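(* The property of being $\mathbb{Q}$-locally irreducible is $\mathcal T$-stable (in the class of all tropical fans). The property of being locally irreducible is $\mathcal T$-stable in the class of unitary tropical fans.
   Context: **Fans.** $N$ is a free abelian group of finite rank, $N_{\mathbb R}=N\otimes\mathbb R$. A rational fan $\Sigma$ in $N_{\mathbb R}$ is a non-empty finite collection of strongly convex rational polyhedral cones, closed under taking faces, any two of which meet in a common face; $|\Sigma|$ is its support, $\Sigma_k$ the set of its $k$-dimensional cones, $\underline 0=\{0\}$; facets are maximal cones. For a cone $\sigma$, $N_\sigma=N\cap\mathrm{span}(\sigma)$ and $N^\sigma=N/N_\sigma$. If $\tau$ is a codimension one face of $\sigma$, $\mathfrak n_{\sigma/\tau}\in N_\sigma$ denotes any vector lying on the same side of $\mathrm{span}(\tau)$ as $\sigma$ with $N_\tau+\mathbb Z\,\mathfrak n_{\sigma/\tau}=N_\sigma$, and $e^\tau_\sigma$ is its image in $N^\tau$. The star fan $\Sigma^\sigma$ is the fan in $N^\sigma_{\mathbb R}$ formed by the images $\eta^\sigma$ of the cones $\eta\in\Sigma$ containing $\sigma$. **Tropical fans.** For $K\in\{\mathbb Z,\mathbb Q\}$, $\mathrm{MW}_p(\Sigma,K)$ is the group of Minkowski weights: maps $w\colon\Sigma_p\to K$ with $\sum_{\sigma\supset\tau,\,\sigma\in\Sigma_p}w(\sigma)e^\tau_\sigma=0$ in $N^\tau\otimes K$ for all $\tau\in\Sigma_{p-1}$; $\mathrm{MW}_p(\Sigma)=\mathrm{MW}_p(\Sigma,\mathbb Z)$. A tropical fan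 $(\Sigma,\omega_\Sigma)$ of dimension $d$ is a rational fan of pure dimension $d$ with an orientation, i.e. an element $\omega_\Sigma\in\mathrm{MW}_d(\Sigma)$ taking only non-zero values. Star fans carry the induced orientation $\omega_{\Sigma^\sigma}(\eta^\sigma)=\omega_\Sigma(\eta)$; products carry $\omega(\sigma\times\sigma')=\omega_\Sigma(\sigma)\omega_{\Sigma'}(\sigma')$. Tropical fans are considered up to isomorphism (integral linear isomorphisms of the lattices $N\cap\mathrm{span}|\Sigma|$ matching cones and orientations). A tropical fan is unitary if $\omega_\Sigma$ only takes values $\pm1$. **Local irreducibility.** A tropical fan $\Sigma$ of dimension $d$ is locally irreducible if $\mathrm{MW}_{d-\dim\sigma}(\Sigma^\sigma)=\mathbb Z\,\omega_{\Sigma^\sigma}$ for every $\sigma\in\Sigma$, and $\mathbb Q$-locally irreducible if $\mathrm{MW}_{d-\dim\sigma}(\Sigma^\sigma,\mathbb Q)=\mathbb Q\,\omega_{\Sigma^\sigma}$ for every $\sigma\in\Sigma$. **Meromorphic functions, divisors, tropical modifications.** A meromorphic function $f$ on $\Sigma$ is a continuous function $|\Sigma|\to\mathbb R$ whose restriction to each cone $\sigma$ is given by an integral linear form $f_\sigma\in\mathrm{Hom}(N_\sigma,\mathbb Z)$. For $\tau\in\Sigma_{d-1}$, $\mathrm{ord}_\tau(f)=-\sum_{\sigma\supset\tau}\omega_\Sigma(\sigma)f_\sigma(\mathfrak n_{\sigma/\tau})+f_\tau\bigl(\sum_{\sigma\supset\tau}\omega_\Sigma(\sigma)\mathfrak n_{\sigma/\tau}\bigr)$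 (sums over $\sigma\in\Sigma_d$), and $\mathrm{div}(f)\in\mathrm{MW}_{d-1}(\Sigma)$ is $\tau\mapsto\mathrm{ord}_\tau(f)$. When not identically zero, $\mathrm{div}(f)$ is identified with the tropical fan $\Delta$ consisting of all $\tau\in\Sigma_{d-1}$ with $\mathrm{ord}_\tau(f)\ne0$ and their faces, oriented by $\mathrm{ord}(f)$; when zero, $\mathrm{div}(f)$ is called trivial and $\Delta=\varnothing$. The tropical modification $\mathrm{TM}_f(\Sigma)$ is the tropical fan in $(N\times\mathbb Z)_{\mathbb R}$ with cones $\sigma_o=\{(x,f(x)):x\in\sigma\}$ for $\sigma\in\Sigma$ and $\delta_\uparrow=\delta_o+\mathbb R_{\ge0}(0,1)$ for $\delta\in\Delta$, with orientation $\sigma_o\mapsto\omega_\Sigma(\sigma)$ ($\sigma\in\Sigma_d$), $\delta_\uparrow\mapsto\mathrm{ord}_\delta(f)$ ($\delta\in\Delta_{d-1}$). **Blow-ups.** For $\sigma\in\Sigma$ and a rational ray $\rho$ in the relative interior of $\sigma$, the blow-up (stellar subdivision) $\Sigma_{(\rho)}$ is obtained by removing all cones containing $\sigma$ and adding the cones $\tau+\rho$ for $\tau$ a face, not containing $\sigma$, of some $\eta\in\Sigma$ with $\eta\supseteq\sigma$; each facet gets the weight of the facet of $\Sigma$ containing it. $\Sigma$ is then the blow-down of $\Sigma_{(\rho)}$ along $\rho$. **$\mathcal T$-stability.** Let $\mathscr C$ be a class of tropical fans. A subclass $\mathscr S\subseteq\mathscr C$ is $\mathcal T$-stable in $\mathscr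 C$ if: (i) if $\Sigma,\Sigma'\in\mathscr S$ and $\Sigma\times\Sigma'\in\mathscr C$, then $\Sigma\times\Sigma'\in\mathscr S$; (ii) if $\Sigma\in\mathscr S$, $f$ is meromorphic on $\Sigma$ with $\mathrm{div}(f)$ trivial or in $\mathscr S$, and $\mathrm{TM}_f(\Sigma)\in\mathscr C$, then $\mathrm{TM}_f(\Sigma)\in\mathscr S$; (iii) if $\Sigma\in\mathscr C$, $\sigma\in\Sigma$, $\rho$ is a rational ray in the relative interior of $\sigma$, $\Sigma^\sigma\in\mathscr S$ and $\Sigma_{(\rho)}\in\mathscr C$, then $\Sigma\in\mathscr S\Leftrightarrow\Sigma_{(\rho)}\in\mathscr S$. A property is $\mathcal T$-stable in $\mathscr C$ if the subclass of elements of $\mathscr C$ having it is; "$\mathcal T$-stable" alone means in the class of all tropical fans. *)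

theory Defs
  imports "HOL-Analysis.Analysis" "HOL-Analysis.Finite_Function_Topology"
begin

section \<open>Lattices and rational fans\<close>

text \<open>
  A free abelian group \<open>N\<close> of finite rank is given as a subgroup, generated by finitely many
  linearly independent vectors, of a real vector space, so that its span is
  \<open>N \<otimes> \<real>\<close>.  The ambient real vector space may be larger than that span.
\<close>

definition is_lattice :: "'a::real_vector set \<Rightarrow> bool" where
  "is_lattice N \<longleftrightarrow>
     (\<exists>B. finite B \<and> independent B \<and> N = {\<Sum>b\<in>B. of_int (c b) *\<^sub>R b | c :: 'a \<Rightarrow> int. True})"

definition rational_polyhedral_cone :: "'a::real_vector set \<Rightarrow> 'a set \<Rightarrow> bool" where
  "rational_polyhedral_cone N \<sigma> \<longleftrightarrow> (\<exists>G. finite G \<and> G \<subseteq> N \<and> \<sigma> = convex_cone hull G)"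

definition strongly_convex :: "'a::real_vector set \<Rightarrow> bool" where
  "strongly_convex \<sigma> \<longleftrightarrow> \<sigma> \<inter> uminus ` \<sigma> = {0}"

text \<open>
  The orientation is a real-valued function on cones; only its values on the
  top-dimensional cones matter, and these are required to be integers in \<open>tropical_fan\<close>.
\<close>

record 'a ofan =
  lat :: "'a set"
  cones :: "'a set set"
  ori :: "'a set \<Rightarrow> real"

text \<open>
  The library's notion of face admits the empty set, which is not a face of a cone
  and has to be excluded.
\<close>

definition rational_fan :: "('a::real_vector, 'm) ofan_scheme \<Rightarrow> bool" where
  "rational_fan F \<longleftrightarrow>
     is_lattice (lat F) \<and> finite (cones F) \<and> cones F \<noteq> {} \<and>
     (\<forall>\<sigma>\<in>cones F. rational_polyhedral_cone (lat F) \<sigma> \<and> strongly_convex \<sigma>) \<and>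
     (\<forall>\<sigma>\<in>cones F. \<forall>\<tau>. \<tau> face_of \<sigma> \<and> \<tau> \<noteq> {} \<longrightarrow> \<tau> \<in> cones F) \<and>
     (\<forall>\<sigma>\<in>cones F. \<forall>\<eta>\<in>cones F. \<sigma> \<inter> \<eta> face_of \<sigma> \<and> \<sigma> \<inter> \<eta> face_of \<eta>)"

definition supp :: "('a::real_vector, 'm) ofan_scheme \<Rightarrow> 'a set" where
  "supp F = \<Union> (cones F)"

definition cones_of_dim :: "('a::real_vector, 'm) ofan_scheme \<Rightarrow> nat \<Rightarrow> 'a set set" where
  "cones_of_dim F k = {\<sigma> \<in> cones F. dim \<sigma> = k}"

definition facets :: "('a::real_vector, 'm) ofan_scheme \<Rightarrow> 'a set set" where
  "facets F = {\<sigma> \<in> cones F. \<forall>\<eta>\<in>cones F. \<sigma> \<subseteq> \<eta> \<longrightarrow> \<eta> = \<sigma>}"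

definition fan_dim :: "('a::real_vector, 'm) ofan_scheme \<Rightarrow> nat" where
  "fan_dim F = Max (dim ` cones F)"

text \<open>For a cone \<open>\<sigma>\<close>, this is \<open>N\<^sub>\<sigma>\<close>.\<close>

definition sublat :: "'a::real_vector set \<Rightarrow> 'a set \<Rightarrow> 'a set" where
  "sublat N \<sigma> = N \<inter> span \<sigma>"


section \<open>Minkowski weights and tropical fans\<close>

text \<open>
  The vectors that can serve as \<open>\<nn>\<^bsub>\<sigma>/\<tau>\<^esub>\<close>, for \<open>\<tau>\<close> a
  face of codimension one of \<open>\<sigma>\<close>.  The vectors on the same side of the span of \<open>\<tau>\<close> as
  \<open>\<sigma>\<close> are those congruent, modulo this span, to a point of \<open>\<sigma>\<close> not in this span.
\<close>

definition is_normal_vector :: "'a::real_vector set \<Rightarrow> 'a set \<Rightarrow> 'a set \<Rightarrow> 'a \<Rightarrow> bool" where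
  "is_normal_vector N \<sigma> \<tau> v \<longleftrightarrow>
     v \<in> sublat N \<sigma> \<and> (\<exists>x \<in> \<sigma> - span \<tau>. v - x \<in> span \<tau>) \<and>
     {x + of_int k *\<^sub>R v | x (k::int). x \<in> sublat N \<tau>} = sublat N \<sigma>"

definition normal_vector :: "'a::real_vector set \<Rightarrow> 'a set \<Rightarrow> 'a set \<Rightarrow> 'a" where
  "normal_vector N \<sigma> \<tau> = (SOME v. is_normal_vector N \<sigma> \<tau> v)"

text \<open>
  The set \<open>K\<close> is \<open>\<int>\<close> or \<open>\<rat>\<close>.  As \<open>N\<^sup>\<tau> = N / N\<^sub>\<tau>\<close> is free, \<open>N\<^sup>\<tau> \<otimes> K\<close> embeds
  into \<open>N\<^sup>\<tau> \<otimes> \<real> = span N / span \<tau>\<close>; a combination of the \<open>e\<^sup>\<tau>\<^sub>\<sigma>\<close> is therefore zero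
  exactly if the same combination of the normal vectors lies in \<open>span \<tau>\<close>.  Weights are
  functions on the \<open>p\<close>-dimensional cones only, hence extensional.
\<close>

definition minkowski_weights ::
    "('a::real_vector, 'm) ofan_scheme \<Rightarrow> real set \<Rightarrow> nat \<Rightarrow> ('a set \<Rightarrow> real) set" where
  "minkowski_weights F K p =
     {w \<in> cones_of_dim F p \<rightarrow>\<^sub>E K.
        \<forall>\<tau>\<in>cones F. Suc (dim \<tau>) = p \<longrightarrow>
          (\<Sum>\<sigma> | \<sigma> \<in> cones_of_dim F p \<and> \<tau> \<subseteq> \<sigma>. w \<sigma> *\<^sub>R normal_vector (lat F) \<sigma> \<tau>) \<in> span \<tau>}"

definition tropical_fan :: "('a::real_vector, 'm) ofan_scheme \<Rightarrow> bool" where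
  "tropical_fan F \<longleftrightarrow>
     rational_fan F \<and>
     (\<forall>\<sigma>\<in>facets F. dim \<sigma> = fan_dim F) \<and>
     restrict (ori F) (cones_of_dim F (fan_dim F)) \<in> minkowski_weights F \<int> (fan_dim F) \<and>
     (\<forall>\<sigma>\<in>cones_of_dim F (fan_dim F). ori F \<sigma> \<noteq> 0)"

definition unitary :: "('a::real_vector, 'm) ofan_scheme \<Rightarrow> bool" where
  "unitary F \<longleftrightarrow> (\<forall>\<sigma>\<in>cones_of_dim F (fan_dim F). ori F \<sigma> \<in> {1, -1})"

definition fan_iso :: "('a::real_vector, 'm) ofan_scheme \<Rightarrow> ('b::real_vector, 'n) ofan_scheme \<Rightarrow> bool" where
  "fan_iso F G \<longleftrightarrow>
     (\<exists>\<phi>. linear \<phi> \<and>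
        bij_betw \<phi> (lat F \<inter> span (supp F)) (lat G \<inter> span (supp G)) \<and>
        bij_betw (image \<phi>) (cones F) (cones G) \<and>
        (\<forall>\<sigma>\<in>cones_of_dim F (fan_dim F). ori G (\<phi> ` \<sigma>) = ori F \<sigma>))"


section \<open>Star fans and local irreducibility\<close>

text \<open>
  The quotient by \<open>span \<sigma>\<close> is realised by a linear map with kernel \<open>span \<sigma>\<close>; the image of
  \<open>N\<close> under it is a copy of \<open>N\<^sup>\<sigma>\<close>, and a different choice of the map gives an isomorphic fan.
\<close>

definition quot_map :: "'a::real_vector set \<Rightarrow> 'a \<Rightarrow> 'a" where
  "quot_map \<sigma> = (SOME p. linear p \<and> {x. p x = 0} = span \<sigma>)"

lemma quot_map_exists:
  fixes \<sigma> :: "'a::real_vector set"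
  shows "\<exists>p :: 'a \<Rightarrow> 'a. linear p \<and> {x. p x = 0} = span \<sigma>"
proof -
  obtain g :: "'a \<Rightarrow> 'a"
    where g: "linear g" "range g \<subseteq> span \<sigma>" "\<And>v. v \<in> span \<sigma> \<Longrightarrow> g v = v"
    using linear_exists_left_inverse_on[OF linear_id subspace_span, of \<sigma>] by auto
  have "linear (\<lambda>x. x - g x)"
    by (intro linear_compose_sub linear_ident g(1))
  moreover have "{x. x - g x = 0} = span \<sigma>"
  proof
    show "{x. x - g x = 0} \<subseteq> span \<sigma>"
    proof
      fix x assume "x \<in> {x. x - g x = 0}"
      then have "x = g x" by simp
      then show "x \<in> span \<sigma>" using g(2) by (metis range_subsetD)
    qed
  qed (use g(3) in auto)
  ultimately show ?thesis by blast
qed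

lemma quot_map:
  shows "linear (quot_map \<sigma>)" and "{x. quot_map \<sigma> x = 0} = span \<sigma>"
  unfolding quot_map_def using someI_ex[OF quot_map_exists[of \<sigma>]] by blast+

definition star_fan :: "('a::real_vector, 'm) ofan_scheme \<Rightarrow> 'a set \<Rightarrow> 'a ofan" where
  "star_fan F \<sigma> =
     \<lparr>lat = quot_map \<sigma> ` lat F,
      cones = {quot_map \<sigma> ` \<eta> | \<eta>. \<eta> \<in> cones F \<and> \<sigma> \<subseteq> \<eta>},
      ori = (\<lambda>\<zeta>. ori F (THE \<eta>. \<eta> \<in> cones F \<and> \<sigma> \<subseteq> \<eta> \<and> quot_map \<sigma> ` \<eta> = \<zeta>))\<rparr>"

definition locally_irreducible_over :: "real set \<Rightarrow> ('a::real_vector, 'm) ofan_scheme \<Rightarrow> bool" where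
  "locally_irreducible_over K F \<longleftrightarrow>
     (\<forall>\<sigma>\<in>cones F.
        minkowski_weights (star_fan F \<sigma>) K (fan_dim F - dim \<sigma>) =
        {\<lambda>\<zeta>\<in>cones_of_dim (star_fan F \<sigma>) (fan_dim F - dim \<sigma>). c * ori (star_fan F \<sigma>) \<zeta> | c. c \<in> K})"

definition locally_irreducible :: "('a::real_vector, 'm) ofan_scheme \<Rightarrow> bool" where
  "locally_irreducible F \<longleftrightarrow> locally_irreducible_over \<int> F"

definition Q_locally_irreducible :: "('a::real_vector, 'm) ofan_scheme \<Rightarrow> bool" where
  "Q_locally_irreducible F \<longleftrightarrow> locally_irreducible_over \<rat> F"


section \<open>Products, tropical modifications, blow-ups\<close>

definition prod_fan ::
    "('a::real_vector, 'm) ofan_scheme \<Rightarrow> ('b::real_vector, 'n) ofan_scheme \<Rightarrow> ('a \<times> 'b) ofan" where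
  "prod_fan F G =
     \<lparr>lat = lat F \<times> lat G,
      cones = {\<sigma> \<times> \<eta> | \<sigma> \<eta>. \<sigma> \<in> cones F \<and> \<eta> \<in> cones G},
      ori = (\<lambda>\<zeta>. ori F (fst ` \<zeta>) * ori G (snd ` \<zeta>))\<rparr>"

definition meromorphic :: "('a::real_normed_vector, 'm) ofan_scheme \<Rightarrow> ('a \<Rightarrow> real) \<Rightarrow> bool" where
  "meromorphic F f \<longleftrightarrow>
     continuous_on (supp F) f \<and>
     (\<forall>\<sigma>\<in>cones F. \<exists>l. linear l \<and> l ` sublat (lat F) \<sigma> \<subseteq> \<int> \<and> (\<forall>x\<in>\<sigma>. l x = f x))"

text \<open>For meromorphic \<open>f\<close> this is \<open>f\<^sub>\<sigma>\<close>; it is uniquely determined on \<open>span \<sigma>\<close>.\<close>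

definition cone_form :: "('a::real_vector \<Rightarrow> real) \<Rightarrow> 'a set \<Rightarrow> 'a \<Rightarrow> real" where
  "cone_form f \<sigma> = (SOME l. linear l \<and> (\<forall>x\<in>\<sigma>. l x = f x))"

definition ord_along :: "('a::real_vector, 'm) ofan_scheme \<Rightarrow> ('a \<Rightarrow> real) \<Rightarrow> 'a set \<Rightarrow> real" where
  "ord_along F f \<tau> =
     (let S = {\<sigma> \<in> cones_of_dim F (fan_dim F). \<tau> \<subseteq> \<sigma>};
          n = (\<lambda>\<sigma>. normal_vector (lat F) \<sigma> \<tau>)
      in - (\<Sum>\<sigma>\<in>S. ori F \<sigma> * cone_form f \<sigma> (n \<sigma>)) + cone_form f \<tau> (\<Sum>\<sigma>\<in>S. ori F \<sigma> *\<^sub>R n \<sigma>))"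

definition div_support :: "('a::real_vector, 'm) ofan_scheme \<Rightarrow> ('a \<Rightarrow> real) \<Rightarrow> 'a set set" where
  "div_support F f = {\<tau> \<in> cones F. Suc (dim \<tau>) = fan_dim F \<and> ord_along F f \<tau> \<noteq> 0}"

definition div_trivial :: "('a::real_vector, 'm) ofan_scheme \<Rightarrow> ('a \<Rightarrow> real) \<Rightarrow> bool" where
  "div_trivial F f \<longleftrightarrow> div_support F f = {}"

text \<open>When the divisor is trivial, this has no cones (and hence is not a fan).\<close>

definition div_fan :: "('a::real_vector, 'm) ofan_scheme \<Rightarrow> ('a \<Rightarrow> real) \<Rightarrow> 'a ofan" where
  "div_fan F f =
     \<lparr>lat = lat F,
      cones = {\<delta>. \<delta> \<noteq> {} \<and> (\<exists>\<tau>\<in>div_support F f. \<delta> face_of \<tau>)},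
      ori = ord_along F f\<rparr>"

definition graph_cone :: "('a \<Rightarrow> real) \<Rightarrow> 'a set \<Rightarrow> ('a \<times> real) set" where
  "graph_cone f \<sigma> = {(x, f x) | x. x \<in> \<sigma>}"

definition up_cone :: "('a \<Rightarrow> real) \<Rightarrow> 'a set \<Rightarrow> ('a \<times> real) set" where
  "up_cone f \<delta> = {(x, f x + t) | x t. x \<in> \<delta> \<and> 0 \<le> t}"

text \<open>Both kinds of cones are mapped back to \<open>\<sigma>\<close> and \<open>\<delta>\<close> by the first projection.\<close>

definition tropical_modification ::
    "('a::real_vector, 'm) ofan_scheme \<Rightarrow> ('a \<Rightarrow> real) \<Rightarrow> ('a \<times> real) ofan" where
  "tropical_modification F f =
     \<lparr>lat = lat F \<times> \<int>,
      cones = graph_cone f ` cones F \<union> up_cone f ` cones (div_fan F f),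
      ori = (\<lambda>\<zeta>. if \<zeta> \<in> graph_cone f ` cones F then ori F (fst ` \<zeta>)
                 else ord_along F f (fst ` \<zeta>))\<rparr>"

definition rational_ray :: "'a::real_vector set \<Rightarrow> 'a set \<Rightarrow> bool" where
  "rational_ray N \<rho> \<longleftrightarrow> (\<exists>v\<in>N. v \<noteq> 0 \<and> \<rho> = {t *\<^sub>R v | t. 0 \<le> t})"

text \<open>A ray lies in the relative interior of a cone if all its points other than its apex do.\<close>

definition ray_in_interior ::
    "('a::real_normed_vector, 'm) ofan_scheme \<Rightarrow> 'a set \<Rightarrow> 'a set \<Rightarrow> bool" where
  "ray_in_interior F \<sigma> \<rho> \<longleftrightarrow> rational_ray (lat F) \<rho> \<and> \<rho> - {0} \<subseteq> rel_interior \<sigma>"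

definition blow_up ::
    "('a::real_vector, 'm) ofan_scheme \<Rightarrow> 'a set \<Rightarrow> 'a set \<Rightarrow> 'a ofan" where
  "blow_up F \<sigma> \<rho> =
     \<lparr>lat = lat F,
      cones = {\<eta> \<in> cones F. \<not> \<sigma> \<subseteq> \<eta>} \<union>
              {{x + y | x y. x \<in> \<tau> \<and> y \<in> \<rho>} | \<tau>.
                 \<tau> \<noteq> {} \<and> \<not> \<sigma> \<subseteq> \<tau> \<and> (\<exists>\<eta>\<in>cones F. \<sigma> \<subseteq> \<eta> \<and> \<tau> face_of \<eta>)},
      ori = (\<lambda>\<zeta>. ori F (THE \<eta>. \<eta> \<in> facets F \<and> \<zeta> \<subseteq> \<eta>))\<rparr>"


section \<open>T-stability\<close>

text \<open>
  Tropical fans being considered up to isomorphism, a class of tropical fans is represented by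
  a set, closed under isomorphism, of tropical fans in the space of finitely supported real
  sequences.  This space contains lattices of every finite rank, so every tropical fan, in
  whatever space, is isomorphic to one there.
\<close>

type_synonym universe = "nat \<Rightarrow>\<^sub>0 real"

definition fan_class :: "universe ofan set \<Rightarrow> bool" where
  "fan_class C \<longleftrightarrow>
     (\<forall>F\<in>C. tropical_fan F) \<and>
     (\<forall>F\<in>C. \<forall>G. tropical_fan G \<and> fan_iso F G \<longrightarrow> G \<in> C)"

text \<open>Membership in a class, for a fan living in an arbitrary space.\<close>

definition in_class :: "('b::real_vector, 'm) ofan_scheme \<Rightarrow> universe ofan set \<Rightarrow> bool" where
  "in_class F C \<longleftrightarrow> (\<exists>G\<in>C. fan_iso F G)"

definition T_stable_in :: "universe ofan set \<Rightarrow> universe ofan set \<Rightarrow> bool" where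
  "T_stable_in C S \<longleftrightarrow>
     fan_class C \<and> fan_class S \<and> S \<subseteq> C \<and>
     (\<forall>F\<in>S. \<forall>F'\<in>S. in_class (prod_fan F F') C \<longrightarrow> in_class (prod_fan F F') S) \<and>
     (\<forall>F\<in>S. \<forall>f. meromorphic F f \<and> (div_trivial F f \<or> in_class (div_fan F f) S) \<and>
        in_class (tropical_modification F f) C \<longrightarrow> in_class (tropical_modification F f) S) \<and>
     (\<forall>F\<in>C. \<forall>\<sigma>\<in>cones F. \<forall>\<rho>. ray_in_interior F \<sigma> \<rho> \<and> in_class (star_fan F \<sigma>) S \<and>
        in_class (blow_up F \<sigma> \<rho>) C \<longrightarrow> (F \<in> S \<longleftrightarrow> in_class (blow_up F \<sigma> \<rho>) S))"

definition T_stable_property ::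
    "(universe ofan \<Rightarrow> bool) \<Rightarrow> universe ofan set \<Rightarrow> bool" where
  "T_stable_property P C \<longleftrightarrow> T_stable_in C {F \<in> C. P F}"

definition all_tropical_fans :: "universe ofan set" where
  "all_tropical_fans = {F. tropical_fan F}"

definition unitary_tropical_fans :: "universe ofan set" where
  "unitary_tropical_fans = {F. tropical_fan F \<and> unitary F}"

end

theory Submission
  imports Defs
begin

text \<open>
  Being irreducible over \<open>K\<close> means that near every cone the balanced \<open>K\<close>-valued weights on the top
  cones are the multiples of the orientation.

  On a product, such a weight is a multiple of the first orientation for each fixed top cone of the second
  factor, and the multiplicities form a balanced weight on the second factor.  On a tropical modification,
  the weights on the graph are balanced on the original fan, hence multiples of its orientation, and the
  balancing condition in the new coordinate then forces the weights of the vertical cones to be the same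
  multiple of the order of \<open>f\<close>; near a vertical cone one sees the balanced weights of the divisor.

  For blow-ups, irreducibility depends only on the weighted support.  A balanced weight on a subdivision
  takes the same value on any two pieces of a top cone that meet: they are joined by a generic path
  inside the cone, which crosses only walls with exactly two pieces on opposite sides.  Hence balanced weights
  near a point are the same on a fan and on its subdivision.
\<close>

section \<open>Dimension counts for finitely spanned subsets of an arbitrary real vector
  space\<close>

section \<open>Dimension in a real vector space\<close>

text \<open>Membership in a class only says that a product, modification, divisor or blow-up is
  isomorphic to a tropical fan of the class, and an isomorphism is a linear map that is bijective on
  lattice points. So \<open>rigid\<close> is formulated for arbitrary fan data and moved along
  isomorphisms under the weak condition \<open>lattice_spanned\<close>, which each construction
  satisfies by inspection; whatever else is needed of the fan axioms is pulled back from the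
  isomorphic copy. That injectivity on lattice points extends to real spans is not linear algebra:
  the map sending (a, b) to a + b sqrt 2 is injective on integer pairs but not on real ones.
  Discreteness of the target lattice excludes this. Most of the argument takes place in a space
  without topology. Separating functionals replace it: closedness is used along lines only, and
  interior points are points that lie in no proper face. Integral and rational coefficients are one
  case. The multiplier always comes from the rigidity of an input, hence lies in \<open>K\<close>;
  division by an orientation occurs only inside balancing conditions, which are real linear.\<close>

definition fin_dim :: "'a::real_vector set \<Rightarrow> bool" where
  "fin_dim S \<longleftrightarrow> (\<exists>B. finite B \<and> S \<subseteq> span B)"

lemma fin_dim_finite: "finite S \<Longrightarrow> fin_dim S"
  unfolding fin_dim_def using span_superset by blast

lemma fin_dim_mono: "fin_dim T \<Longrightarrow> S \<subseteq> span T \<Longrightarrow> fin_dim S"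
  unfolding fin_dim_def by (meson span_minimal subspace_span subset_trans)

lemma fin_dim_insert: "fin_dim S \<Longrightarrow> fin_dim (insert x S)"
proof -
  assume "fin_dim S"
  then obtain B where "finite B" "S \<subseteq> span B" by (auto simp: fin_dim_def)
  then have "finite (insert x B)" "insert x S \<subseteq> span (insert x B)"
    using span_mono[of B "insert x B"] by (auto intro: span_base)
  then show ?thesis unfolding fin_dim_def by blast
qed

lemma fin_dim_image: "fin_dim S \<Longrightarrow> linear f \<Longrightarrow> fin_dim (f ` S)"
  unfolding fin_dim_def by (metis finite_imageI image_mono linear_span_image)

text \<open>\<open>dim\<close> is the cardinality of a basis, which is 0 for an infinite one.
  \<open>fin_dim\<close> excludes this, and the dimension counts below rest on the finite basis
  found here.\<close>

lemma fin_dim_basis: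
  assumes "fin_dim S"
  obtains B where "B \<subseteq> S" "finite B" "independent B" "span B = span S" "card B = dim S"
proof -
  obtain B where B: "B \<subseteq> S" "independent B" "S \<subseteq> span B" "card B = dim S"
    using basis_exists by blast
  obtain A where A: "finite A" "S \<subseteq> span A" using assms by (auto simp: fin_dim_def)
  have "finite B" using independent_span_bound[OF A(1) B(2)] A B by blast
  moreover have "span B = span S"
    using B by (simp add: span_eq subset_trans[OF B(1) span_superset])
  ultimately show ?thesis using that B by blast
qed

lemma dim_mono_fin:
  assumes "fin_dim T" "S \<subseteq> span T"
  shows "dim S \<le> dim T"
proof -
  obtain B where "finite B" "span B = span T" "card B = dim T"
    using fin_dim_basis[OF assms(1)] by metis
  then show ?thesis using dim_le_card[of S B] assms by auto
qed

lemma dim_insert_fin: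
  assumes "fin_dim S" "x \<notin> span S"
  shows "dim (insert x S) = Suc (dim S)"
proof -
  obtain B where B: "finite B" "independent B" "span B = span S" "card B = dim S"
    using fin_dim_basis[OF assms(1)] by metis
  have "independent (insert x B)"
    using B assms by (simp add: independent_insertI)
  moreover have "span (insert x B) = span (insert x S)"
    using B by (simp add: span_insert)
  moreover have "x \<notin> B" using B assms span_base by blast
  ultimately show ?thesis using B dim_eq_card[of "insert x B" "insert x S"] by simp
qed

lemma span_eq_of_dim:
  assumes "fin_dim T" "S \<subseteq> span T" "dim T \<le> dim S"
  shows "span S = span T"
proof (rule ccontr)
  assume "span S \<noteq> span T"
  then obtain t where t: "t \<in> span T" "t \<notin> span S"
    using assms(2) span_minimal[OF assms(2)] by auto
  have "Suc (dim S) = dim (insert t S)"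
    using dim_insert_fin[OF fin_dim_mono[OF assms(1,2)] t(2)] by simp
  also have "\<dots> \<le> dim T"
    by (rule dim_mono_fin) (use assms t in auto)
  finally show False using assms(3) by simp
qed

lemma dim_image_inj_on:
  assumes "fin_dim S" "linear f" "inj_on f (span S)"
  shows "dim (f ` S) = dim S"
proof -
  obtain B where B: "B \<subseteq> S" "finite B" "independent B" "span B = span S" "card B = dim S"
    using fin_dim_basis[OF assms(1)] by metis
  have "independent (f ` B)"
    using B assms by (intro linear_independent_injective_image) auto
  moreover have "span (f ` B) = span (f ` S)"
    by (simp add: linear_span_image assms B)
  moreover have "card (f ` B) = card B"
    using B assms(3) by (intro card_image) (metis inj_on_subset span_superset)
  ultimately show ?thesis using B dim_eq_card by metis
qed

text \<open>Rank-nullity for a map whose kernel is known on \<open>span T\<close> only. Vectors of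
  \<open>T\<close> are adjoined to \<open>S\<close> one at a time; each raises the dimension of the
  set and of its image together, or neither.\<close>

lemma dim_quotient:
  assumes "linear q" "fin_dim T" "S \<subseteq> T" and ker: "\<And>x. x \<in> span T \<Longrightarrow> q x = 0 \<longleftrightarrow> x \<in> span S"
  shows "dim (q ` T) + dim S = dim T"
proof -
  have fS: "fin_dim S" using assms fin_dim_mono span_superset by blast
  have *: "dim (q ` (S \<union> E)) + dim S = dim (S \<union> E)" if "finite E" "E \<subseteq> T" for E
    using that
  proof (induction E)
    case empty
    have "q ` S \<subseteq> {0}" using ker assms(3) span_superset by fastforce
    then have "dim (q ` S) \<le> dim {0::'b}"
      by (intro dim_mono_fin) (auto simp: fin_dim_finite)
    also have "dim {0::'b} = 0"
      using dim_eq_card[of "{}" "{0::'b}"] by (simp add: independent_empty)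
    finally show ?case by simp
  next
    case (insert e E)
    have ET: "E \<subseteq> T" "e \<in> T" using insert.prems by auto
    have f: "fin_dim (S \<union> E)"
      by (rule fin_dim_mono[OF assms(2)]) (use ET assms(3) span_superset in blast)
    have IH: "dim (q ` (S \<union> E)) + dim S = dim (S \<union> E)" using insert.IH ET by blast
    have sub: "span (S \<union> E) \<subseteq> span T" using ET assms(3) by (intro span_mono) auto
    show ?case
    proof (cases "e \<in> span (S \<union> E)")
      case True
      then have "span (S \<union> insert e E) = span (S \<union> E)" by (simp add: span_redundant)
      then have "dim (q ` (S \<union> insert e E)) = dim (q ` (S \<union> E))" "dim (S \<union> insert e E) = dim (S \<union> E)"
        by (intro span_eq_dim; simp only: linear_span_image[OF assms(1)])+
      then show ?thesis using IH by simp
    next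
      case False
      \<comment> \<open>Otherwise \<open>e\<close> would differ from a vector of
        \<open>span (S \<union> E)\<close> by a kernel vector, which lies in
        \<open>span S\<close>.\<close>
      have "q e \<notin> span (q ` (S \<union> E))"
      proof
        assume "q e \<in> span (q ` (S \<union> E))"
        then obtain y where y: "y \<in> span (S \<union> E)" "q e = q y"
          unfolding linear_span_image[OF assms(1)] by blast
        have "q (e - y) = 0" using y assms(1) by (simp add: linear_diff)
        moreover have "e - y \<in> span T" using y sub ET by (intro span_diff) (auto intro: span_base)
        ultimately have "e - y \<in> span S" using ker by blast
        then have "e - y \<in> span (S \<union> E)" using span_mono[of S "S \<union> E"] by auto
        then show False using False y(1) span_add by fastforce
      qed
      then show ?thesis
        using IH False dim_insert_fin[OF f] dim_insert_fin[OF fin_dim_image[OF f assms(1)]] by simp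
    qed
  qed
  obtain B where B: "B \<subseteq> T" "finite B" "span B = span T"
    using fin_dim_basis[OF assms(2)] by metis
  have s: "span (S \<union> B) = span T"
  proof
    show "span (S \<union> B) \<subseteq> span T" using B(1) assms(3) by (intro span_mono) auto
    show "span T \<subseteq> span (S \<union> B)" unfolding B(3)[symmetric] by (intro span_mono) auto
  qed
  then have "span (q ` (S \<union> B)) = span (q ` T)"
    by (simp add: linear_span_image assms)
  then show ?thesis using *[OF B(2,1)] s span_eq_dim[of "S \<union> B" T] span_eq_dim[of "q ` (S \<union> B)" "q ` T"] by simp
qed

lemma fin_dim_Times: "fin_dim S \<Longrightarrow> fin_dim T \<Longrightarrow> fin_dim (S \<times> T)"
proof -
  assume "fin_dim S" "fin_dim T"
  then have 1: "fin_dim ((\<lambda>x. (x, 0::'b)) ` S)" and 2: "fin_dim ((\<lambda>x. (0::'a, x)) ` T)"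
    by (auto intro!: fin_dim_image linearI)
  then obtain B C where BC: "finite B" "finite C"
    "(\<lambda>x. (x, 0::'b)) ` S \<subseteq> span B" "(\<lambda>x. (0::'a, x)) ` T \<subseteq> span C"
    by (auto simp: fin_dim_def)
  have "(x, y) \<in> span (B \<union> C)" if "x \<in> S" "y \<in> T" for x y
  proof -
    have "(x, 0) \<in> span (B \<union> C)" "(0, y) \<in> span (B \<union> C)"
      using BC that span_mono[of B "B \<union> C"] span_mono[of C "B \<union> C"] by auto
    then have "(x, 0) + (0, y) \<in> span (B \<union> C)" by (rule span_add)
    then show ?thesis by simp
  qed
  then show ?thesis using BC unfolding fin_dim_def by (intro exI[of _ "B \<union> C"]) auto
qed

text \<open>With 0 in both sets the two axis slices lie in the product, and a pair is the sum of its
  axis components.\<close>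

lemma span_Times:
  assumes "0 \<in> S" "0 \<in> T"
  shows "span (S \<times> T) = span S \<times> span T"
proof
  show "span (S \<times> T) \<subseteq> span S \<times> span T"
    by (intro span_minimal subspace_Times) (auto intro: span_base)
  show "span S \<times> span T \<subseteq> span (S \<times> T)"
  proof clarify
    fix x y assume xy: "x \<in> span S" "y \<in> span T"
    have "(x, 0) \<in> span ((\<lambda>x. (x, 0::'b)) ` S)" "(0, y) \<in> span ((\<lambda>y. (0::'a, y)) ` T)"
      using xy by (subst linear_span_image; auto intro!: linearI)+
    moreover have "(\<lambda>x. (x, 0::'b)) ` S \<subseteq> S \<times> T" "(\<lambda>y. (0::'a, y)) ` T \<subseteq> S \<times> T"
      using assms by auto
    ultimately have "(x, 0) \<in> span (S \<times> T)" "(0, y) \<in> span (S \<times> T)"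
      using span_mono by blast+
    then have "(x, 0) + (0, y) \<in> span (S \<times> T)" by (rule span_add)
    then show "(x, y) \<in> span (S \<times> T)" by simp
  qed
qed

text \<open>The second projection has kernel \<open>S \<times> {0}\<close> inside the span, so the
  count for quotients applies.\<close>

lemma dim_Times_fin:
  assumes "fin_dim S" "fin_dim T" "0 \<in> S" "0 \<in> T"
  shows "dim (S \<times> T) = dim S + dim T"
proof -
  let ?i = "\<lambda>x. (x, 0::'b)"
  have li: "linear ?i" by (auto intro!: linearI)
  have sub: "S \<times> {0} \<subseteq> S \<times> T" using assms by auto
  have "dim (snd ` (S \<times> T)) + dim (S \<times> {0::'b}) = dim (S \<times> T)"
  proof (rule dim_quotient[OF linear_snd fin_dim_Times[OF assms(1,2)] sub])
    fix x assume "x \<in> span (S \<times> T)"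
    then show "snd x = 0 \<longleftrightarrow> x \<in> span (S \<times> {0::'b})"
      using assms by (auto simp: span_Times)
  qed
  moreover have "snd ` (S \<times> T) = T" using assms by force
  moreover have "S \<times> {0::'b} = ?i ` S" by auto
  moreover have "dim (?i ` S) = dim S"
    by (rule dim_image_inj_on[OF assms(1) li]) (auto intro: inj_onI)
  ultimately show ?thesis by simp
qed

section \<open>Convex cones: additive description of faces, generic points, interior points\<close>

section \<open>Cones and their faces\<close>

lemma convex_cone_sum:
  "finite I \<Longrightarrow> convex_cone C \<Longrightarrow> (\<And>i. i \<in> I \<Longrightarrow> x i \<in> C) \<Longrightarrow> (\<Sum>i\<in>I. x i) \<in> C"
  by (induction I rule: finite_induct) (auto intro: convex_cone_add convex_cone_contains_0)

text \<open>Negative multiples of a difference arise by exchanging its two terms, so the differences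
  already form a subspace.\<close>

lemma span_convex_cone:
  assumes "convex_cone C"
  shows "span C = {x - y | x y. x \<in> C \<and> y \<in> C}"
proof (rule span_unique)
  show "C \<subseteq> {x - y | x y. x \<in> C \<and> y \<in> C}"
    using convex_cone_contains_0[OF assms] by (force intro: exI[of _ 0])
  show "subspace {x - y | x y. x \<in> C \<and> y \<in> C}"
    unfolding subspace_def
  proof (intro conjI ballI allI)
    show "0 \<in> {x - y |x y. x \<in> C \<and> y \<in> C}" using convex_cone_contains_0[OF assms] by force
  next
    fix u v assume "u \<in> {x - y |x y. x \<in> C \<and> y \<in> C}" "v \<in> {x - y |x y. x \<in> C \<and> y \<in> C}"
    then obtain a b c d where "u = a - b" "v = c - d" "a \<in> C" "b \<in> C" "c \<in> C" "d \<in> C" by blast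
    then have "u + v = (a + c) - (b + d)" "a + c \<in> C" "b + d \<in> C"
      using assms by (auto intro: convex_cone_add)
    then show "u + v \<in> {x - y |x y. x \<in> C \<and> y \<in> C}" by blast
  next
    fix c :: real and u assume "u \<in> {x - y |x y. x \<in> C \<and> y \<in> C}"
    then obtain a b where ab: "u = a - b" "a \<in> C" "b \<in> C" by blast
    show "c *\<^sub>R u \<in> {x - y |x y. x \<in> C \<and> y \<in> C}"
    proof (cases "c \<ge> 0")
      case True
      then have "c *\<^sub>R u = c *\<^sub>R a - c *\<^sub>R b" "c *\<^sub>R a \<in> C" "c *\<^sub>R b \<in> C"
        using ab assms by (auto intro: convex_cone_scaleR simp: scaleR_diff_right)
      then show ?thesis by blast
    next
      case False
      then have "(-c) *\<^sub>R a \<in> C" "(-c) *\<^sub>R b \<in> C"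
        using ab assms convex_cone_scaleR[of C "- c"] by simp_all
      moreover have "c *\<^sub>R u = (-c) *\<^sub>R b - (-c) *\<^sub>R a" using ab by (simp add: scaleR_diff_right)
      ultimately
      show ?thesis by blast
    qed
  qed
next
  fix U assume "C \<subseteq> U" "subspace U"
  then show "{x - y | x y. x \<in> C \<and> y \<in> C} \<subseteq> U"
    by (auto intro: subspace_diff)
qed

lemma convex_cone_face:
  assumes "convex_cone C" "T face_of C" "T \<noteq> {}"
  shows "convex_cone T"
  using assms face_of_conic face_of_imp_convex unfolding convex_cone_def by blast

text \<open>Faces are defined by open segments. In a cone the midpoint of \<open>x\<close> and
  \<open>y\<close> is half their sum, which turns the definition into this additive form.\<close>

lemma face_of_add:
  assumes "convex_cone C" "T face_of C" "x \<in> C" "y \<in> C" "x + y \<in> T"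
  shows "x \<in> T"
proof -
  have T: "convex_cone T" using convex_cone_face assms by blast
  have m: "(1/2) *\<^sub>R (x + y) \<in> T" by (rule convex_cone_scaleR[OF T]) (use assms in auto)
  show ?thesis
  \<comment> \<open>An open segment with equal ends is empty, so the face property gives nothing
    when \<open>x = y\<close>.\<close>
  proof (cases "x = y")
    case True
    then have "x + y = 2 *\<^sub>R x" by (simp add: scaleR_2)
    then have "(1/2) *\<^sub>R (x + y) = x" by simp
    then show ?thesis using m by simp
  next
    case False
    have "(1/2) *\<^sub>R (x + y) \<in> open_segment x y"
      unfolding in_segment(2) by (intro conjI False exI[of _ "1/2"]) (simp_all add: scaleR_add_right)
    then show ?thesis using assms m unfolding face_of_def by blast
  qed
qed

text \<open>Converse of the additive description: a point inside a segment is the sum of rescaled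
  end points, and scaling back stays in the cone \<open>T\<close>.\<close>

lemma face_of_coneI:
  assumes "convex_cone C" "convex_cone T" "T \<subseteq> C"
    and "\<And>x y. x \<in> C \<Longrightarrow> y \<in> C \<Longrightarrow> x + y \<in> T \<Longrightarrow> x \<in> T"
  shows "T face_of C"
  unfolding face_of_def
proof (intro conjI ballI impI)
  show "convex T" using assms by (simp add: convex_cone_def)
  fix a b x assume *: "a \<in> C" "b \<in> C" "x \<in> T" "x \<in> open_segment a b"
  then obtain u where u: "0 < u" "u < 1" "x = (1 - u) *\<^sub>R a + u *\<^sub>R b" by (auto simp: in_segment)
  have c: "(1 - u) *\<^sub>R a \<in> C" "u *\<^sub>R b \<in> C" using * u assms by (auto intro: convex_cone_scaleR)
  have "(1 - u) *\<^sub>R a \<in> T" "u *\<^sub>R b \<in> T"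
    using assms(4)[OF c] assms(4)[OF c(2,1)] * u by (auto simp: add.commute)
  then have "(1 / (1 - u)) *\<^sub>R (1 - u) *\<^sub>R a \<in> T" "(1 / u) *\<^sub>R u *\<^sub>R b \<in> T"
    using u convex_cone_scaleR[OF assms(2), of "1 / (1 - u)"] convex_cone_scaleR[OF assms(2), of "1 / u"]
    by (simp_all del: scaleR_scaleR)
  then show "a \<in> T" "b \<in> T" using u by auto
qed (use assms in auto)

text \<open>A point of the span is a difference \<open>a - b\<close> of points of the face. Adding
  \<open>b\<close> gives a point of the face with the original point as a summand.\<close>

lemma face_of_Int_span:
  assumes "convex_cone C" "T face_of C" "T \<noteq> {}"
  shows "C \<inter> span T = T"
proof
  show "T \<subseteq> C \<inter> span T" using assms face_of_imp_subset span_superset by fastforce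
  show "C \<inter> span T \<subseteq> T"
  proof
    fix x assume x: "x \<in> C \<inter> span T"
    have T: "convex_cone T" using convex_cone_face assms by blast
    obtain a b where ab: "x = a - b" "a \<in> T" "b \<in> T" using x span_convex_cone[OF T] by auto
    have "x + b \<in> T" using ab by simp
    then show "x \<in> T" using face_of_add[OF assms(1,2), of x b] ab x assms(2) face_of_imp_subset by blast
  qed
qed

text \<open>Pointedness modulo a face: points of the cone outside \<open>span T\<close> cannot
  cancel. This makes the positive side of a wall well defined.\<close>

lemma face_of_add_span:
  assumes "convex_cone C" "T face_of C" "T \<noteq> {}" "x \<in> C" "y \<in> C" "x + y \<in> span T"
  shows "x \<in> span T"
proof -
  have "x + y \<in> T" using face_of_Int_span[OF assms(1-3)] convex_cone_add assms by blast
  then show ?thesis using face_of_add assms span_base by blast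
qed

text \<open>A convex cone is not a finite union of proper subspace sections. From a point that suits
  the earlier subspaces one moves in a direction \<open>u\<close> outside the new one; each earlier
  subspace excludes at most one parameter, since two would put \<open>u\<close>, and then
  \<open>y\<close>, into it.\<close>

lemma generic_point:
  assumes "convex_cone C" "finite \<W>" "\<And>W. W \<in> \<W> \<Longrightarrow> subspace W"
  shows "\<exists>y\<in>C. \<forall>W\<in>\<W>. y \<in> W \<longrightarrow> C \<subseteq> W"
  using assms(2,3)
proof (induction \<W>)
  case empty
  then show ?case using convex_cone_contains_0[OF assms(1)] by auto
next
  case (insert W \<W>)
  then obtain y where y: "y \<in> C" "\<forall>W\<in>\<W>. y \<in> W \<longrightarrow> C \<subseteq> W" by auto
  show ?case
  proof (cases "y \<notin> W \<or> C \<subseteq> W")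
    case True
    then show ?thesis using y by blast
  next
    case False
    then obtain u where u: "u \<in> C" "u \<notin> W" and yW: "y \<in> W" by blast
    let ?bad = "\<lambda>W'. {s. y + s *\<^sub>R u \<in> W'}"
    have "finite (?bad W')" if W': "W' \<in> \<W>" "\<not> C \<subseteq> W'" for W'
    proof -
      have "s = t" if st: "s \<in> ?bad W'" "t \<in> ?bad W'" for s t
      proof (rule ccontr)
        assume "s \<noteq> t"
        have sW: "subspace W'" using insert W' by auto
        have "(y + s *\<^sub>R u) - (y + t *\<^sub>R u) \<in> W'" using st sW by (intro subspace_diff) auto
        then have "(s - t) *\<^sub>R u \<in> W'" by (simp add: algebra_simps)
        then have "(1 / (s - t)) *\<^sub>R (s - t) *\<^sub>R u \<in> W'" using sW subspace_scale by blast
        then have "u \<in> W'" using \<open>s \<noteq> t\<close> by simp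
        then have "(y + s *\<^sub>R u) - s *\<^sub>R u \<in> W'" using st sW
          by (intro subspace_diff subspace_scale) auto
        then show False using y W' by auto
      qed
      then have "?bad W' = {} \<or> (\<exists>s. ?bad W' = {s})" by blast
      then show ?thesis by auto
    qed
    then have "finite (\<Union>W'\<in>{W'\<in>\<W>. \<not> C \<subseteq> W'}. ?bad W')" using insert by auto
    moreover have "infinite {(0::real)<..}" by (rule infinite_Ioi)
    ultimately have "\<not> {0<..} \<subseteq> (\<Union>W'\<in>{W'\<in>\<W>. \<not> C \<subseteq> W'}. ?bad W')"
      using finite_subset by blast
    then obtain s where s: "s > 0" "s \<notin> (\<Union>W'\<in>{W'\<in>\<W>. \<not> C \<subseteq> W'}. ?bad W')"
      unfolding subset_iff greaterThan_iff by blast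
    have "y + s *\<^sub>R u \<notin> W"
    proof
      assume "y + s *\<^sub>R u \<in> W"
      moreover have sW: "subspace W" using insert by auto
      ultimately have "(y + s *\<^sub>R u) - y \<in> W" using yW subspace_diff by blast
      then have "s *\<^sub>R u \<in> W" by simp
      then show False using subspace_scale[OF sW, of "s *\<^sub>R u" "1 / s"] u s by simp
    qed
    moreover have "y + s *\<^sub>R u \<in> C"
      using y u s assms(1) by (auto intro!: convex_cone_add convex_cone_scaleR)
    ultimately show ?thesis using s(2) by blast
  qed
qed

text \<open>A point that lies in no proper face is an algebraic interior point of the cone.\<close>

lemma span_absorb:
  assumes "convex_cone C" "x \<in> C" "\<And>T. T face_of C \<Longrightarrow> x \<in> T \<Longrightarrow> T = C" "y \<in> span C"
  shows "\<exists>t>0. t *\<^sub>R x + y \<in> C"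
proof -
  \<comment> \<open>The points below a multiple of \<open>x\<close> in the order given by the cone.
    This is a face containing \<open>x\<close>, hence everything.\<close>
  define T where "T = {y\<in>C. \<exists>t\<ge>0. t *\<^sub>R x - y \<in> C}"
  have T: "convex_cone T"
    unfolding convex_cone_iff
  proof (intro conjI ballI allI impI)
    show "0 \<in> T" using convex_cone_contains_0[OF assms(1)] assms(2) by (auto simp: T_def intro!: exI[of _ 1])
  next
    fix u v assume "u \<in> T" "v \<in> T"
    then obtain s t where st: "u \<in> C" "v \<in> C" "s \<ge> 0" "t \<ge> 0" "s *\<^sub>R x - u \<in> C" "t *\<^sub>R x - v \<in> C"
      by (auto simp: T_def)
    then have "(s *\<^sub>R x - u) + (t *\<^sub>R x - v) \<in> C" "u + v \<in> C"
      by (auto intro: convex_cone_add[OF assms(1)])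
    moreover have "(s *\<^sub>R x - u) + (t *\<^sub>R x - v) = (s + t) *\<^sub>R x - (u + v)" by (simp add: algebra_simps)
    ultimately show "u + v \<in> T" using st unfolding T_def by (auto intro!: exI[of _ "s + t"])
  next
    fix u and c :: real assume "u \<in> T" "0 \<le> c"
    then obtain s where st: "u \<in> C" "s \<ge> 0" "s *\<^sub>R x - u \<in> C" by (auto simp: T_def)
    then have "c *\<^sub>R (s *\<^sub>R x - u) \<in> C" "c *\<^sub>R u \<in> C"
      using \<open>0 \<le> c\<close> by (auto intro: convex_cone_scaleR[OF assms(1)])
    then show "c *\<^sub>R u \<in> T" using st \<open>0 \<le> c\<close> unfolding T_def
      by (auto intro!: exI[of _ "c * s"] simp: algebra_simps)
  qed
  have "T face_of C"
  proof (rule face_of_coneI[OF assms(1) T])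
    show "T \<subseteq> C" by (auto simp: T_def)
    fix u v assume uv: "u \<in> C" "v \<in> C" "u + v \<in> T"
    then obtain s where s: "s \<ge> 0" "s *\<^sub>R x - (u + v) \<in> C" by (auto simp: T_def)
    then have "s *\<^sub>R x - (u + v) + v \<in> C" using uv convex_cone_add[OF assms(1)] by blast
    then show "u \<in> T" using uv s by (auto simp: T_def intro!: exI[of _ s])
  qed
  moreover have "x \<in> T" using assms(2) convex_cone_contains_0[OF assms(1)] by (auto simp: T_def intro!: exI[of _ 1])
  ultimately have TC: "T = C" using assms(3) by blast
  obtain a b where ab: "y = a - b" "a \<in> C" "b \<in> C" using assms(4) span_convex_cone[OF assms(1)] by auto
  obtain t where t: "t \<ge> 0" "t *\<^sub>R x - b \<in> C" using ab TC by (auto simp: T_def)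
  \<comment> \<open>The additional \<open>x\<close> makes the coefficient \<open>t + 1\<close>
    strictly positive.\<close>
  have "(t *\<^sub>R x - b) + (a + x) \<in> C"
    using t ab assms by (intro convex_cone_add[OF assms(1)])
  moreover have "(t *\<^sub>R x - b) + (a + x) = (t + 1) *\<^sub>R x + y" using ab by (simp add: algebra_simps)
  ultimately show ?thesis using t by (intro exI[of _ "t + 1"]) auto
qed

section \<open>Separation of a point from a finitely generated cone, and closedness along
  lines\<close>

section \<open>Farkas' lemma\<close>

lemma linear_functional_neg:
  fixes z :: "'a::real_vector"
  assumes "z \<noteq> 0"
  shows "\<exists>h. linear h \<and> h z < (0::real)"
proof -
  have "independent {z}" using assms by simp
  then obtain h :: "'a \<Rightarrow> real" where "linear h" "\<forall>x\<in>{z}. h x = - 1"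
    using linear_independent_extend[of "{z}" "\<lambda>_. - 1 :: real"] by blast
  then show ?thesis by (intro exI[of _ h]) auto
qed

text \<open>Induction on the number of generators: if a functional that separates \<open>z\<close> from the cone
  over \<open>I\<close> is negative on the new generator \<open>g\<close>, project along \<open>g\<close> to its kernel.\<close>

lemma farkas_family:
  fixes v :: "'i \<Rightarrow> 'a::real_vector"
  assumes "finite I" "\<And>c. (\<And>i. i \<in> I \<Longrightarrow> 0 \<le> c i) \<Longrightarrow> z \<noteq> (\<Sum>i\<in>I. c i *\<^sub>R v i)"
  shows "\<exists>h. linear h \<and> (\<forall>i\<in>I. 0 \<le> h (v i)) \<and> h z < (0::real)"
  using assms
proof (induction I arbitrary: v z)
  case empty
  then have "z \<noteq> 0" by auto
  then show ?case using linear_functional_neg by auto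
next
  case (insert j I)
  have ne: "z \<noteq> (\<Sum>i\<in>I. c i *\<^sub>R v i)" if "\<And>i. i \<in> I \<Longrightarrow> 0 \<le> c i" for c
  proof -
    have "(\<Sum>i\<in>insert j I. (if i = j then 0 else c i) *\<^sub>R v i) = (\<Sum>i\<in>I. c i *\<^sub>R v i)"
      using insert(1,2) by (simp, intro sum.cong) auto
    moreover have "z \<noteq> (\<Sum>i\<in>insert j I. (if i = j then 0 else c i) *\<^sub>R v i)"
      by (rule insert(4)) (use that in auto)
    ultimately show ?thesis by simp
  qed
  then obtain h where h: "linear h" "\<forall>i\<in>I. 0 \<le> h (v i)" "h z < (0::real)"
    using insert(3)[of z v] by blast
  show ?case
  proof (cases "0 \<le> h (v j)")
    case True
    then show ?thesis using h by (intro exI[of _ h]) auto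
  next
    case False
    define \<pi> where "\<pi> = (\<lambda>x. x - (h x / h (v j)) *\<^sub>R v j)"
    have l\<pi>: "linear \<pi>"
      by (rule linearI) (simp_all add: \<pi>_def linear_add[OF h(1)] linear_scale[OF h(1)] algebra_simps add_divide_distrib)
    have "\<pi> z \<noteq> (\<Sum>i\<in>I. c i *\<^sub>R \<pi> (v i))" if c: "\<And>i. i \<in> I \<Longrightarrow> 0 \<le> c i" for c
    proof
      \<comment> \<open>The coefficient of \<open>v j\<close> forced by undoing the projection. It
        is nonnegative because \<open>h\<close> is negative at \<open>z\<close> and
        \<open>v j\<close> and nonnegative at the other generators.\<close>
      define a where "a = h z / h (v j) - (\<Sum>i\<in>I. c i * (h (v i) / h (v j)))"
      assume "\<pi> z = (\<Sum>i\<in>I. c i *\<^sub>R \<pi> (v i))"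
      also have "\<dots> = (\<Sum>i\<in>I. c i *\<^sub>R v i) - (\<Sum>i\<in>I. c i * (h (v i) / h (v j))) *\<^sub>R v j"
        by (simp add: \<pi>_def scaleR_diff_right sum_subtractf scaleR_sum_left)
      finally have "z = (\<Sum>i\<in>I. c i *\<^sub>R v i) + (h z / h (v j) - (\<Sum>i\<in>I. c i * (h (v i) / h (v j)))) *\<^sub>R v j"
        by (simp add: \<pi>_def algebra_simps)
      also have "\<dots> = (\<Sum>i\<in>I. c i *\<^sub>R v i) + a *\<^sub>R v j" by (simp add: a_def)
      also have "\<dots> = (\<Sum>i\<in>I. (c(j := a)) i *\<^sub>R v i) + a *\<^sub>R v j"
        using insert(2) by (intro arg_cong2[where f = "(+)"] sum.cong) auto
      also have "\<dots> = (\<Sum>i\<in>insert j I. (c(j := a)) i *\<^sub>R v i)"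
        using insert(1,2) by (simp add: add.commute)
      finally have zeq: "z = \<dots>" .
      moreover have "(\<Sum>i\<in>I. c i * (h (v i) / h (v j))) \<le> 0"
        using False h c by (intro sum_nonpos mult_nonneg_nonpos divide_nonneg_neg) auto
      moreover have "0 \<le> h z / h (v j)" using False h by (simp add: divide_nonpos_neg)
      ultimately have "0 \<le> a" by (simp add: a_def)
      then have "z \<noteq> (\<Sum>i\<in>insert j I. (c(j := a)) i *\<^sub>R v i)"
        by (intro insert(4)) (use c in auto)
      with zeq show False by blast
    qed
    then obtain k where k: "linear k" "\<forall>i\<in>I. 0 \<le> k (\<pi> (v i))" "k (\<pi> z) < (0::real)"
      using insert(3)[of "\<pi> z" "\<lambda>i. \<pi> (v i)"] by blast
    have "\<pi> (v j) = 0" using False by (simp add: \<pi>_def)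
    then have "linear (k \<circ> \<pi>)" "\<forall>i\<in>insert j I. 0 \<le> (k \<circ> \<pi>) (v i)" "(k \<circ> \<pi>) z < 0"
      using k l\<pi> by (auto simp: linear_compose linear_0)
    then show ?thesis by blast
  qed
qed

definition fg_cone :: "'a::real_vector set \<Rightarrow> bool" where
  "fg_cone C \<longleftrightarrow> (\<exists>G. finite G \<and> C = convex_cone hull G)"

lemma fg_cone_convex_cone: "fg_cone C \<Longrightarrow> convex_cone C"
  by (auto simp: fg_cone_def convex_cone_convex_cone_hull)

lemma linear_nonneg_on_hull:
  assumes "linear h" "\<forall>g\<in>G. 0 \<le> h g" "x \<in> convex_cone hull G"
  shows "0 \<le> (h x :: real)"
proof -
  have "convex_cone {x. 0 \<le> h x}"
    unfolding convex_cone_iff using assms(1) by (auto simp: linear_0 linear_add linear_scale)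
  then have "convex_cone hull G \<subseteq> {x. 0 \<le> h x}"
    using assms(2) by (intro hull_minimal) auto
  then show ?thesis using assms(3) by auto
qed

lemma farkas:
  assumes "fg_cone C" "z \<notin> C"
  shows "\<exists>h. linear h \<and> (\<forall>x\<in>C. 0 \<le> h x) \<and> h z < (0::real)"
proof -
  obtain G where G: "finite G" "C = convex_cone hull G" using assms by (auto simp: fg_cone_def)
  have "z \<noteq> (\<Sum>g\<in>G. c g *\<^sub>R g)" if "\<And>g. g \<in> G \<Longrightarrow> 0 \<le> c g" for c
  proof -
    have "(\<Sum>g\<in>G. c g *\<^sub>R g) \<in> C"
      unfolding G(2) using that
      by (intro convex_cone_sum[OF G(1) convex_cone_convex_cone_hull] convex_cone_hull_mul hull_inc)
    then show ?thesis using assms by auto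
  qed
  then obtain h where "linear h" "\<forall>g\<in>G. 0 \<le> h g" "h z < (0::real)"
    using farkas_family[of G z "\<lambda>x. x"] G(1) by blast
  then show ?thesis using linear_nonneg_on_hull G by blast
qed

text \<open>By Farkas' lemma the cone is the intersection of the half-spaces containing it, and each
  of them meets the line in a closed set of parameters. The ambient space carries no topology, so
  closedness is expressed through the real parameter.\<close>

lemma fg_cone_closed_on_line:
  assumes "fg_cone C"
  shows "closed {t. x + t *\<^sub>R y \<in> C}"
proof -
  have "{t. x + t *\<^sub>R y \<in> C} = (\<Inter>h\<in>{h. linear h \<and> (\<forall>x\<in>C. 0 \<le> h x)}. {t::real. 0 \<le> h x + t * h y})"
    (is "?L = ?R")
  proof
    show "?L \<subseteq> ?R" 
    proof (rule subsetI, rule INT_I)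
      fix t and h :: "'a \<Rightarrow> real" assume "t \<in> ?L" "h \<in> {h. linear h \<and> (\<forall>x\<in>C. 0 \<le> h x)}"
      then have "linear h" "0 \<le> h (x + t *\<^sub>R y)" by auto
      then show "t \<in> {t. 0 \<le> h x + t * h y}" by (simp add: linear_add linear_scale)
    qed
    show "?R \<subseteq> ?L"
    proof (rule subsetI, rule ccontr)
      fix t assume t: "t \<in> ?R" "t \<notin> ?L"
      then obtain h where "linear h" "\<forall>x\<in>C. 0 \<le> h x" "h (x + t *\<^sub>R y) < (0::real)"
        using farkas[OF assms, of "x + t *\<^sub>R y"] by blast
      then show False using t(1) by (fastforce simp: linear_add linear_scale)
    qed
  qed
  also have "closed \<dots>"
    by (intro closed_INT ballI closed_Collect_le continuous_intros)
  finally show ?thesis .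
qed

section \<open>Discreteness of lattices, and existence and uniqueness of normal vectors\<close>

section \<open>Lattices and normal vectors\<close>

text \<open>The part of \<open>is_lattice\<close> that passes to products and intersections without
  a choice of basis.\<close>

definition additive_subgroup :: "'a::real_vector set \<Rightarrow> bool" where
  "additive_subgroup L \<longleftrightarrow> 0 \<in> L \<and> (\<forall>x\<in>L. \<forall>y\<in>L. x - y \<in> L)"

lemma additive_subgroup_0: "additive_subgroup L \<Longrightarrow> 0 \<in> L"
  by (simp add: additive_subgroup_def)

lemma additive_subgroup_diff: "additive_subgroup L \<Longrightarrow> x \<in> L \<Longrightarrow> y \<in> L \<Longrightarrow> x - y \<in> L"
  by (simp add: additive_subgroup_def)

lemma additive_subgroup_add: "additive_subgroup L \<Longrightarrow> x \<in> L \<Longrightarrow> y \<in> L \<Longrightarrow> x + y \<in> L"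
  using additive_subgroup_diff[of L 0 y] additive_subgroup_diff[of L x "- y"] additive_subgroup_0 by auto

lemma additive_subgroup_of_int:
  assumes "additive_subgroup L" "x \<in> L"
  shows "of_int k *\<^sub>R x \<in> L"
proof -
  have n: "of_nat n *\<^sub>R x \<in> L" for n
    by (induction n) (use assms in \<open>auto simp: algebra_simps intro: additive_subgroup_0 additive_subgroup_add\<close>)
  show ?thesis
  proof (cases "k \<ge> 0")
    case True
    then show ?thesis using n[of "nat k"] by (simp add: of_nat_nat)
  next
    case False
    have "0 - of_nat (nat (- k)) *\<^sub>R x \<in> L"
      using n assms by (intro additive_subgroup_diff additive_subgroup_0)
    then show ?thesis using False by (simp add: of_nat_nat)
  qed
qed

lemma additive_subgroup_sum:
  "finite I \<Longrightarrow> additive_subgroup L \<Longrightarrow> (\<And>i. i \<in> I \<Longrightarrow> f i \<in> L) \<Longrightarrow> sum f I \<in> L"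
  by (induction I rule: finite_induct) (auto intro: additive_subgroup_0 additive_subgroup_add)

lemma additive_subgroup_subspace: "subspace U \<Longrightarrow> additive_subgroup U"
  by (simp add: additive_subgroup_def subspace_0 subspace_diff)

lemma additive_subgroup_Int: "additive_subgroup L \<Longrightarrow> additive_subgroup M \<Longrightarrow> additive_subgroup (L \<inter> M)"
  by (simp add: additive_subgroup_def)

lemma additive_subgroup_Times: "additive_subgroup L \<Longrightarrow> additive_subgroup M \<Longrightarrow> additive_subgroup (L \<times> M)"
  by (auto simp: additive_subgroup_def zero_prod_def)

lemma additive_subgroup_Ints: "additive_subgroup (\<int> :: real set)"
  by (simp add: additive_subgroup_def)

lemma additive_subgroup_sublat: "additive_subgroup L \<Longrightarrow> additive_subgroup (sublat L \<sigma>)"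
  unfolding sublat_def by (simp add: additive_subgroup_Int additive_subgroup_subspace)

lemma lattice_subgroup:
  assumes "is_lattice N"
  shows "additive_subgroup N"
proof -
  obtain B where B: "finite B" "N = {\<Sum>b\<in>B. of_int (c b) *\<^sub>R b | c :: 'a \<Rightarrow> int. True}"
    using assms by (auto simp: is_lattice_def)
  have "0 \<in> N" unfolding B(2) by (auto intro!: exI[of _ "\<lambda>_. 0"])
  moreover have "x - y \<in> N" if xy: "x \<in> N" "y \<in> N" for x y
  proof -
    have ex: "\<exists>c :: 'a \<Rightarrow> int. z = (\<Sum>b\<in>B. of_int (c b) *\<^sub>R b)" if "z \<in> N" for z
      using that unfolding B(2) by simp
    obtain c :: "'a \<Rightarrow> int" where "x = (\<Sum>b\<in>B. of_int (c b) *\<^sub>R b)" using ex[OF xy(1)] ..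
    moreover obtain d :: "'a \<Rightarrow> int" where "y = (\<Sum>b\<in>B. of_int (d b) *\<^sub>R b)" using ex[OF xy(2)] ..
    ultimately have "x - y = (\<Sum>b\<in>B. of_int (c b - d b) *\<^sub>R b)"
      by (simp add: sum_subtractf scaleR_diff_left)
    then show ?thesis unfolding B(2) by (intro CollectI exI[of _ "\<lambda>b. c b - d b"]) auto
  qed
  ultimately show ?thesis by (simp add: additive_subgroup_def)
qed

text \<open>This is discreteness in algebraic form: coordinates in a lattice basis are linear
  functionals, so bounded coefficients leave finitely many integer coordinates.\<close>

lemma finite_lattice_bounded:
  assumes "is_lattice N" "finite I"
  shows "finite {x\<in>N. \<exists>a. (\<forall>i\<in>I. \<bar>a i\<bar> \<le> 1) \<and> x = (\<Sum>i\<in>I. a i *\<^sub>R f i)}"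
proof -
  obtain B where B: "finite B" "independent B" "N = {\<Sum>b\<in>B. of_int (c b) *\<^sub>R b | c :: 'a \<Rightarrow> int. True}"
    using assms by (auto simp: is_lattice_def)
  have "\<exists>h. linear h \<and> (\<forall>b'\<in>B. h b' = (of_bool (b' = b) :: real))" for b
    by (rule linear_independent_extend[OF B(2)])
  then obtain h where h: "\<And>b. linear (h b)" "\<And>b b'. b' \<in> B \<Longrightarrow> h b b' = (of_bool (b' = b) :: real)"
    by metis
  \<comment> \<open>A bound for the coordinate along \<open>b\<close> of any combination with
    coefficients between -1 and 1.\<close>
  define M where "M b = \<lceil>\<Sum>i\<in>I. \<bar>h b (f i)\<bar>\<rceil>" for b
  have "{x\<in>N. \<exists>a. (\<forall>i\<in>I. \<bar>a i\<bar> \<le> 1) \<and> x = (\<Sum>i\<in>I. a i *\<^sub>R f i)}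
        \<subseteq> (\<lambda>c. \<Sum>b\<in>B. of_int (c b) *\<^sub>R b) ` (\<Pi>\<^sub>E b\<in>B. {- M b..M b})"
  proof
    fix x assume "x \<in> {x\<in>N. \<exists>a. (\<forall>i\<in>I. \<bar>a i\<bar> \<le> 1) \<and> x = (\<Sum>i\<in>I. a i *\<^sub>R f i)}"
    then obtain a c where a: "\<forall>i\<in>I. \<bar>a i\<bar> \<le> 1" "x = (\<Sum>i\<in>I. a i *\<^sub>R f i)"
      and c: "x = (\<Sum>b\<in>B. of_int (c b) *\<^sub>R b)" using B(3) by auto
    have "c b \<in> {- M b..M b}" if b: "b \<in> B" for b
    proof -
      have "h b x = (\<Sum>b'\<in>B. of_int (c b') * of_bool (b' = b))"
        unfolding c using h by (simp add: linear_sum linear_scale)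
      also have "\<dots> = of_int (c b)" using b B(1) by (simp add: of_bool_def if_distrib cong: if_cong)
      finally have "of_int (c b) = (\<Sum>i\<in>I. a i * h b (f i))"
        unfolding a(2) using h by (simp add: linear_sum linear_scale)
      then have "\<bar>of_int (c b)\<bar> \<le> (\<Sum>i\<in>I. \<bar>a i * h b (f i)\<bar>)" by (simp add: sum_abs)
      also have "\<dots> \<le> (\<Sum>i\<in>I. \<bar>h b (f i)\<bar>)"
        using a(1) by (intro sum_mono) (auto simp: abs_mult intro: mult_left_le_one_le)
      also have "\<dots> \<le> of_int (M b)" unfolding M_def by simp
      finally have "\<bar>c b\<bar> \<le> M b" by linarith
      then show ?thesis by auto
    qed
    then have "restrict c B \<in> (\<Pi>\<^sub>E b\<in>B. {- M b..M b})" by auto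
    moreover have "x = (\<Sum>b\<in>B. of_int (restrict c B b) *\<^sub>R b)" unfolding c by simp
    ultimately show "x \<in> (\<lambda>c. \<Sum>b\<in>B. of_int (c b) *\<^sub>R b) ` (\<Pi>\<^sub>E b\<in>B. {- M b..M b})" by blast
  qed
  moreover have "finite (\<Pi>\<^sub>E b\<in>B. {- M b..M b})" using B(1) by (intro finite_PiE) auto
  ultimately show ?thesis by (meson finite_imageI finite_subset)
qed

text \<open>If \<open>\<phi>\<close> killed \<open>\<Sum> r\<^sub>v v\<close>, the lattice points \<open>\<Sum> \<lfloor>n r\<^sub>v\<rfloor> v\<close> would have bounded, hence only finitely
  many, images.\<close>

lemma inj_on_span_subgroup:
  assumes L: "additive_subgroup L" and N: "is_lattice N" and \<phi>: "linear \<phi>" "inj_on \<phi> L" "\<phi> ` L \<subseteq> N"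
  shows "inj_on \<phi> (span L)"
proof -
  have "x = 0" if x: "x \<in> span L" "\<phi> x = 0" for x
  proof -
    obtain B where B: "B \<subseteq> L" "independent B" "L \<subseteq> span B"
      using maximal_independent_subset by blast
    have "x \<in> span B" using x B(3) span_minimal[OF B(3)] by auto
    then obtain T r where T: "finite T" "T \<subseteq> B" "x = (\<Sum>v\<in>T. r v *\<^sub>R v)"
      unfolding span_explicit by blast
    define X where "X n = (\<Sum>v\<in>T. of_int \<lfloor>of_nat n * r v\<rfloor> *\<^sub>R v)" for n :: nat
    have XL: "X n \<in> L" for n
      unfolding X_def using T B L by (intro additive_subgroup_sum additive_subgroup_of_int) auto
    have "\<phi> (X n) \<in> {y\<in>N. \<exists>a. (\<forall>v\<in>T. \<bar>a v\<bar> \<le> 1) \<and> y = (\<Sum>v\<in>T. a v *\<^sub>R \<phi> v)}" for n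
    proof -
      have 1: "(\<Sum>v\<in>T. r v *\<^sub>R \<phi> v) = 0"
        using x(2) unfolding T(3) using \<phi>(1) by (simp add: linear_sum linear_scale)
      have "\<phi> (X n) = (\<Sum>v\<in>T. of_int \<lfloor>of_nat n * r v\<rfloor> *\<^sub>R \<phi> v)"
        unfolding X_def using \<phi>(1) by (simp add: linear_sum linear_scale)
      \<comment> \<open>A floor is the number minus its fractional part; the numbers themselves
        contribute \<open>of_nat n\<close> times the vanishing sum.\<close>
      also have "\<dots> = (\<Sum>v\<in>T. (- frac (of_nat n * r v)) *\<^sub>R \<phi> v) + of_nat n *\<^sub>R (\<Sum>v\<in>T. r v *\<^sub>R \<phi> v)"
        unfolding scaleR_sum_right sum.distrib[symmetric]
        by (intro sum.cong) (auto simp: frac_def algebra_simps)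
      also have "\<dots> = (\<Sum>v\<in>T. (- frac (of_nat n * r v)) *\<^sub>R \<phi> v)" using 1 by simp
      finally have e: "\<phi> (X n) = \<dots>" .
      have "\<bar>- frac (of_nat n * r v)\<bar> \<le> 1" for v
        using frac_ge_0[of "of_nat n * r v"] frac_lt_1[of "of_nat n * r v"] by linarith
      moreover have "\<phi> (X n) \<in> N" using XL \<phi>(3) by auto
      ultimately show ?thesis
        using e by (intro CollectI conjI exI[of _ "\<lambda>v. - frac (of_nat n * r v)"]) auto
    qed
    then have "range (\<lambda>n. \<phi> (X n)) \<subseteq> {y\<in>N. \<exists>a. (\<forall>v\<in>T. \<bar>a v\<bar> \<le> 1) \<and> y = (\<Sum>v\<in>T. a v *\<^sub>R \<phi> v)}"
      by blast
    then have "finite (range (\<lambda>n. \<phi> (X n)))"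
      using finite_lattice_bounded[OF N T(1), of \<phi>] finite_subset by blast
    then obtain m where m: "infinite {n. \<phi> (X n) = \<phi> (X m)}"
      using pigeonhole_infinite[of UNIV "\<lambda>n. \<phi> (X n)"] by auto
    have "r u = 0" if u: "u \<in> T" for u
    proof (rule ccontr)
      assume ru: "r u \<noteq> 0"
      \<comment> \<open>Indices more than \<open>k\<close> apart have values \<open>n * r u\<close>
        more than 1 apart, so their floors differ, although \<open>X n = X m\<close> makes them
        equal.\<close>
      obtain k :: nat where k: "1 / \<bar>r u\<bar> < of_nat k" using reals_Archimedean2 by blast
      obtain n where n: "n > m + k" "\<phi> (X n) = \<phi> (X m)"
        using m unfolding infinite_nat_iff_unbounded by auto
      then have "X n = X m" using \<phi>(2) XL by (meson inj_onD)
      then have "(\<Sum>v\<in>T. (of_int \<lfloor>of_nat n * r v\<rfloor> - of_int \<lfloor>of_nat m * r v\<rfloor>) *\<^sub>R v) = 0"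
        unfolding X_def by (simp add: scaleR_diff_left sum_subtractf)
      moreover have "independent T" using B T independent_mono by blast
      ultimately have "of_int \<lfloor>of_nat n * r u\<rfloor> - of_int \<lfloor>of_nat m * r u\<rfloor> = (0::real)"
        using independentD[OF _ T(1) subset_refl, of "\<lambda>v. of_int \<lfloor>of_nat n * r v\<rfloor> - of_int \<lfloor>of_nat m * r v\<rfloor>" u] u by simp
      then have "\<lfloor>of_nat n * r u\<rfloor> = \<lfloor>of_nat m * r u\<rfloor>" by simp
      then have "\<bar>of_nat n * r u - of_nat m * r u\<bar> < 1" by linarith
      moreover have "\<bar>of_nat n * r u - of_nat m * r u\<bar> = (of_nat n - of_nat m) * \<bar>r u\<bar>"
        using n(1) by (simp add: abs_mult left_diff_distrib[symmetric])
      moreover have "1 < of_nat k * \<bar>r u\<bar>" using k ru by (simp add: divide_less_eq)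
      moreover have "of_nat k * \<bar>r u\<bar> \<le> (of_nat n - of_nat m) * \<bar>r u\<bar>"
        using n(1) by (intro mult_right_mono) auto
      ultimately show False by linarith
    qed
    then show "x = 0" unfolding T(3) by simp
  qed
  then show ?thesis
    by (intro inj_onI) (metis \<phi>(1) eq_iff_diff_eq_0 linear_diff span_diff)
qed

text \<open>A lattice vector of least positive height over \<open>span \<tau>\<close> generates the
  lattice modulo \<tau>, by division with remainder. The height is the coordinate along
  \<open>s\<close>. To see that a least height exists, candidates are reduced modulo the lattice
  vectors \<open>T\<close> to a bounded, hence finite, set.\<close>

lemma normal_vector_exists_aux:
  assumes N: "is_lattice N" and \<eta>: "convex_cone \<eta>" "\<tau> \<subseteq> \<eta>"
    and T: "finite T" "independent T" "T \<subseteq> N" "span T = span \<tau>"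
    and s: "s \<in> N" "s \<in> \<eta>" "s \<notin> span \<tau>" "span \<eta> = span (insert s \<tau>)"
  shows "\<exists>v. is_normal_vector N \<eta> \<tau> v"
proof -
  note NG = lattice_subgroup[OF N]
  have sT: "s \<notin> T" using s T span_base by blast
  have "independent (insert s T)" using T s by (simp add: independent_insertI)
  from linear_independent_extend[OF this, of "\<lambda>x. of_bool (x = s) :: real"]
  obtain h :: "'a \<Rightarrow> real" where h: "linear h" "\<forall>x\<in>insert s T. h x = of_bool (x = s)" by blast
  have hs: "h s = 1" and hT: "\<And>t. t \<in> T \<Longrightarrow> h t = 0" using h sT by auto
  have h0: "h x = 0" if "x \<in> span \<tau>" for x
    using linear_eq_0_on_span[OF h(1), of T x] hT that T by auto
  have dec: "x - h x *\<^sub>R s \<in> span \<tau>" if x: "x \<in> span \<eta>" for x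
  proof -
    obtain k where k: "x - k *\<^sub>R s \<in> span \<tau>" using x s(4) span_breakdown_eq by blast
    then have "h (x - k *\<^sub>R s) = 0" using h0 by blast
    then have "h x = k" using h(1) hs by (simp add: linear_diff linear_scale)
    then show ?thesis using k by simp
  qed
  \<comment> \<open>Candidates no higher than \<open>s\<close>, with bounded coordinates along
    \<open>T\<close>. The set contains \<open>s\<close>, so the minimum is taken over a nonempty
    set.\<close>
  define X where "X = {x\<in>N. x \<in> span \<eta> \<and> 0 < h x \<and> h x \<le> 1 \<and>
      (\<exists>a. (\<forall>t\<in>T. \<bar>a t\<bar> \<le> 1) \<and> x = h x *\<^sub>R s + (\<Sum>t\<in>T. a t *\<^sub>R t))}"
  have "X \<subseteq> {x\<in>N. \<exists>a. (\<forall>i\<in>insert s T. \<bar>a i\<bar> \<le> 1) \<and> x = (\<Sum>i\<in>insert s T. a i *\<^sub>R i)}"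
  proof
    fix x assume "x \<in> X"
    then obtain a where a: "x \<in> N" "0 < h x" "h x \<le> 1" "\<forall>t\<in>T. \<bar>a t\<bar> \<le> 1" "x = h x *\<^sub>R s + (\<Sum>t\<in>T. a t *\<^sub>R t)"
      by (auto simp: X_def)
    have "(\<Sum>i\<in>insert s T. (a(s := h x)) i *\<^sub>R i) = h x *\<^sub>R s + (\<Sum>t\<in>T. (a(s := h x)) t *\<^sub>R t)"
      using T(1) sT by simp
    also have "(\<Sum>t\<in>T. (a(s := h x)) t *\<^sub>R t) = (\<Sum>t\<in>T. a t *\<^sub>R t)"
      using sT by (intro sum.cong) auto
    finally have "x = (\<Sum>i\<in>insert s T. (a(s := h x)) i *\<^sub>R i)" using a(5) by simp
    moreover have "\<forall>i\<in>insert s T. \<bar>(a(s := h x)) i\<bar> \<le> 1" using a by auto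
    ultimately show "x \<in> {x\<in>N. \<exists>a. (\<forall>i\<in>insert s T. \<bar>a i\<bar> \<le> 1) \<and> x = (\<Sum>i\<in>insert s T. a i *\<^sub>R i)}"
      using a(1) by blast
  qed
  then have finX: "finite X"
    using finite_lattice_bounded[OF N, of "insert s T" "\<lambda>x. x"] T(1) finite_subset by fastforce
  moreover have sX: "s \<in> X" using s hs by (auto simp: X_def span_base intro!: exI[of _ "\<lambda>_. 0"])
  ultimately have "Min (h ` X) \<in> h ` X" by (intro Min_in) auto
  then obtain v where v: "v \<in> X" "h v = Min (h ` X)" by force
  have vmin: "h v \<le> h x" if "x \<in> X" for x
    unfolding v(2) using finX that by simp
  have vN: "v \<in> N" "v \<in> span \<eta>" "0 < h v" using v(1) by (auto simp: X_def)
  have main: "\<exists>k::int. y - of_int k *\<^sub>R v \<in> N \<inter> span \<tau>" if y: "y \<in> N" "y \<in> span \<eta>" for y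
  proof -
    \<comment> \<open>The remainder \<open>z\<close> after this many subtractions of
      \<open>v\<close> has height in the interval from 0 to \<open>h v\<close>, the right end
      excluded.\<close>
    define k where "k = \<lfloor>h y / h v\<rfloor>"
    define z where "z = y - of_int k *\<^sub>R v"
    have zN: "z \<in> N" unfolding z_def using y vN NG by (intro additive_subgroup_diff additive_subgroup_of_int)
    have z\<eta>: "z \<in> span \<eta>" unfolding z_def using y vN by (intro span_diff span_scale)
    have hz: "h z = h y - of_int k * h v" unfolding z_def using h(1) by (simp add: linear_diff linear_scale)
    have "of_int k \<le> h y / h v" "h y / h v < of_int k + 1" unfolding k_def by linarith+
    then have hz1: "0 \<le> h z" "h z < h v" using vN(3) unfolding hz by (auto simp: field_simps)
    have "h z = 0"
    proof (rule ccontr)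
      assume "h z \<noteq> 0"
      have "z - h z *\<^sub>R s \<in> span T" using dec[OF z\<eta>] T by simp
      then obtain b where b: "z - h z *\<^sub>R s = (\<Sum>t\<in>T. b t *\<^sub>R t)"
        unfolding span_finite[OF T(1)] by auto
      \<comment> \<open>Removing integer parts along \<open>T\<close> keeps the height and leads
        into \<open>X\<close>, where a positive height below \<open>h v\<close> contradicts
        minimality.\<close>
      define z' where "z' = z - (\<Sum>t\<in>T. of_int \<lfloor>b t\<rfloor> *\<^sub>R t)"
      have z'1: "z' = h z *\<^sub>R s + (\<Sum>t\<in>T. frac (b t) *\<^sub>R t)"
      proof -
        have "z = h z *\<^sub>R s + (\<Sum>t\<in>T. b t *\<^sub>R t)" using b by (simp add: algebra_simps)
        then have "z' = h z *\<^sub>R s + ((\<Sum>t\<in>T. b t *\<^sub>R t) - (\<Sum>t\<in>T. of_int \<lfloor>b t\<rfloor> *\<^sub>R t))"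
          unfolding z'_def by simp
        also have "(\<Sum>t\<in>T. b t *\<^sub>R t) - (\<Sum>t\<in>T. of_int \<lfloor>b t\<rfloor> *\<^sub>R t) = (\<Sum>t\<in>T. frac (b t) *\<^sub>R t)"
          unfolding sum_subtractf[symmetric] by (simp add: frac_def scaleR_diff_left)
        finally show ?thesis .
      qed
      have hz': "h z' = h z" unfolding z'_def using h(1) hT by (simp add: linear_diff linear_sum linear_scale)
      have "z' \<in> N" unfolding z'_def using zN T NG
        by (intro additive_subgroup_diff additive_subgroup_sum additive_subgroup_of_int) auto
      moreover have "z' \<in> span \<eta>"
      proof -
        have "T \<subseteq> span \<eta>" using T(4) \<eta>(2) span_mono span_superset by blast
        then show ?thesis unfolding z'_def using z\<eta> by (intro span_diff span_sum span_scale) auto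
      qed
      moreover have "h z \<le> 1"
        using hz1 vmin[OF sX] hs by linarith
      moreover have "\<forall>t\<in>T. \<bar>frac (b t)\<bar> \<le> 1"
        by (simp add: frac_lt_1 less_imp_le)
      ultimately have "z' \<in> X" using z'1 hz' hz1 \<open>h z \<noteq> 0\<close> unfolding X_def
        by (intro CollectI conjI exI[of _ "\<lambda>t. frac (b t)"]) auto
      then show False using vmin[of z'] hz' hz1 by simp
    qed
    then have "z \<in> span \<tau>" using dec[OF z\<eta>] by simp
    then show ?thesis using zN unfolding z_def by blast
  qed
  have "is_normal_vector N \<eta> \<tau> v"
    unfolding is_normal_vector_def
  proof (intro conjI)
    show "v \<in> sublat N \<eta>" using vN by (simp add: sublat_def)
    have "h v *\<^sub>R s \<in> \<eta>" using s vN \<eta> by (intro convex_cone_scaleR) auto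
    moreover have "h v *\<^sub>R s \<notin> span \<tau>"
      using h0[of "h v *\<^sub>R s"] h(1) hs vN by (auto simp: linear_scale)
    ultimately show "\<exists>x\<in>\<eta> - span \<tau>. v - x \<in> span \<tau>" using dec[OF vN(2)] by blast
    show "{x + of_int k *\<^sub>R v | x (k::int). x \<in> sublat N \<tau>} = sublat N \<eta>" (is "?A = ?B")
    proof
      show "?A \<subseteq> ?B"
        using vN NG \<eta>(2) span_mono[OF \<eta>(2)] unfolding sublat_def
        by (auto intro!: additive_subgroup_add additive_subgroup_of_int span_add span_scale)
      show "?B \<subseteq> ?A"
      proof
        fix y assume "y \<in> ?B"
        then obtain k :: int where k: "y - of_int k *\<^sub>R v \<in> N \<inter> span \<tau>" using main by (auto simp: sublat_def)
        have "y = (y - of_int k *\<^sub>R v) + of_int k *\<^sub>R v" by simp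
        then show "y \<in> ?A" using k unfolding sublat_def by blast
      qed
    qed
  qed
  then show ?thesis by blast
qed

lemma rational_polyhedral_cone_fg: "rational_polyhedral_cone N \<sigma> \<Longrightarrow> fg_cone \<sigma>"
  by (auto simp: rational_polyhedral_cone_def fg_cone_def)

lemma span_convex_cone_hull: "span (convex_cone hull G) = span G"
proof
  have "convex_cone (span G)"
    unfolding convex_cone_iff by (auto intro: span_0 span_add span_scale)
  then have "convex_cone hull G \<subseteq> span G" by (intro hull_minimal span_superset)
  then show "span (convex_cone hull G) \<subseteq> span G" by (simp add: span_minimal)
  show "span G \<subseteq> span (convex_cone hull G)" by (intro span_mono hull_subset)
qed

lemma rational_polyhedral_cone_fin_dim: "rational_polyhedral_cone N \<sigma> \<Longrightarrow> fin_dim \<sigma>"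
  unfolding rational_polyhedral_cone_def fin_dim_def
  by (metis span_convex_cone_hull span_superset)

text \<open>As the dimension drops, some generator of the larger cone lies outside
  \<open>span \<tau>\<close>. Generators are lattice vectors, so it provides the vector
  \<open>s\<close> that measures heights.\<close>

lemma normal_vector_exists:
  assumes N: "is_lattice N" and r: "rational_polyhedral_cone N \<eta>" "rational_polyhedral_cone N \<tau>"
    and "\<tau> \<subseteq> \<eta>" "Suc (dim \<tau>) = dim \<eta>"
  shows "\<exists>v. is_normal_vector N \<eta> \<tau> v"
proof -
  obtain G H where G: "finite G" "G \<subseteq> N" "\<eta> = convex_cone hull G"
    and H: "finite H" "H \<subseteq> N" "\<tau> = convex_cone hull H"
    using r by (auto simp: rational_polyhedral_cone_def)
  have fd: "fin_dim \<eta>" "fin_dim \<tau>" using r rational_polyhedral_cone_fin_dim by blast+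
  obtain T where T: "T \<subseteq> H" "finite T" "independent T" "span T = span H"
    using fin_dim_basis[OF fin_dim_finite[OF H(1)]] by metis
  have "\<not> G \<subseteq> span \<tau>"
  proof
    assume "G \<subseteq> span \<tau>"
    then have "\<eta> \<subseteq> span \<tau>" using span_convex_cone_hull[of G] G(3) span_minimal span_superset by blast
    then have "dim \<eta> \<le> dim \<tau>" using dim_mono_fin fd by blast
    then show False using assms by simp
  qed
  then obtain s where s: "s \<in> G" "s \<notin> span \<tau>" by blast
  have s\<eta>: "s \<in> \<eta>" using s G hull_inc by fast
  have "span (insert s \<tau>) = span \<eta>"
  proof (rule span_eq_of_dim[OF fd(1)])
    show "insert s \<tau> \<subseteq> span \<eta>" using s\<eta> assms span_superset by blast
    show "dim \<eta> \<le> dim (insert s \<tau>)" using dim_insert_fin[OF fd(2) s(2)] assms by simp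
  qed
  then show ?thesis
  proof (intro normal_vector_exists_aux[where T = T and s = s])
    show "convex_cone \<eta>" using r fg_cone_convex_cone rational_polyhedral_cone_fg by blast
    show "span T = span \<tau>" unfolding H(3) span_convex_cone_hull by (rule T(4))
  qed (use s s\<eta> T G H assms in auto)
qed

text \<open>Modulo \<open>span \<tau>\<close> each vector is an integer multiple of the other, so
  they agree up to sign. Opposite signs would make two points of the cone outside
  \<open>span \<tau>\<close> cancel, which \<open>pt\<close> excludes.\<close>

lemma normal_vector_unique:
  assumes v: "is_normal_vector N \<eta> \<tau> v" "is_normal_vector N \<eta> \<tau> v'"
    and pt: "\<And>x y. x \<in> \<eta> \<Longrightarrow> y \<in> \<eta> \<Longrightarrow> x + y \<in> span \<tau> \<Longrightarrow> x \<in> span \<tau>"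
  shows "v - v' \<in> span \<tau>"
proof -
  obtain a b where ab: "a \<in> \<eta>" "a \<notin> span \<tau>" "v - a \<in> span \<tau>" "b \<in> \<eta>" "b \<notin> span \<tau>" "v' - b \<in> span \<tau>"
    using v unfolding is_normal_vector_def by blast
  have nv: "v \<notin> span \<tau>" using ab span_diff[of v \<tau> "v - a"] by auto
  have "v \<in> {x + of_int k *\<^sub>R v' | x (k::int). x \<in> sublat N \<tau>}"
       "v' \<in> {x + of_int k *\<^sub>R v | x (k::int). x \<in> sublat N \<tau>}"
    using v unfolding is_normal_vector_def by blast+
  then obtain x y and k l :: int where k: "v = x + of_int k *\<^sub>R v'" "x \<in> span \<tau>"
    and l: "v' = y + of_int l *\<^sub>R v" "y \<in> span \<tau>"
    unfolding sublat_def by blast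
  have "v = x + of_int k *\<^sub>R (y + of_int l *\<^sub>R v)" using k(1) unfolding l(1) .
  moreover have "(1 - of_int (k * l)) *\<^sub>R v = v - of_int k *\<^sub>R of_int l *\<^sub>R v"
    by (simp add: scaleR_diff_left)
  moreover have "x + of_int k *\<^sub>R (y + of_int l *\<^sub>R v) - of_int k *\<^sub>R of_int l *\<^sub>R v = x + of_int k *\<^sub>R y"
    by (simp add: scaleR_add_right)
  ultimately have "(1 - of_int (k * l)) *\<^sub>R v = x + of_int k *\<^sub>R y" by metis
  then have "(1 - of_int (k * l)) *\<^sub>R v \<in> span \<tau>" using k(2) l(2) by (simp add: span_add span_scale)
  then have "1 - of_int (k * l) = (0::real)"
    using nv span_scale[of "(1 - of_int (k * l)) *\<^sub>R v" \<tau> "1 / (1 - of_int (k * l))"]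
    by (auto split: if_splits)
  then have kl: "k * l = 1" using of_int_eq_iff[of 1 "k * l", where ?'a = real] by simp
  then have "k = 1 \<or> k = -1" using zmult_eq_1_iff by blast
  then show ?thesis
  proof
    assume "k = 1"
    then show ?thesis using k by simp
  next
    assume "k = -1"
    then have "v + v' \<in> span \<tau>" using k by simp
    then have "(v + v') - (v - a) - (v' - b) \<in> span \<tau>" by (rule span_diff[OF span_diff[OF _ ab(3)] ab(6)])
    then have "a + b \<in> span \<tau>" by (simp add: algebra_simps)
    then show ?thesis using pt ab by blast
  qed
qed

text \<open>Removes the choice made in \<open>normal_vector\<close>: modulo
  \<open>span \<tau>\<close> any vector that qualifies may be used in its place, for instance one
  transported from another fan.\<close>

lemma normal_vector_cong:
  assumes "is_normal_vector N \<eta> \<tau> v"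
    and "\<And>x y. x \<in> \<eta> \<Longrightarrow> y \<in> \<eta> \<Longrightarrow> x + y \<in> span \<tau> \<Longrightarrow> x \<in> span \<tau>"
  shows "normal_vector N \<eta> \<tau> - v \<in> span \<tau>"
  by (rule normal_vector_unique[OF _ assms])
    (auto simp: normal_vector_def intro: someI[of "is_normal_vector N \<eta> \<tau>", OF assms(1)])

lemma span_sum_cong:
  assumes "\<And>i. i \<in> I \<Longrightarrow> f i - g i \<in> span T"
  shows "(\<Sum>i\<in>I. w i *\<^sub>R f i) \<in> span T \<longleftrightarrow> (\<Sum>i\<in>I. w i *\<^sub>R g i) \<in> span T"
proof -
  have d: "(\<Sum>i\<in>I. w i *\<^sub>R f i) - (\<Sum>i\<in>I. w i *\<^sub>R g i) \<in> span T"
    unfolding sum_subtractf[symmetric] scaleR_diff_right[symmetric]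
    using assms by (intro span_sum span_scale)
  show ?thesis
    using span_add_eq[OF d, of "\<Sum>i\<in>I. w i *\<^sub>R g i"] by simp
qed

text \<open>One form for quotient maps, isomorphisms of spans, the exchange of factors and graph
  embeddings. The condition \<open>ker\<close> keeps a point off the wall off the image of the
  wall.\<close>

lemma normal_vector_image:
  assumes q: "linear q" and v: "is_normal_vector N \<eta> \<tau> v"
    and "sublat N' (q ` \<eta>) = q ` sublat N \<eta>" "sublat N' (q ` \<tau>) = q ` sublat N \<tau>"
    and ker: "\<And>x. x \<in> span \<eta> \<Longrightarrow> q x \<in> span (q ` \<tau>) \<Longrightarrow> x \<in> span \<tau>"
  shows "is_normal_vector N' (q ` \<eta>) (q ` \<tau>) (q v)"
  unfolding is_normal_vector_def
proof (intro conjI)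
  show "q v \<in> sublat N' (q ` \<eta>)" using v assms(3) by (auto simp: is_normal_vector_def)
  obtain x where x: "x \<in> \<eta>" "x \<notin> span \<tau>" "v - x \<in> span \<tau>" using v unfolding is_normal_vector_def by blast
  have "q v - q x \<in> span (q ` \<tau>)" using x q by (simp add: linear_diff[symmetric] linear_span_image)
  moreover have "q x \<notin> span (q ` \<tau>)" using ker x span_base by blast
  ultimately show "\<exists>x\<in>q ` \<eta> - span (q ` \<tau>). q v - x \<in> span (q ` \<tau>)" using x by blast
  have "sublat N \<eta> = {x + of_int k *\<^sub>R v | x (k::int). x \<in> sublat N \<tau>}"
    using v unfolding is_normal_vector_def by blast
  then have "q ` sublat N \<eta> = q ` {x + of_int k *\<^sub>R v | x (k::int). x \<in> sublat N \<tau>}" by simp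
  also have "\<dots> = {x + of_int k *\<^sub>R q v | x (k::int). x \<in> q ` sublat N \<tau>}"
    (is "?L = ?R")
  proof
    show "?L \<subseteq> ?R"
    proof clarify
      fix y and k :: int assume "y \<in> sublat N \<tau>"
      moreover have "q (y + of_int k *\<^sub>R v) = q y + of_int k *\<^sub>R q v"
        by (simp add: linear_add[OF q] linear_scale[OF q])
      ultimately show "\<exists>x l. q (y + of_int k *\<^sub>R v) = x + of_int l *\<^sub>R q v \<and> x \<in> q ` sublat N \<tau>" by blast
    qed
    show "?R \<subseteq> ?L"
    proof clarify
      fix y and k :: int assume "y \<in> sublat N \<tau>"
      moreover have "q y + of_int k *\<^sub>R q v = q (y + of_int k *\<^sub>R v)"
        by (simp add: linear_add[OF q] linear_scale[OF q])
      ultimately show "q y + of_int k *\<^sub>R q v \<in> ?L" by blast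
    qed
  qed
  finally show "{x + of_int k *\<^sub>R q v | x (k::int). x \<in> sublat N' (q ` \<tau>)} = sublat N' (q ` \<eta>)"
    using assms(3,4) by simp
qed

section \<open>Top-dimensional weights near a cone, and the basic incidence facts of a fan\<close>

section \<open>Local weights on rational fans\<close>

abbreviation top_cones :: "('a::real_vector, 'm) ofan_scheme \<Rightarrow> 'a set set" where
  "top_cones F \<equiv> cones_of_dim F (fan_dim F)"

definition balanced_at :: "('a::real_vector, 'm) ofan_scheme \<Rightarrow> ('a set \<Rightarrow> real) \<Rightarrow> 'a set \<Rightarrow> bool" where
  "balanced_at F w \<tau> \<longleftrightarrow>
     (\<Sum>\<sigma> | \<sigma> \<in> top_cones F \<and> \<tau> \<subseteq> \<sigma>. w \<sigma> *\<^sub>R normal_vector (lat F) \<sigma> \<tau>) \<in> span \<tau>"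

text \<open>Minkowski weights of top dimension on the star fan at \<open>\<sigma>\<close>, read on \<open>F\<close> itself.\<close>

definition local_weight ::
    "real set \<Rightarrow> ('a::real_vector, 'm) ofan_scheme \<Rightarrow> 'a set \<Rightarrow> ('a set \<Rightarrow> real) \<Rightarrow> bool" where
  "local_weight K F \<sigma> w \<longleftrightarrow>
     (\<forall>\<eta>\<in>top_cones F. \<sigma> \<subseteq> \<eta> \<longrightarrow> w \<eta> \<in> K) \<and>
     (\<forall>\<tau>\<in>cones F. Suc (dim \<tau>) = fan_dim F \<and> \<sigma> \<subseteq> \<tau> \<longrightarrow> balanced_at F w \<tau>)"

text \<open>Local irreducibility freed from star fans. It makes sense for any fan data, so it can be
  proved for a product or a modification that is only known to be isomorphic to a fan.\<close>

definition rigid :: "real set \<Rightarrow> ('a::real_vector, 'm) ofan_scheme \<Rightarrow> bool" where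
  "rigid K F \<longleftrightarrow>
     (\<forall>\<sigma>\<in>cones F. \<forall>w. local_weight K F \<sigma> w \<longrightarrow>
        (\<exists>c\<in>K. \<forall>\<eta>\<in>top_cones F. \<sigma> \<subseteq> \<eta> \<longrightarrow> w \<eta> = c * ori F \<eta>))"

lemma rigidD:
  assumes "rigid K F" "\<sigma> \<in> cones F" "local_weight K F \<sigma> w"
  obtains c where "c \<in> K" "\<And>\<eta>. \<eta> \<in> top_cones F \<Longrightarrow> \<sigma> \<subseteq> \<eta> \<Longrightarrow> w \<eta> = c * ori F \<eta>"
proof -
  have "\<exists>c\<in>K. \<forall>\<eta>\<in>top_cones F. \<sigma> \<subseteq> \<eta> \<longrightarrow> w \<eta> = c * ori F \<eta>"
    by (rule assms(1)[unfolded rigid_def, THEN bspec, THEN spec, THEN mp]) (use assms in auto)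
  then show ?thesis using that by blast
qed

lemma balanced_at_cong:
  assumes "\<And>\<eta>. \<eta> \<in> top_cones F \<Longrightarrow> \<tau> \<subseteq> \<eta> \<Longrightarrow> w \<eta> = w' \<eta>"
  shows "balanced_at F w \<tau> \<longleftrightarrow> balanced_at F w' \<tau>"
proof -
  have "(\<Sum>\<sigma> | \<sigma> \<in> top_cones F \<and> \<tau> \<subseteq> \<sigma>. w \<sigma> *\<^sub>R normal_vector (lat F) \<sigma> \<tau>) =
        (\<Sum>\<sigma> | \<sigma> \<in> top_cones F \<and> \<tau> \<subseteq> \<sigma>. w' \<sigma> *\<^sub>R normal_vector (lat F) \<sigma> \<tau>)"
    by (rule sum.cong) (use assms in auto)
  then show ?thesis by (simp add: balanced_at_def)
qed

lemma local_weight_cong: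
  assumes "\<And>\<eta>. \<eta> \<in> top_cones F \<Longrightarrow> \<sigma> \<subseteq> \<eta> \<Longrightarrow> w \<eta> = w' \<eta>"
  shows "local_weight K F \<sigma> w \<longleftrightarrow> local_weight K F \<sigma> w'"
proof -
  have "balanced_at F w \<tau> \<longleftrightarrow> balanced_at F w' \<tau>" if "\<sigma> \<subseteq> \<tau>" for \<tau>
    by (rule balanced_at_cong) (use assms that in auto)
  then show ?thesis using assms by (auto simp: local_weight_def)
qed

lemma balanced_at_scale: "balanced_at F w \<tau> \<Longrightarrow> balanced_at F (\<lambda>\<eta>. c * w \<eta>) \<tau>"
  unfolding balanced_at_def scaleR_scaleR[symmetric] scaleR_sum_right[symmetric] by (rule span_scale)

lemma rational_fanD:
  assumes "rational_fan F"
  shows "is_lattice (lat F)" "finite (cones F)" "cones F \<noteq> {}"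
    "\<sigma> \<in> cones F \<Longrightarrow> rational_polyhedral_cone (lat F) \<sigma>"
    "\<sigma> \<in> cones F \<Longrightarrow> strongly_convex \<sigma>"
    "\<sigma> \<in> cones F \<Longrightarrow> \<tau> face_of \<sigma> \<Longrightarrow> \<tau> \<noteq> {} \<Longrightarrow> \<tau> \<in> cones F"
    "\<sigma> \<in> cones F \<Longrightarrow> \<eta> \<in> cones F \<Longrightarrow> \<sigma> \<inter> \<eta> face_of \<sigma>"
  using assms unfolding rational_fan_def by blast+

lemma rational_fan_cone:
  assumes "rational_fan F" "\<sigma> \<in> cones F"
  shows "convex_cone \<sigma>" "fin_dim \<sigma>" "fg_cone \<sigma>" "0 \<in> \<sigma>"
  using rational_fanD(4)[OF assms] rational_polyhedral_cone_fg fg_cone_convex_cone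
    rational_polyhedral_cone_fin_dim convex_cone_contains_0 by blast+

lemma rational_fan_subset_face:
  assumes "rational_fan F" "\<sigma> \<in> cones F" "\<tau> \<in> cones F" "\<tau> \<subseteq> \<sigma>"
  shows "\<tau> face_of \<sigma>"
  using rational_fanD(7)[OF assms(1-3)] assms(4) by (simp add: Int_absorb1)

lemma rational_fan_Int:
  assumes "rational_fan F" "\<sigma> \<in> cones F" "\<eta> \<in> cones F"
  shows "\<sigma> \<inter> \<eta> \<in> cones F"
  using rational_fanD(6)[OF assms(1,2) rational_fanD(7)[OF assms]] rational_fan_cone(4)[OF assms(1)] assms by blast

lemma rational_fan_pointed:
  assumes "rational_fan F" "\<sigma> \<in> cones F" "\<tau> \<in> cones F" "\<tau> \<subseteq> \<sigma>" "x \<in> \<sigma>" "y \<in> \<sigma>" "x + y \<in> span \<tau>"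
  shows "x \<in> span \<tau>"
  using face_of_add_span[OF rational_fan_cone(1)[OF assms(1,2)] rational_fan_subset_face[OF assms(1-4)]]
    rational_fan_cone(4)[OF assms(1,3)] assms(5-7) by blast

lemma rational_fan_dim_le:
  assumes "rational_fan F" "\<sigma> \<in> cones F"
  shows "dim \<sigma> \<le> fan_dim F"
  unfolding fan_dim_def using assms rational_fanD(2)[OF assms(1)] by simp

lemma rational_fan_dim_mono:
  assumes "rational_fan F" "\<sigma> \<in> cones F" "S \<subseteq> span \<sigma>"
  shows "dim S \<le> dim \<sigma>"
  using dim_mono_fin rational_fan_cone(2)[OF assms(1,2)] assms(3) by blast

lemma rational_fan_eq_of_span:
  assumes "rational_fan F" "\<sigma> \<in> cones F" "\<tau> \<in> cones F" "\<tau> \<subseteq> \<sigma>" "\<sigma> \<subseteq> span \<tau>"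
  shows "\<tau> = \<sigma>"
  using face_of_Int_span[OF rational_fan_cone(1)[OF assms(1,2)] rational_fan_subset_face[OF assms(1-4)]]
    rational_fan_cone(4)[OF assms(1,3)] assms(5) by blast

lemma rational_fan_eq_of_dim:
  assumes "rational_fan F" "\<sigma> \<in> cones F" "\<tau> \<in> cones F" "\<tau> \<subseteq> \<sigma>" "dim \<sigma> \<le> dim \<tau>"
  shows "\<tau> = \<sigma>"
proof (rule rational_fan_eq_of_span[OF assms(1-4)])
  have "span \<tau> = span \<sigma>"
    by (rule span_eq_of_dim[OF rational_fan_cone(2)[OF assms(1,2)] _ assms(5)])
      (use assms(4) span_superset in blast)
  then show "\<sigma> \<subseteq> span \<tau>" using span_superset by blast
qed

lemma rational_fan_normal_vector:
  assumes "rational_fan F" "\<sigma> \<in> cones F" "\<tau> \<in> cones F" "\<tau> \<subseteq> \<sigma>" "Suc (dim \<tau>) = dim \<sigma>"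
  shows "is_normal_vector (lat F) \<sigma> \<tau> (normal_vector (lat F) \<sigma> \<tau>)"
  unfolding normal_vector_def
  by (rule someI_ex, rule normal_vector_exists)
    (use assms rational_fanD[OF assms(1)] in auto)

lemma tropical_fan_rational: "tropical_fan F \<Longrightarrow> rational_fan F"
  by (simp add: tropical_fan_def)

lemma tropical_fan_balanced:
  assumes "tropical_fan F" "\<tau> \<in> cones F" "Suc (dim \<tau>) = fan_dim F"
  shows "balanced_at F (ori F) \<tau>"
proof -
  have "(\<Sum>\<sigma> | \<sigma> \<in> top_cones F \<and> \<tau> \<subseteq> \<sigma>. restrict (ori F) (top_cones F) \<sigma> *\<^sub>R normal_vector (lat F) \<sigma> \<tau>) \<in> span \<tau>"
    using assms unfolding tropical_fan_def minkowski_weights_def by blast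
  then have "balanced_at F (restrict (ori F) (top_cones F)) \<tau>" by (simp add: balanced_at_def)
  then show ?thesis by (subst balanced_at_cong[where w' = "restrict (ori F) (top_cones F)"]) auto
qed

lemma tropical_fan_ori:
  assumes "tropical_fan F" "\<eta> \<in> top_cones F"
  shows "ori F \<eta> \<in> \<int>" "ori F \<eta> \<noteq> 0"
proof -
  have "restrict (ori F) (top_cones F) \<in> top_cones F \<rightarrow>\<^sub>E \<int>"
    using assms unfolding tropical_fan_def minkowski_weights_def by blast
  then have "restrict (ori F) (top_cones F) \<eta> \<in> \<int>" using assms(2) by (rule PiE_mem)
  then show "ori F \<eta> \<in> \<int>" using assms(2) by simp
  show "ori F \<eta> \<noteq> 0" using assms unfolding tropical_fan_def by blast
qed

section \<open>Translation between weights on a star fan and local weights\<close>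

section \<open>Star fans\<close>

context
  fixes F :: "('a::real_vector, 'm) ofan_scheme" and \<sigma> :: "'a set"
  assumes rf: "rational_fan F" and \<sigma>: "\<sigma> \<in> cones F"
begin

lemma quot_map_eq_0: "quot_map \<sigma> x = 0 \<longleftrightarrow> x \<in> span \<sigma>"
  using quot_map(2)[of \<sigma>] by blast

lemma quot_map_eq: "quot_map \<sigma> x = quot_map \<sigma> y \<longleftrightarrow> x - y \<in> span \<sigma>"
  using quot_map_eq_0[of "x - y"] linear_diff[OF quot_map(1)[of \<sigma>], of x y] by simp

lemma quot_map_mem_span:
  assumes "\<sigma> \<subseteq> \<tau>"
  shows "quot_map \<sigma> x \<in> span (quot_map \<sigma> ` \<tau>) \<longleftrightarrow> x \<in> span \<tau>"
proof
  assume "quot_map \<sigma> x \<in> span (quot_map \<sigma> ` \<tau>)"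
  then obtain y where "y \<in> span \<tau>" "x - y \<in> span \<sigma>"
    unfolding linear_span_image[OF quot_map(1)] quot_map_eq[symmetric] by blast
  then show "x \<in> span \<tau>" using span_mono[OF assms] span_add[of y \<tau> "x - y"] by auto
qed (simp add: linear_span_image[OF quot_map(1)])

text \<open>If \<open>x\<close> and \<open>y\<close> have the same image, adding suitable points of
  \<sigma> to both gives one common point of \<eta> and \<zeta>. Their intersection is a face of
  \<eta>, so it contains the summand \<open>x\<close>. Hence a cone around \<sigma> is determined by
  its image.\<close>

lemma quot_map_subset:
  assumes "\<eta> \<in> cones F" "\<sigma> \<subseteq> \<eta>" "\<zeta> \<in> cones F" "\<sigma> \<subseteq> \<zeta>"
  shows "quot_map \<sigma> ` \<eta> \<subseteq> quot_map \<sigma> ` \<zeta> \<longleftrightarrow> \<eta> \<subseteq> \<zeta>"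
proof
  assume sub: "quot_map \<sigma> ` \<eta> \<subseteq> quot_map \<sigma> ` \<zeta>"
  show "\<eta> \<subseteq> \<zeta>"
  proof
    fix x assume x: "x \<in> \<eta>"
    then obtain y where y: "y \<in> \<zeta>" "x - y \<in> span \<sigma>" using sub unfolding quot_map_eq[symmetric] by blast
    obtain a b where ab: "x - y = a - b" "a \<in> \<sigma>" "b \<in> \<sigma>"
      using y(2) span_convex_cone[OF rational_fan_cone(1)[OF rf \<sigma>]] by auto
    have "x + b = y + a" using ab(1) by (simp add: algebra_simps)
    moreover have "x + b \<in> \<eta>" "y + a \<in> \<zeta>"
      using x y ab assms rational_fan_cone(1)[OF rf] by (auto intro: convex_cone_add)
    ultimately have "x + b \<in> \<eta> \<inter> \<zeta>" by simp
    then have "x \<in> \<eta> \<inter> \<zeta>"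
      using face_of_add[OF rational_fan_cone(1)[OF rf assms(1)] rational_fanD(7)[OF rf assms(1,3)] x] ab assms by blast
    then show "x \<in> \<zeta>" by simp
  qed
qed auto

lemma quot_map_inj: "inj_on (image (quot_map \<sigma>)) {\<eta> \<in> cones F. \<sigma> \<subseteq> \<eta>}"
  by (rule inj_onI) (metis (mono_tags, lifting) mem_Collect_eq order_class.order_eq_iff quot_map_subset)

lemma dim_quot_map:
  assumes "\<eta> \<in> cones F" "\<sigma> \<subseteq> \<eta>"
  shows "dim (quot_map \<sigma> ` \<eta>) + dim \<sigma> = dim \<eta>"
  by (rule dim_quotient[OF quot_map(1) rational_fan_cone(2)[OF rf assms(1)] assms(2) quot_map_eq_0])

lemma sublat_quot_map:
  assumes "\<sigma> \<subseteq> \<eta>"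
  shows "sublat (quot_map \<sigma> ` lat F) (quot_map \<sigma> ` \<eta>) = quot_map \<sigma> ` sublat (lat F) \<eta>"
proof
  show "sublat (quot_map \<sigma> ` lat F) (quot_map \<sigma> ` \<eta>) \<subseteq> quot_map \<sigma> ` sublat (lat F) \<eta>"
    using quot_map_mem_span[OF assms] by (auto simp: sublat_def)
  show "quot_map \<sigma> ` sublat (lat F) \<eta> \<subseteq> sublat (quot_map \<sigma> ` lat F) (quot_map \<sigma> ` \<eta>)"
    using quot_map_mem_span[OF assms] by (auto simp: sublat_def)
qed

lemma lat_star [simp]: "lat (star_fan F \<sigma>) = quot_map \<sigma> ` lat F"
  by (simp add: star_fan_def)

lemma cones_star: "cones (star_fan F \<sigma>) = image (quot_map \<sigma>) ` {\<eta> \<in> cones F. \<sigma> \<subseteq> \<eta>}"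
  by (auto simp: star_fan_def)

lemma ori_star:
  assumes "\<eta> \<in> cones F" "\<sigma> \<subseteq> \<eta>"
  shows "ori (star_fan F \<sigma>) (quot_map \<sigma> ` \<eta>) = ori F \<eta>"
proof -
  have "(THE \<zeta>. \<zeta> \<in> cones F \<and> \<sigma> \<subseteq> \<zeta> \<and> quot_map \<sigma> ` \<zeta> = quot_map \<sigma> ` \<eta>) = \<eta>"
    using assms quot_map_inj by (intro the_equality) (auto simp: inj_on_def)
  then show ?thesis by (simp add: star_fan_def)
qed

lemma top_cones_star:
  "cones_of_dim (star_fan F \<sigma>) (fan_dim F - dim \<sigma>) = image (quot_map \<sigma>) ` {\<eta> \<in> top_cones F. \<sigma> \<subseteq> \<eta>}"
proof -
  have "dim (quot_map \<sigma> ` \<eta>) = fan_dim F - dim \<sigma> \<longleftrightarrow> dim \<eta> = fan_dim F" if "\<eta> \<in> cones F" "\<sigma> \<subseteq> \<eta>" for \<eta>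
    using dim_quot_map[OF that] rational_fan_dim_le[OF rf \<sigma>] by linarith
  then show ?thesis unfolding cones_of_dim_def cones_star by blast
qed

lemma normal_vector_star:
  assumes "\<eta> \<in> cones F" "\<tau> \<in> cones F" "\<sigma> \<subseteq> \<tau>" "\<tau> \<subseteq> \<eta>" "Suc (dim \<tau>) = dim \<eta>"
  shows "normal_vector (quot_map \<sigma> ` lat F) (quot_map \<sigma> ` \<eta>) (quot_map \<sigma> ` \<tau>)
          - quot_map \<sigma> (normal_vector (lat F) \<eta> \<tau>) \<in> span (quot_map \<sigma> ` \<tau>)"
proof (rule normal_vector_cong)
  have "\<sigma> \<subseteq> \<eta>" using assms by blast
  then show "is_normal_vector (quot_map \<sigma> ` lat F) (quot_map \<sigma> ` \<eta>) (quot_map \<sigma> ` \<tau>)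
      (quot_map \<sigma> (normal_vector (lat F) \<eta> \<tau>))"
    using rational_fan_normal_vector[OF rf assms(1,2,4,5)] sublat_quot_map quot_map_mem_span assms
    by (intro normal_vector_image quot_map(1)) auto
next
  fix x y
  assume "x \<in> quot_map \<sigma> ` \<eta>" "y \<in> quot_map \<sigma> ` \<eta>" and s: "x + y \<in> span (quot_map \<sigma> ` \<tau>)"
  then obtain a b where ab: "a \<in> \<eta>" "b \<in> \<eta>" "x = quot_map \<sigma> a" "y = quot_map \<sigma> b" by blast
  have "a + b \<in> span \<tau>"
    using s unfolding ab linear_add[OF quot_map(1), symmetric] quot_map_mem_span[OF assms(3)] .
  then show "x \<in> span (quot_map \<sigma> ` \<tau>)"
    unfolding ab quot_map_mem_span[OF assms(3)] using rational_fan_pointed[OF rf] assms ab by blast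
qed

text \<open>Top cones around \<tau> correspond to their images, normal vectors to normal vectors
  modulo the wall, and since \<open>span \<tau>\<close> contains the kernel, membership in the span
  can be tested before projecting.\<close>

lemma balanced_at_star:
  assumes "\<tau> \<in> cones F" "\<sigma> \<subseteq> \<tau>" "Suc (dim \<tau>) = fan_dim F"
  shows "(\<Sum>\<zeta> | \<zeta> \<in> cones_of_dim (star_fan F \<sigma>) (fan_dim F - dim \<sigma>) \<and> quot_map \<sigma> ` \<tau> \<subseteq> \<zeta>.
            w \<zeta> *\<^sub>R normal_vector (lat (star_fan F \<sigma>)) \<zeta> (quot_map \<sigma> ` \<tau>)) \<in> span (quot_map \<sigma> ` \<tau>)
          \<longleftrightarrow> balanced_at F (\<lambda>\<eta>. w (quot_map \<sigma> ` \<eta>)) \<tau>"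
proof -
  let ?q = "quot_map \<sigma>"
  let ?C = "{\<eta> \<in> top_cones F. \<tau> \<subseteq> \<eta>}"
  have C: "\<eta> \<in> cones F" "\<sigma> \<subseteq> \<eta>" "\<tau> \<subseteq> \<eta>" "Suc (dim \<tau>) = dim \<eta>" if "\<eta> \<in> ?C" for \<eta>
    using that assms by (auto simp: cones_of_dim_def)
  have "{\<zeta>. \<zeta> \<in> cones_of_dim (star_fan F \<sigma>) (fan_dim F - dim \<sigma>) \<and> ?q ` \<tau> \<subseteq> \<zeta>} = image ?q ` ?C" (is "?L = ?R")
  proof
    show "?L \<subseteq> ?R"
    proof
      fix \<zeta> assume "\<zeta> \<in> ?L"
      then obtain \<eta> where \<eta>: "\<eta> \<in> top_cones F" "\<sigma> \<subseteq> \<eta>" "\<zeta> = ?q ` \<eta>" "?q ` \<tau> \<subseteq> ?q ` \<eta>"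
        unfolding top_cones_star by blast
      then have "\<tau> \<subseteq> \<eta>" using quot_map_subset[of \<tau> \<eta>] assms by (auto simp: cones_of_dim_def)
      then show "\<zeta> \<in> ?R" using \<eta> by blast
    qed
    show "?R \<subseteq> ?L" unfolding top_cones_star using assms(2) by blast
  qed
  moreover have "inj_on (image ?q) ?C"
    using quot_map_inj by (rule inj_on_subset) (use C in blast)
  ultimately have 1: "(\<Sum>\<zeta> | \<zeta> \<in> cones_of_dim (star_fan F \<sigma>) (fan_dim F - dim \<sigma>) \<and> ?q ` \<tau> \<subseteq> \<zeta>.
            w \<zeta> *\<^sub>R normal_vector (lat (star_fan F \<sigma>)) \<zeta> (?q ` \<tau>))
      = (\<Sum>\<eta>\<in>?C. w (?q ` \<eta>) *\<^sub>R normal_vector (?q ` lat F) (?q ` \<eta>) (?q ` \<tau>))"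
    by (simp add: sum.reindex)
  have 2: "(\<Sum>\<eta>\<in>?C. w (?q ` \<eta>) *\<^sub>R normal_vector (?q ` lat F) (?q ` \<eta>) (?q ` \<tau>)) \<in> span (?q ` \<tau>)
      \<longleftrightarrow> (\<Sum>\<eta>\<in>?C. w (?q ` \<eta>) *\<^sub>R ?q (normal_vector (lat F) \<eta> \<tau>)) \<in> span (?q ` \<tau>)"
    by (rule span_sum_cong) (use C assms in \<open>blast intro: normal_vector_star\<close>)
  have 3: "(\<Sum>\<eta>\<in>?C. w (?q ` \<eta>) *\<^sub>R ?q (normal_vector (lat F) \<eta> \<tau>)) =
      ?q (\<Sum>\<eta>\<in>?C. w (?q ` \<eta>) *\<^sub>R normal_vector (lat F) \<eta> \<tau>)"
    by (simp add: linear_sum[OF quot_map(1)] linear_scale[OF quot_map(1)])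
  show ?thesis
    unfolding 1 2 unfolding 3 quot_map_mem_span[OF assms(2)] balanced_at_def ..
qed

lemma minkowski_weights_star:
  "w \<in> minkowski_weights (star_fan F \<sigma>) K (fan_dim F - dim \<sigma>) \<longleftrightarrow>
     w \<in> extensional (cones_of_dim (star_fan F \<sigma>) (fan_dim F - dim \<sigma>)) \<and>
     local_weight K F \<sigma> (\<lambda>\<eta>. w (quot_map \<sigma> ` \<eta>))"
proof -
  let ?q = "quot_map \<sigma>" and ?p = "fan_dim F - dim \<sigma>"
  let ?D = "cones_of_dim (star_fan F \<sigma>) ?p"
  \<comment> \<open>The bound on \<open>dim \<sigma>\<close> makes the truncated difference
    \<open>fan_dim F - dim \<sigma>\<close> the true one.\<close>
  have *: "Suc (dim (?q ` \<tau>)) = ?p \<longleftrightarrow> Suc (dim \<tau>) = fan_dim F" if "\<tau> \<in> cones F" "\<sigma> \<subseteq> \<tau>" for \<tau>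
    using dim_quot_map[OF that] rational_fan_dim_le[OF rf \<sigma>] by linarith
  let ?bal = "\<lambda>\<tau>. (\<Sum>\<zeta> | \<zeta> \<in> cones_of_dim (star_fan F \<sigma>) ?p \<and> \<tau> \<subseteq> \<zeta>.
      w \<zeta> *\<^sub>R normal_vector (lat (star_fan F \<sigma>)) \<zeta> \<tau>) \<in> span \<tau>"
  have "?bal (?q ` \<tau>) \<longleftrightarrow> balanced_at F (\<lambda>\<eta>. w (?q ` \<eta>)) \<tau>"
    if "\<tau> \<in> cones F" "\<sigma> \<subseteq> \<tau>" "Suc (dim \<tau>) = fan_dim F" for \<tau>
    by (rule balanced_at_star[OF that])
  then have bal: "(\<forall>\<tau>\<in>cones (star_fan F \<sigma>). Suc (dim \<tau>) = ?p \<longrightarrow> ?bal \<tau>) \<longleftrightarrow>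
      (\<forall>\<tau>\<in>cones F. Suc (dim \<tau>) = fan_dim F \<and> \<sigma> \<subseteq> \<tau> \<longrightarrow> balanced_at F (\<lambda>\<eta>. w (?q ` \<eta>)) \<tau>)"
    unfolding cones_star using * by auto
  have val: "w \<in> ?D \<rightarrow>\<^sub>E K \<longleftrightarrow> w \<in> extensional ?D \<and> (\<forall>\<eta>\<in>top_cones F. \<sigma> \<subseteq> \<eta> \<longrightarrow> w (?q ` \<eta>) \<in> K)"
    unfolding PiE_iff top_cones_star by auto
  show ?thesis
    unfolding minkowski_weights_def local_weight_def mem_Collect_eq bal val by simp
qed

end

text \<open>Multiples of the orientation are always weights, since \<open>K\<close> contains the
  integers and is closed under products. So the equality of sets amounts to the inclusion of weights
  in multiples, which is rigidity.\<close>

lemma locally_irreducible_over_iff_rigid: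
  fixes F :: "('a::real_vector, 'm) ofan_scheme"
  assumes F: "tropical_fan F" and K: "\<int> \<subseteq> K" "\<And>a b. a \<in> K \<Longrightarrow> b \<in> K \<Longrightarrow> a * b \<in> K"
  shows "locally_irreducible_over K F \<longleftrightarrow> rigid K F"
proof -
  note rf = tropical_fan_rational[OF F]
  have "minkowski_weights (star_fan F \<sigma>) K (fan_dim F - dim \<sigma>) =
        {\<lambda>\<zeta>\<in>cones_of_dim (star_fan F \<sigma>) (fan_dim F - dim \<sigma>). c * ori (star_fan F \<sigma>) \<zeta> | c. c \<in> K}
    \<longleftrightarrow> (\<forall>w. local_weight K F \<sigma> w \<longrightarrow>
        (\<exists>c\<in>K. \<forall>\<eta>\<in>top_cones F. \<sigma> \<subseteq> \<eta> \<longrightarrow> w \<eta> = c * ori F \<eta>))" (is "?L = ?R \<longleftrightarrow> ?P")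
    if \<sigma>: "\<sigma> \<in> cones F" for \<sigma>
  proof -
    let ?q = "quot_map \<sigma>" and ?p = "fan_dim F - dim \<sigma>"
    let ?D = "cones_of_dim (star_fan F \<sigma>) ?p"
    have D: "?D = image ?q ` {\<eta> \<in> top_cones F. \<sigma> \<subseteq> \<eta>}" by (rule top_cones_star[OF rf \<sigma>])
    have ori: "ori (star_fan F \<sigma>) (?q ` \<eta>) = ori F \<eta>" if "\<eta> \<in> top_cones F" "\<sigma> \<subseteq> \<eta>" for \<eta>
      using ori_star[OF rf \<sigma>] that by (simp add: cones_of_dim_def)
    have "?R \<subseteq> ?L"
    proof clarify
      fix c assume c: "c \<in> K"
      let ?w = "\<lambda>\<zeta>\<in>?D. c * ori (star_fan F \<sigma>) \<zeta>"
      have w: "?w (?q ` \<eta>) = c * ori F \<eta>" if "\<eta> \<in> top_cones F" "\<sigma> \<subseteq> \<eta>" for \<eta>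
        using ori that unfolding D by simp
      have "local_weight K F \<sigma> (\<lambda>\<eta>. c * ori F \<eta>)"
        unfolding local_weight_def
        using tropical_fan_ori[OF F] c K tropical_fan_balanced[OF F] balanced_at_scale by blast
      then have "local_weight K F \<sigma> (\<lambda>\<eta>. ?w (?q ` \<eta>))"
        using local_weight_cong[of F \<sigma> "\<lambda>\<eta>. ?w (?q ` \<eta>)" "\<lambda>\<eta>. c * ori F \<eta>"] w by blast
      then show "?w \<in> ?L" unfolding minkowski_weights_star[OF rf \<sigma>] by auto
    qed
    moreover have "?L \<subseteq> ?R \<longleftrightarrow> ?P"
    proof
      assume P: ?P
      show "?L \<subseteq> ?R"
      proof
        fix w assume "w \<in> ?L"
        then have w: "w \<in> extensional ?D" "local_weight K F \<sigma> (\<lambda>\<eta>. w (?q ` \<eta>))"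
          unfolding minkowski_weights_star[OF rf \<sigma>] by auto
        then obtain c where c: "c \<in> K" "\<And>\<eta>. \<eta> \<in> top_cones F \<Longrightarrow> \<sigma> \<subseteq> \<eta> \<Longrightarrow> w (?q ` \<eta>) = c * ori F \<eta>"
          using P by blast
        have "w = (\<lambda>\<zeta>\<in>?D. c * ori (star_fan F \<sigma>) \<zeta>)"
        proof (rule extensionalityI[OF w(1)])
          fix \<zeta> assume "\<zeta> \<in> ?D"
          then show "w \<zeta> = (\<lambda>\<zeta>\<in>?D. c * ori (star_fan F \<sigma>) \<zeta>) \<zeta>"
            using c(2) ori unfolding D by auto
        qed simp
        then show "w \<in> ?R" using c(1) by blast
      qed
    next
      assume LR: "?L \<subseteq> ?R"
      show ?P
      proof (intro allI impI)
        fix w assume w: "local_weight K F \<sigma> w"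
        \<comment> \<open>The weight moved to the star fan along the injection of cones around
          \<sigma>, and cut off so as to be extensional.\<close>
        define w' where "w' = (\<lambda>\<zeta>\<in>?D. w (inv_into {\<eta> \<in> cones F. \<sigma> \<subseteq> \<eta>} (image ?q) \<zeta>))"
        have w': "w' (?q ` \<eta>) = w \<eta>" if "\<eta> \<in> top_cones F" "\<sigma> \<subseteq> \<eta>" for \<eta>
        proof -
          have "inv_into {\<eta> \<in> cones F. \<sigma> \<subseteq> \<eta>} (image ?q) (?q ` \<eta>) = \<eta>"
            by (rule inv_into_f_f[OF quot_map_inj[OF rf \<sigma>]]) (use that in \<open>auto simp: cones_of_dim_def\<close>)
          then show ?thesis using that unfolding w'_def D by simp
        qed
        have "local_weight K F \<sigma> (\<lambda>\<eta>. w' (?q ` \<eta>))"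
          using w local_weight_cong[of F \<sigma> "\<lambda>\<eta>. w' (?q ` \<eta>)" w] w' by blast
        then have "w' \<in> ?L" unfolding minkowski_weights_star[OF rf \<sigma>] by (auto simp: w'_def)
        then obtain c where c: "c \<in> K" "w' = (\<lambda>\<zeta>\<in>?D. c * ori (star_fan F \<sigma>) \<zeta>)" using LR by blast
        have "w \<eta> = c * ori F \<eta>" if "\<eta> \<in> top_cones F" "\<sigma> \<subseteq> \<eta>" for \<eta>
        proof -
          have "?q ` \<eta> \<in> ?D" using that unfolding D by blast
          then show ?thesis using w'[OF that] ori[OF that] c(2) by simp
        qed
        then show "\<exists>c\<in>K. \<forall>\<eta>\<in>top_cones F. \<sigma> \<subseteq> \<eta> \<longrightarrow> w \<eta> = c * ori F \<eta>" using c(1) by blast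
      qed
    qed
    ultimately show ?thesis by blast
  qed
  then show ?thesis unfolding locally_irreducible_over_def rigid_def by (rule ball_cong[OF refl])
qed

section \<open>Transport of weights, faces and fan axioms along an isomorphism\<close>

section \<open>Isomorphisms of fans\<close>

text \<open>What the source of an isomorphism has to provide itself: enough lattice points in each
  cone for a map given on lattice points to control the real spans.\<close>

definition lattice_spanned :: "('a::real_vector, 'm) ofan_scheme \<Rightarrow> bool" where
  "lattice_spanned F \<longleftrightarrow> additive_subgroup (lat F) \<and> (\<forall>\<sigma>\<in>cones F. fin_dim \<sigma> \<and> \<sigma> \<subseteq> span (lat F \<inter> \<sigma>))"

lemma rational_polyhedral_cone_spanned:
  assumes "rational_polyhedral_cone N \<sigma>"
  shows "\<sigma> \<subseteq> span (N \<inter> \<sigma>)"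
proof -
  obtain G where G: "G \<subseteq> N" "\<sigma> = convex_cone hull G" using assms by (auto simp: rational_polyhedral_cone_def)
  have "G \<subseteq> N \<inter> \<sigma>" using G hull_subset[of G convex_cone] by auto
  then have "span G \<subseteq> span (N \<inter> \<sigma>)" by (rule span_mono)
  then show ?thesis using G span_convex_cone_hull[of G] span_superset by blast
qed

lemma rational_fan_lattice_spanned: "rational_fan F \<Longrightarrow> lattice_spanned F"
  unfolding lattice_spanned_def
  by (auto dest: rational_fanD(1,4) rational_fan_cone(2) intro: lattice_subgroup
      rational_polyhedral_cone_spanned[THEN subsetD])

text \<open>The assumptions are asymmetric on purpose: the target is a rational fan, while the
  source may be a construction whose fan axioms have not been verified.\<close>

locale fan_isomorphism =
  fixes F :: "('a::real_vector, 'm) ofan_scheme" and G :: "('b::real_vector, 'n) ofan_scheme" and \<phi> :: "'a \<Rightarrow> 'b"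
  assumes lin: "linear \<phi>"
    and bij_lat: "bij_betw \<phi> (lat F \<inter> span (supp F)) (lat G \<inter> span (supp G))"
    and bij_cones: "bij_betw (image \<phi>) (cones F) (cones G)"
    and ori_iso: "\<And>\<sigma>. \<sigma> \<in> top_cones F \<Longrightarrow> ori G (\<phi> ` \<sigma>) = ori F \<sigma>"
    and spanned: "lattice_spanned F"
    and ratG: "rational_fan G"
begin

lemma cone_subset: "\<sigma> \<in> cones F \<Longrightarrow> \<sigma> \<subseteq> span (supp F)"
  unfolding supp_def by (rule subset_trans[OF Union_upper span_superset])

text \<open>The lattice points on which \<phi> is injective span the support, and their images lie
  in a lattice, so discreteness extends injectivity to the real span.\<close>

lemma inj: "inj_on \<phi> (span (supp F))"
proof -
  let ?L = "lat F \<inter> span (supp F)"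
  have "inj_on \<phi> (span ?L)"
  proof (rule inj_on_span_subgroup[OF _ rational_fanD(1)[OF ratG] lin])
    show "additive_subgroup ?L"
      using spanned by (auto simp: lattice_spanned_def intro: additive_subgroup_Int additive_subgroup_subspace)
    show "inj_on \<phi> ?L" using bij_lat by (rule bij_betw_imp_inj_on)
    show "\<phi> ` ?L \<subseteq> lat G" using bij_betw_imp_surj_on[OF bij_lat] by blast
  qed
  moreover have "supp F \<subseteq> span ?L"
  proof
    fix x assume "x \<in> supp F"
    then obtain \<sigma> where \<sigma>: "\<sigma> \<in> cones F" "x \<in> \<sigma>" by (auto simp: supp_def)
    have "lat F \<inter> \<sigma> \<subseteq> ?L" using cone_subset[OF \<sigma>(1)] by blast
    then have "span (lat F \<inter> \<sigma>) \<subseteq> span ?L" by (rule span_mono)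
    then show "x \<in> span ?L" using \<sigma> spanned unfolding lattice_spanned_def by blast
  qed
  then have "span (supp F) \<subseteq> span ?L" by (simp add: span_minimal)
  ultimately show ?thesis by (rule inj_on_subset)
qed

lemma span_cone_subset: "\<sigma> \<in> cones F \<Longrightarrow> span \<sigma> \<subseteq> span (supp F)"
  using cone_subset span_minimal by blast

lemma image_cone: "\<sigma> \<in> cones F \<Longrightarrow> \<phi> ` \<sigma> \<in> cones G"
  using bij_cones by (rule bij_betwE[THEN bspec])

lemma cone_preimage:
  assumes "\<zeta> \<in> cones G"
  obtains \<sigma> where "\<sigma> \<in> cones F" "\<zeta> = \<phi> ` \<sigma>"
  using assms bij_betw_imp_surj_on[OF bij_cones] by blast

lemma image_subset_iff_cone:
  assumes "\<sigma> \<in> cones F" "\<tau> \<in> cones F"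
  shows "\<phi> ` \<tau> \<subseteq> \<phi> ` \<sigma> \<longleftrightarrow> \<tau> \<subseteq> \<sigma>"
  by (rule inj_on_image_subset_iff[OF inj]) (use assms cone_subset in auto)

lemma dim_image_cone: "\<sigma> \<in> cones F \<Longrightarrow> dim (\<phi> ` \<sigma>) = dim \<sigma>"
  using spanned inj_on_subset[OF inj span_cone_subset] unfolding lattice_spanned_def
  by (intro dim_image_inj_on lin) auto

lemma fan_dim_eq: "fan_dim G = fan_dim F"
proof -
  have "dim ` cones G = dim ` image \<phi> ` cones F" using bij_betw_imp_surj_on[OF bij_cones] by simp
  also have "\<dots> = dim ` cones F" using dim_image_cone by (force simp: image_image)
  finally show ?thesis by (simp add: fan_dim_def)
qed

lemma top_cones_eq: "top_cones G = image \<phi> ` top_cones F"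
  unfolding fan_dim_eq cones_of_dim_def bij_betw_imp_surj_on[OF bij_cones, symmetric]
  using dim_image_cone by auto

lemma image_mem_span: 
  assumes "\<sigma> \<in> cones F" "x \<in> span (supp F)"
  shows "\<phi> x \<in> span (\<phi> ` \<sigma>) \<longleftrightarrow> x \<in> span \<sigma>"
  unfolding linear_span_image[OF lin]
  using inj_on_image_mem_iff[OF inj assms(2) span_cone_subset[OF assms(1)]] .

lemma supp_eq: "supp G = \<phi> ` supp F"
  unfolding supp_def bij_betw_imp_surj_on[OF bij_cones, symmetric] by blast

lemma sublat_image:
  assumes "\<sigma> \<in> cones F"
  shows "sublat (lat G) (\<phi> ` \<sigma>) = \<phi> ` sublat (lat F) \<sigma>"
proof
  show "sublat (lat G) (\<phi> ` \<sigma>) \<subseteq> \<phi> ` sublat (lat F) \<sigma>"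
  proof
    fix y assume y: "y \<in> sublat (lat G) (\<phi> ` \<sigma>)"
    have "span (\<phi> ` \<sigma>) \<subseteq> span (supp G)"
      unfolding supp_eq by (intro span_mono image_mono) (use assms in \<open>auto simp: supp_def\<close>)
    then have "y \<in> lat G \<inter> span (supp G)" using y by (auto simp: sublat_def)
    then obtain x where x: "x \<in> lat F" "x \<in> span (supp F)" "y = \<phi> x"
      using bij_betw_imp_surj_on[OF bij_lat] by blast
    then show "y \<in> \<phi> ` sublat (lat F) \<sigma>"
      using y image_mem_span[OF assms] by (auto simp: sublat_def)
  qed
  show "\<phi> ` sublat (lat F) \<sigma> \<subseteq> sublat (lat G) (\<phi> ` \<sigma>)"
  proof
    fix y assume "y \<in> \<phi> ` sublat (lat F) \<sigma>"
    then obtain x where x: "x \<in> lat F" "x \<in> span \<sigma>" "y = \<phi> x" by (auto simp: sublat_def)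
    then have "x \<in> lat F \<inter> span (supp F)" using span_cone_subset[OF assms] by auto
    then have "y \<in> lat G" using bij_betw_imp_surj_on[OF bij_lat] x by blast
    then show "y \<in> sublat (lat G) (\<phi> ` \<sigma>)" using x by (auto simp: sublat_def linear_span_image[OF lin])
  qed
qed

text \<open>The general existence result does not apply to \<open>F\<close>, which is not known to
  be rational. A normal vector is therefore brought back from \<open>G\<close> by a linear left
  inverse of \<phi>, and only then compared with the chosen ones.\<close>

lemma normal_vector_iso:
  assumes "\<sigma> \<in> cones F" "\<tau> \<in> cones F" "\<tau> \<subseteq> \<sigma>" "Suc (dim \<tau>) = dim \<sigma>"
  shows "normal_vector (lat F) \<sigma> \<tau> \<in> span (supp F)"
    and "normal_vector (lat G) (\<phi> ` \<sigma>) (\<phi> ` \<tau>) - \<phi> (normal_vector (lat F) \<sigma> \<tau>) \<in> span (\<phi> ` \<tau>)"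
proof -
  have G: "\<phi> ` \<sigma> \<in> cones G" "\<phi> ` \<tau> \<in> cones G" "\<phi> ` \<tau> \<subseteq> \<phi> ` \<sigma>" "Suc (dim (\<phi> ` \<tau>)) = dim (\<phi> ` \<sigma>)"
    using assms image_cone dim_image_cone by auto
  obtain v where v: "is_normal_vector (lat G) (\<phi> ` \<sigma>) (\<phi> ` \<tau>) v"
    using rational_fan_normal_vector[OF ratG G] by blast
  obtain \<psi> where \<psi>: "linear \<psi>" "\<forall>x\<in>span (supp F). \<psi> (\<phi> x) = x"
    using linear_exists_left_inverse_on[OF lin subspace_span inj] by blast
  have \<psi>i: "\<psi> ` \<phi> ` A = A" if "A \<subseteq> span (supp F)" for A
    unfolding image_image using \<psi>(2) that by (auto simp: image_iff subset_iff)
  have \<psi>s: "\<psi> ` \<phi> ` \<eta> = \<eta>" "sublat (lat F) (\<psi> ` \<phi> ` \<eta>) = \<psi> ` sublat (lat G) (\<phi> ` \<eta>)" if "\<eta> \<in> cones F" for \<eta>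
  proof -
    show *: "\<psi> ` \<phi> ` \<eta> = \<eta>" by (rule \<psi>i[OF cone_subset[OF that]])
    have "sublat (lat F) \<eta> \<subseteq> span (supp F)" using span_cone_subset[OF that] by (auto simp: sublat_def)
    then show "sublat (lat F) (\<psi> ` \<phi> ` \<eta>) = \<psi> ` sublat (lat G) (\<phi> ` \<eta>)"
      unfolding * sublat_image[OF that] by (rule \<psi>i[symmetric])
  qed
  have "is_normal_vector (lat F) (\<psi> ` \<phi> ` \<sigma>) (\<psi> ` \<phi> ` \<tau>) (\<psi> v)"
  proof (rule normal_vector_image[OF \<psi>(1) v \<psi>s(2)[OF assms(1)] \<psi>s(2)[OF assms(2)]])
    fix x assume "x \<in> span (\<phi> ` \<sigma>)" and x: "\<psi> x \<in> span (\<psi> ` \<phi> ` \<tau>)"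
    then obtain y where y: "y \<in> span \<sigma>" "x = \<phi> y" unfolding linear_span_image[OF lin] by blast
    then have "\<psi> x = y" using \<psi>(2) span_cone_subset[OF assms(1)] by blast
    then have "y \<in> span \<tau>" using x \<psi>s(1)[OF assms(2)] by simp
    then show "x \<in> span (\<phi> ` \<tau>)" using y by (simp add: linear_span_image[OF lin])
  qed
  then have "is_normal_vector (lat F) \<sigma> \<tau> (\<psi> v)" using \<psi>s(1) assms by simp
  then have nF: "is_normal_vector (lat F) \<sigma> \<tau> (normal_vector (lat F) \<sigma> \<tau>)"
    unfolding normal_vector_def by (rule someI)
  then show "normal_vector (lat F) \<sigma> \<tau> \<in> span (supp F)"
    using span_cone_subset[OF assms(1)] by (auto simp: is_normal_vector_def sublat_def)
  show "normal_vector (lat G) (\<phi> ` \<sigma>) (\<phi> ` \<tau>) - \<phi> (normal_vector (lat F) \<sigma> \<tau>) \<in> span (\<phi> ` \<tau>)"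
  proof (rule normal_vector_cong)
    show "is_normal_vector (lat G) (\<phi> ` \<sigma>) (\<phi> ` \<tau>) (\<phi> (normal_vector (lat F) \<sigma> \<tau>))"
    proof (rule normal_vector_image[OF lin nF sublat_image[OF assms(1)] sublat_image[OF assms(2)]])
      fix x assume "x \<in> span \<sigma>" "\<phi> x \<in> span (\<phi> ` \<tau>)"
      then show "x \<in> span \<tau>" using image_mem_span[OF assms(2)] span_cone_subset[OF assms(1)] by blast
    qed
  qed (rule rational_fan_pointed[OF ratG G(1-3)])
qed

lemma balanced_at_iso:
  assumes "\<tau> \<in> cones F" "Suc (dim \<tau>) = fan_dim F"
  shows "balanced_at G w (\<phi> ` \<tau>) \<longleftrightarrow> balanced_at F (\<lambda>\<sigma>. w (\<phi> ` \<sigma>)) \<tau>"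
proof -
  let ?C = "{\<eta> \<in> top_cones F. \<tau> \<subseteq> \<eta>}"
  have C: "\<eta> \<in> cones F" "\<tau> \<subseteq> \<eta>" "Suc (dim \<tau>) = dim \<eta>" if "\<eta> \<in> ?C" for \<eta>
    using that assms by (auto simp: cones_of_dim_def)
  have "(\<Sum>\<eta>\<in>?C. w (\<phi> ` \<eta>) *\<^sub>R normal_vector (lat F) \<eta> \<tau>) \<in> span (supp F)"
    using C assms normal_vector_iso(1) by (intro span_sum span_scale) blast
  note mem = image_mem_span[OF assms(1) this]
  have im: "(\<Sum>\<eta>\<in>?C. w (\<phi> ` \<eta>) *\<^sub>R \<phi> (normal_vector (lat F) \<eta> \<tau>)) =
      \<phi> (\<Sum>\<eta>\<in>?C. w (\<phi> ` \<eta>) *\<^sub>R normal_vector (lat F) \<eta> \<tau>)"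
    by (simp add: linear_sum[OF lin] linear_scale[OF lin])
  have set: "{\<zeta>. \<zeta> \<in> top_cones G \<and> \<phi> ` \<tau> \<subseteq> \<zeta>} = image \<phi> ` ?C"
    unfolding top_cones_eq using image_subset_iff_cone assms(1) by (auto simp: cones_of_dim_def)
  have inj': "inj_on (image \<phi>) ?C"
    using bij_betw_imp_inj_on[OF bij_cones] by (rule inj_on_subset) (use C in blast)
  have "balanced_at G w (\<phi> ` \<tau>) \<longleftrightarrow>
      (\<Sum>\<eta>\<in>?C. w (\<phi> ` \<eta>) *\<^sub>R normal_vector (lat G) (\<phi> ` \<eta>) (\<phi> ` \<tau>)) \<in> span (\<phi> ` \<tau>)"
    unfolding balanced_at_def set sum.reindex[OF inj'] by (simp add: o_def)
  moreover have "\<dots> \<longleftrightarrow> (\<Sum>\<eta>\<in>?C. w (\<phi> ` \<eta>) *\<^sub>R \<phi> (normal_vector (lat F) \<eta> \<tau>)) \<in> span (\<phi> ` \<tau>)"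
    by (rule span_sum_cong) (use C assms in \<open>blast intro: normal_vector_iso(2)\<close>)
  ultimately show ?thesis unfolding im mem balanced_at_def by simp
qed

lemma local_weight_iso:
  assumes "\<sigma> \<in> cones F"
  shows "local_weight K G (\<phi> ` \<sigma>) w \<longleftrightarrow> local_weight K F \<sigma> (\<lambda>\<eta>. w (\<phi> ` \<eta>))"
proof -
  have "(\<forall>\<eta>\<in>top_cones G. \<phi> ` \<sigma> \<subseteq> \<eta> \<longrightarrow> w \<eta> \<in> K) \<longleftrightarrow> (\<forall>\<eta>\<in>top_cones F. \<sigma> \<subseteq> \<eta> \<longrightarrow> w (\<phi> ` \<eta>) \<in> K)"
    unfolding top_cones_eq using image_subset_iff_cone assms by (auto simp: cones_of_dim_def)
  moreover have "(\<forall>\<tau>\<in>cones G. Suc (dim \<tau>) = fan_dim G \<and> \<phi> ` \<sigma> \<subseteq> \<tau> \<longrightarrow> balanced_at G w \<tau>) \<longleftrightarrow>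
      (\<forall>\<tau>\<in>cones F. Suc (dim \<tau>) = fan_dim F \<and> \<sigma> \<subseteq> \<tau> \<longrightarrow> balanced_at F (\<lambda>\<eta>. w (\<phi> ` \<eta>)) \<tau>)"
    unfolding bij_betw_imp_surj_on[OF bij_cones, symmetric] fan_dim_eq
    using image_subset_iff_cone assms dim_image_cone balanced_at_iso by auto
  ultimately show ?thesis unfolding local_weight_def by blast
qed

lemma rigid_iso: "rigid K F \<longleftrightarrow> rigid K G"
proof
  assume F: "rigid K F"
  show "rigid K G"
    unfolding rigid_def
  proof (intro ballI allI impI)
    fix \<zeta> w assume "\<zeta> \<in> cones G" and w: "local_weight K G \<zeta> w"
    then obtain \<sigma> where \<sigma>: "\<sigma> \<in> cones F" "\<zeta> = \<phi> ` \<sigma>" using cone_preimage by blast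
    have "local_weight K F \<sigma> (\<lambda>\<eta>. w (\<phi> ` \<eta>))" using local_weight_iso[OF \<sigma>(1)] w unfolding \<sigma>(2) by blast
    then obtain c where c: "c \<in> K" "\<And>\<eta>. \<eta> \<in> top_cones F \<Longrightarrow> \<sigma> \<subseteq> \<eta> \<Longrightarrow> w (\<phi> ` \<eta>) = c * ori F \<eta>"
      using rigidD[OF F \<sigma>(1)] by blast
    then show "\<exists>c\<in>K. \<forall>\<eta>\<in>top_cones G. \<zeta> \<subseteq> \<eta> \<longrightarrow> w \<eta> = c * ori G \<eta>"
      unfolding top_cones_eq \<sigma>(2) using image_subset_iff_cone \<sigma>(1) ori_iso
      by (intro bexI[of _ c]) (auto simp: cones_of_dim_def)
  qed
next
  assume G: "rigid K G"
  show "rigid K F"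
    unfolding rigid_def
  proof (intro ballI allI impI)
    fix \<sigma> w assume \<sigma>: "\<sigma> \<in> cones F" and w: "local_weight K F \<sigma> w"
    let ?w = "\<lambda>\<zeta>. w (inv_into (cones F) (image \<phi>) \<zeta>)"
    have eq: "?w (\<phi> ` \<eta>) = w \<eta>" if "\<eta> \<in> cones F" for \<eta>
      using inv_into_f_f[OF bij_betw_imp_inj_on[OF bij_cones] that] by simp
    have "local_weight K F \<sigma> (\<lambda>\<eta>. ?w (\<phi> ` \<eta>)) \<longleftrightarrow> local_weight K F \<sigma> w"
      by (rule local_weight_cong) (use eq in \<open>auto simp: cones_of_dim_def\<close>)
    then have "local_weight K G (\<phi> ` \<sigma>) ?w" using w local_weight_iso[OF \<sigma>] by blast
    from rigidD[OF G image_cone[OF \<sigma>] this]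
    obtain c where c: "c \<in> K" "\<And>\<eta>. \<eta> \<in> top_cones G \<Longrightarrow> \<phi> ` \<sigma> \<subseteq> \<eta> \<Longrightarrow> ?w \<eta> = c * ori G \<eta>"
      by blast
    have "w \<eta> = c * ori F \<eta>" if \<eta>: "\<eta> \<in> top_cones F" "\<sigma> \<subseteq> \<eta>" for \<eta>
      using c(2)[of "\<phi> ` \<eta>"] \<eta> eq[of \<eta>] ori_iso[OF \<eta>(1)]
      unfolding top_cones_eq by (auto simp: cones_of_dim_def)
    then show "\<exists>c\<in>K. \<forall>\<eta>\<in>top_cones F. \<sigma> \<subseteq> \<eta> \<longrightarrow> w \<eta> = c * ori F \<eta>"
      using c(1) by blast
  qed
qed

text \<open>For blow-ups: balancing of the orientation is read off from the isomorphic tropical fan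
  instead of being derived from the fan that was blown up.\<close>

lemma balanced_at_ori:
  assumes "tropical_fan G" "\<tau> \<in> cones F" "Suc (dim \<tau>) = fan_dim F"
  shows "balanced_at F (ori F) \<tau>"
proof -
  have "balanced_at G (ori G) (\<phi> ` \<tau>)"
    using assms image_cone dim_image_cone fan_dim_eq by (intro tropical_fan_balanced) auto
  then have "balanced_at F (\<lambda>\<eta>. ori G (\<phi> ` \<eta>)) \<tau>" using balanced_at_iso assms by blast
  then show ?thesis using balanced_at_cong[of F \<tau> "ori F" "\<lambda>\<eta>. ori G (\<phi> ` \<eta>)"] ori_iso by simp
qed

text \<open>A linear map that is injective on the span preserves and reflects open segments;
  convexity of a preimage comes from the left inverse.\<close>

lemma face_of_image:
  assumes "A \<subseteq> span (supp F)" "B \<subseteq> span (supp F)"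
  shows "\<phi> ` A face_of \<phi> ` B \<longleftrightarrow> A face_of B"
proof -
  obtain \<psi> where \<psi>: "linear \<psi>" "\<forall>x\<in>span (supp F). \<psi> (\<phi> x) = x"
    using linear_exists_left_inverse_on[OF lin subspace_span inj] by blast
  have sub: "\<phi> ` A \<subseteq> \<phi> ` B \<longleftrightarrow> A \<subseteq> B" using inj_on_image_subset_iff[OF inj assms] .
  have "\<psi> ` \<phi> ` A = A" unfolding image_image using \<psi>(2) assms(1) by (auto simp: image_iff subset_iff)
  then have conv: "convex (\<phi> ` A) \<longleftrightarrow> convex A"
    using convex_linear_image[OF lin, of A] convex_linear_image[OF \<psi>(1), of "\<phi> ` A"] by auto
  have seg: "\<phi> x \<in> open_segment (\<phi> a) (\<phi> b) \<longleftrightarrow> x \<in> open_segment a b"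
    if "x \<in> span (supp F)" "a \<in> span (supp F)" "b \<in> span (supp F)" for x a b
  proof -
    have "\<phi> x = (1 - u) *\<^sub>R \<phi> a + u *\<^sub>R \<phi> b \<longleftrightarrow> x = (1 - u) *\<^sub>R a + u *\<^sub>R b" for u
    proof -
      have "(1 - u) *\<^sub>R a + u *\<^sub>R b \<in> span (supp F)" using that by (intro span_add span_scale)
      then show ?thesis
        using inj_on_eq_iff[OF inj that(1), of "(1 - u) *\<^sub>R a + u *\<^sub>R b"]
        by (simp add: linear_add[OF lin] linear_scale[OF lin])
    qed
    moreover have "\<phi> a = \<phi> b \<longleftrightarrow> a = b" using inj_on_eq_iff[OF inj] that by blast
    ultimately show ?thesis unfolding in_segment by simp
  qed
  have mem: "\<phi> x \<in> \<phi> ` A \<longleftrightarrow> x \<in> A" if "x \<in> span (supp F)" for x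
    using inj_on_image_mem_iff[OF inj that assms(1)] .
  have "(\<forall>a\<in>\<phi> ` B. \<forall>b\<in>\<phi> ` B. \<forall>x\<in>\<phi> ` A. x \<in> open_segment a b \<longrightarrow> a \<in> \<phi> ` A \<and> b \<in> \<phi> ` A) \<longleftrightarrow>
        (\<forall>a\<in>B. \<forall>b\<in>B. \<forall>x\<in>A. \<phi> x \<in> open_segment (\<phi> a) (\<phi> b) \<longrightarrow> \<phi> a \<in> \<phi> ` A \<and> \<phi> b \<in> \<phi> ` A)"
    by simp
  also have "\<dots> \<longleftrightarrow> (\<forall>a\<in>B. \<forall>b\<in>B. \<forall>x\<in>A. x \<in> open_segment a b \<longrightarrow> a \<in> A \<and> b \<in> A)"
    using assms by (intro ball_cong refl) (simp add: seg mem subset_iff)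
  finally show ?thesis unfolding face_of_def sub conv by simp
qed

text \<open>Finiteness and the face and intersection axioms are combinatorial and come from
  \<open>G\<close>; conditions on the lattice and on single cones are supplied by hand. This
  replaces a direct verification that a stellar subdivision is a fan.\<close>

lemma rational_fan_pullback:
  assumes "is_lattice (lat F)" "\<And>\<sigma>. \<sigma> \<in> cones F \<Longrightarrow> rational_polyhedral_cone (lat F) \<sigma>"
    "\<And>\<sigma>. \<sigma> \<in> cones F \<Longrightarrow> strongly_convex \<sigma>"
  shows "rational_fan F"
proof -
  have fin: "finite (cones F)" "cones F \<noteq> {}"
    using bij_betw_finite[OF bij_cones] bij_betw_imp_surj_on[OF bij_cones] rational_fanD(2,3)[OF ratG] by auto
  have face: "\<tau> \<in> cones F" if "\<sigma> \<in> cones F" "\<tau> face_of \<sigma>" "\<tau> \<noteq> {}" for \<sigma> \<tau>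
  proof -
    have sub: "\<tau> \<subseteq> span (supp F)" using face_of_imp_subset[OF that(2)] cone_subset[OF that(1)] by blast
    have "\<phi> ` \<tau> face_of \<phi> ` \<sigma>" using face_of_image[OF sub cone_subset[OF that(1)]] that by blast
    then have "\<phi> ` \<tau> \<in> cones G" using rational_fanD(6)[OF ratG image_cone[OF that(1)]] that(3) by blast
    then obtain \<eta> where \<eta>: "\<eta> \<in> cones F" "\<phi> ` \<tau> = \<phi> ` \<eta>" using cone_preimage by blast
    then have "\<tau> = \<eta>" using inj_on_image_eq_iff[OF inj sub cone_subset[OF \<eta>(1)]] by blast
    then show ?thesis using \<eta> by simp
  qed
  have int: "\<sigma> \<inter> \<eta> face_of \<sigma>" if "\<sigma> \<in> cones F" "\<eta> \<in> cones F" for \<sigma> \<eta>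
  proof -
    have "\<phi> ` (\<sigma> \<inter> \<eta>) = \<phi> ` \<sigma> \<inter> \<phi> ` \<eta>"
      by (rule inj_on_image_Int[OF inj]) (use that cone_subset in auto)
    then have "\<phi> ` (\<sigma> \<inter> \<eta>) face_of \<phi> ` \<sigma>"
      using rational_fanD(7)[OF ratG image_cone[OF that(1)] image_cone[OF that(2)]] by simp
    moreover have "\<sigma> \<inter> \<eta> \<subseteq> span (supp F)" using cone_subset[OF that(1)] by blast
    ultimately show ?thesis using face_of_image cone_subset[OF that(1)] by blast
  qed
  have int': "\<sigma> \<inter> \<eta> face_of \<eta>" if "\<sigma> \<in> cones F" "\<eta> \<in> cones F" for \<sigma> \<eta>
    using int[OF that(2,1)] by (simp add: Int_commute)
  show ?thesis unfolding rational_fan_def using assms fin face int int' by blast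
qed

end

lemma fan_isomorphismI:
  assumes "fan_iso F G" "lattice_spanned F" "rational_fan G"
  obtains \<phi> where "fan_isomorphism F G \<phi>"
  using assms unfolding fan_iso_def fan_isomorphism_def by blast

lemma rigid_fan_iso:
  assumes "fan_iso F G" "lattice_spanned F" "rational_fan G"
  shows "rigid K F \<longleftrightarrow> rigid K G"
  using fan_isomorphismI[OF assms] fan_isomorphism.rigid_iso by metis

section \<open>Carriers of points, the two sides of a wall, and small perturbations\<close>

section \<open>Walls of a rational fan\<close>

text \<open>Intersections of cones are cones, so a minimal cone containing \<open>x\<close> lies in
  every other cone containing \<open>x\<close>.\<close>

lemma rational_fan_carrier:
  assumes "rational_fan F" "x \<in> supp F"
  obtains \<sigma> where "\<sigma> \<in> cones F" "x \<in> \<sigma>" "\<And>\<eta>. \<eta> \<in> cones F \<Longrightarrow> x \<in> \<eta> \<Longrightarrow> \<sigma> \<subseteq> \<eta>"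
proof -
  have "finite {\<sigma>\<in>cones F. x \<in> \<sigma>}" "{\<sigma>\<in>cones F. x \<in> \<sigma>} \<noteq> {}"
    using rational_fanD(2)[OF assms(1)] assms(2) by (auto simp: supp_def)
  then obtain \<sigma> where \<sigma>: "\<sigma> \<in> cones F" "x \<in> \<sigma>" "\<And>\<eta>. \<eta> \<in> cones F \<Longrightarrow> x \<in> \<eta> \<Longrightarrow> \<eta> \<subseteq> \<sigma> \<Longrightarrow> \<sigma> = \<eta>"
    using finite_has_minimal[of "{\<sigma>\<in>cones F. x \<in> \<sigma>}"] by auto
  have "\<sigma> \<subseteq> \<eta>" if "\<eta> \<in> cones F" "x \<in> \<eta>" for \<eta>
    using \<sigma>(3)[OF rational_fan_Int[OF assms(1) \<sigma>(1) that(1)]] \<sigma>(2) that(2) by auto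
  then show ?thesis using that \<sigma> by blast
qed

text \<open>Every cone is the carrier of a point: take one that is generic for the spans of all
  cones. If it lies in \<eta>, then \<sigma> lies in the span of its face
  \<open>\<sigma> \<inter> \<eta>\<close>, so the two coincide.\<close>

lemma rational_fan_interior_point:
  assumes "rational_fan F" "\<sigma> \<in> cones F"
  obtains z where "z \<in> \<sigma>" "\<And>\<eta>. \<eta> \<in> cones F \<Longrightarrow> z \<in> \<eta> \<Longrightarrow> \<sigma> \<subseteq> \<eta>"
proof -
  have fin: "finite (span ` cones F)" using rational_fanD(2)[OF assms(1)] by simp
  obtain z where z: "z \<in> \<sigma>" "\<forall>W\<in>span ` cones F. z \<in> W \<longrightarrow> \<sigma> \<subseteq> W"
    using generic_point[OF rational_fan_cone(1)[OF assms] fin] by auto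
  have "\<sigma> \<subseteq> \<eta>" if \<eta>: "\<eta> \<in> cones F" "z \<in> \<eta>" for \<eta>
  proof -
    have i: "\<sigma> \<inter> \<eta> \<in> cones F" by (rule rational_fan_Int[OF assms \<eta>(1)])
    have "z \<in> span (\<sigma> \<inter> \<eta>)" using z(1) \<eta>(2) by (simp add: span_base)
    then have "\<sigma> \<subseteq> span (\<sigma> \<inter> \<eta>)" using z(2) i by blast
    then have "\<sigma> \<inter> \<eta> = \<sigma>" by (intro rational_fan_eq_of_span[OF assms i]) auto
    then show ?thesis by blast
  qed
  then show ?thesis using that z(1) by blast
qed

lemma rational_fan_span_absorb:
  assumes "rational_fan F" "\<sigma> \<in> cones F" "z \<in> \<sigma>" "\<And>\<eta>. \<eta> \<in> cones F \<Longrightarrow> z \<in> \<eta> \<Longrightarrow> \<sigma> \<subseteq> \<eta>" "y \<in> span \<sigma>"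
  shows "\<exists>t>0. t *\<^sub>R z + y \<in> \<sigma>"
proof (rule span_absorb[OF rational_fan_cone(1)[OF assms(1,2)] assms(3) _ assms(5)])
  fix T assume T: "T face_of \<sigma>" "z \<in> T"
  then have "T \<in> cones F" using rational_fanD(6)[OF assms(1,2)] by blast
  then show "T = \<sigma>" using assms(4) T face_of_imp_subset by blast
qed

text \<open>A large multiple of an interior point of the wall absorbs the difference of
  \<open>y1\<close> and \<open>y2\<close>. This produces a common point of both cones off
  \<open>span \<beta>\<close>, so their intersection has full dimension and equals both.\<close>

lemma same_side_eq:
  assumes F: "rational_fan F" and c: "\<beta> \<in> cones F" "\<kappa>1 \<in> cones F" "\<kappa>2 \<in> cones F"
    and sub: "\<beta> \<subseteq> \<kappa>1" "\<beta> \<subseteq> \<kappa>2" and d: "Suc (dim \<beta>) = dim \<kappa>1" "Suc (dim \<beta>) = dim \<kappa>2"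
    and y: "y1 \<in> \<kappa>1" "y1 \<notin> span \<beta>" "y2 \<in> \<kappa>2" "y1 - y2 \<in> span \<beta>"
  shows "\<kappa>1 = \<kappa>2"
proof -
  obtain z where z: "z \<in> \<beta>" "\<And>\<eta>. \<eta> \<in> cones F \<Longrightarrow> z \<in> \<eta> \<Longrightarrow> \<beta> \<subseteq> \<eta>"
    using rational_fan_interior_point[OF F c(1)] by blast
  obtain t where t: "t > 0" "t *\<^sub>R z + (y1 - y2) \<in> \<beta>"
    using rational_fan_span_absorb[OF F c(1) z y(4)] by blast
  note C = rational_fan_cone(1)[OF F]
  let ?u = "t *\<^sub>R z + y1"
  have tz: "t *\<^sub>R z \<in> \<beta>" using convex_cone_scaleR[OF C[OF c(1)]] t z by simp
  have "?u \<in> \<kappa>1" using tz sub y by (intro convex_cone_add[OF C[OF c(2)]]) auto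
  moreover have "(t *\<^sub>R z + (y1 - y2)) + y2 \<in> \<kappa>2" 
    by (rule convex_cone_add[OF C[OF c(3)]]) (use t sub y in auto)
  ultimately have u: "?u \<in> \<kappa>1 \<inter> \<kappa>2" by (simp add: algebra_simps)
  have i: "\<kappa>1 \<inter> \<kappa>2 \<in> cones F" by (rule rational_fan_Int[OF F c(2,3)])
  have "?u \<notin> span \<beta>"
  proof
    assume "?u \<in> span \<beta>"
    then have "?u - t *\<^sub>R z \<in> span \<beta>" by (rule span_diff[OF _ span_base[OF tz]])
    then show False using y(2) by simp
  qed
  then have "Suc (dim \<beta>) = dim (insert ?u \<beta>)"
    using dim_insert_fin[OF rational_fan_cone(2)[OF F c(1)]] by simp
  also have "dim (insert ?u \<beta>) \<le> dim (\<kappa>1 \<inter> \<kappa>2)"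
    by (rule rational_fan_dim_mono[OF F i]) (use u sub in \<open>auto intro: span_base\<close>)
  finally have "Suc (dim \<beta>) \<le> dim (\<kappa>1 \<inter> \<kappa>2)" .
  then have "\<kappa>1 \<inter> \<kappa>2 = \<kappa>1" "\<kappa>1 \<inter> \<kappa>2 = \<kappa>2"
    using rational_fan_eq_of_dim[OF F c(2) i] rational_fan_eq_of_dim[OF F c(3) i] d by auto
  then show ?thesis by simp
qed

lemma exists_not_in_span:
  assumes "rational_fan F" "\<beta> \<in> cones F" "Suc (dim \<beta>) = dim \<kappa>"
  shows "\<exists>y\<in>\<kappa>. y \<notin> span \<beta>"
proof (rule ccontr)
  assume "\<not> ?thesis"
  then have "\<kappa> \<subseteq> span \<beta>" by blast
  then show False using rational_fan_dim_mono[OF assms(1,2), of \<kappa>] assms(3) by simp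
qed

lemma wall_span:
  assumes F: "rational_fan F" and c: "\<beta> \<in> cones F" "\<kappa> \<in> cones F"
    and sub: "\<beta> \<subseteq> \<kappa>" and d: "Suc (dim \<beta>) = dim \<kappa>" and y: "y \<in> \<kappa>" "y \<notin> span \<beta>"
  shows "span (insert y \<beta>) = span \<kappa>"
proof (rule span_eq_of_dim[OF rational_fan_cone(2)[OF F c(2)]])
  show "insert y \<beta> \<subseteq> span \<kappa>" using sub y by (auto intro: span_base)
  show "dim \<kappa> \<le> dim (insert y \<beta>)" using dim_insert_fin[OF rational_fan_cone(2)[OF F c(1)] y(2)] d by simp
qed

text \<open>Equal spans make \<open>y2\<close> congruent to a multiple of \<open>y1\<close> modulo
  the wall. The factor cannot vanish, and a positive one would put both cones on the same
  side.\<close>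

lemma opposite_side:
  assumes F: "rational_fan F" and c: "\<beta> \<in> cones F" "\<kappa>1 \<in> cones F" "\<kappa>2 \<in> cones F"
    and sub: "\<beta> \<subseteq> \<kappa>1" "\<beta> \<subseteq> \<kappa>2" and d: "Suc (dim \<beta>) = dim \<kappa>1" "Suc (dim \<beta>) = dim \<kappa>2"
    and ne: "\<kappa>1 \<noteq> \<kappa>2" and sp: "span \<kappa>1 = span \<kappa>2"
    and y: "y1 \<in> \<kappa>1" "y1 \<notin> span \<beta>" "y2 \<in> \<kappa>2" "y2 \<notin> span \<beta>"
  obtains a where "a < 0" "y2 - a *\<^sub>R y1 \<in> span \<beta>"
proof -
  have "y2 \<in> span (insert y1 \<beta>)"
    unfolding wall_span[OF F c(1,2) sub(1) d(1) y(1,2)] sp using y(3) by (rule span_base)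
  then obtain a where a: "y2 - a *\<^sub>R y1 \<in> span \<beta>" using span_breakdown_eq by blast
  have "a \<noteq> 0" using a y(4) by auto
  moreover have "\<not> a > 0"
  proof
    assume pos: "a > 0"
    have 1: "a *\<^sub>R y1 \<in> \<kappa>1" using pos convex_cone_scaleR[OF rational_fan_cone(1)[OF F c(2)]] y by simp
    have 2: "a *\<^sub>R y1 \<notin> span \<beta>"
      using span_scale[of "a *\<^sub>R y1" \<beta> "1 / a"] y(2) pos by auto
    have 3: "a *\<^sub>R y1 - y2 \<in> span \<beta>" using span_neg[OF a] by simp
    show False using same_side_eq[OF F c sub d 1 2 y(3) 3] ne by blast
  qed
  ultimately show ?thesis using that a by (meson linorder_neqE_linordered_idom)
qed

text \<open>Equal spans give equal sublattices, so the negative of a normal vector of \<kappa>1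
  generates as required; it only has to be shown to point to the side of \<kappa>2.\<close>

lemma opposite_normal_vector:
  assumes F: "rational_fan F" and c: "\<beta> \<in> cones F" "\<kappa>1 \<in> cones F" "\<kappa>2 \<in> cones F"
    and sub: "\<beta> \<subseteq> \<kappa>1" "\<beta> \<subseteq> \<kappa>2" and d: "Suc (dim \<beta>) = dim \<kappa>1" "Suc (dim \<beta>) = dim \<kappa>2"
    and ne: "\<kappa>1 \<noteq> \<kappa>2" and sp: "span \<kappa>1 = span \<kappa>2"
  shows "normal_vector (lat F) \<kappa>2 \<beta> + normal_vector (lat F) \<kappa>1 \<beta> \<in> span \<beta>"
proof -
  let ?n = "normal_vector (lat F) \<kappa>1 \<beta>"
  have n: "is_normal_vector (lat F) \<kappa>1 \<beta> ?n" by (rule rational_fan_normal_vector[OF F c(2,1) sub(1) d(1)])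
  obtain y1 where y1: "y1 \<in> \<kappa>1" "y1 \<notin> span \<beta>" "?n - y1 \<in> span \<beta>"
    using n unfolding is_normal_vector_def by blast
  obtain y2 where y2: "y2 \<in> \<kappa>2" "y2 \<notin> span \<beta>" using exists_not_in_span[OF F c(1) d(2)] by blast
  obtain a where a: "a < 0" "y2 - a *\<^sub>R y1 \<in> span \<beta>"
    using opposite_side[OF F c sub d ne sp y1(1,2) y2] by blast
  \<comment> \<open>As \<open>a\<close> is negative, this is a positive multiple of
    \<open>y2\<close>; it is congruent to \<open>- y1\<close>, and so to \<open>- ?n\<close>, modulo
    the wall.\<close>
  let ?x = "(- 1 / a) *\<^sub>R y2"
  have "is_normal_vector (lat F) \<kappa>2 \<beta> (- ?n)"
    unfolding is_normal_vector_def
  proof (intro conjI)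
    have sub_eq: "sublat (lat F) \<kappa>1 = sublat (lat F) \<kappa>2" using sp by (simp add: sublat_def)
    have "?n \<in> sublat (lat F) \<kappa>1" using n by (simp add: is_normal_vector_def)
    then have "0 - ?n \<in> sublat (lat F) \<kappa>2" unfolding sub_eq
      by (intro additive_subgroup_diff additive_subgroup_0 additive_subgroup_sublat lattice_subgroup rational_fanD(1)[OF F])
    then show "- ?n \<in> sublat (lat F) \<kappa>2" by simp
    have "?x \<in> \<kappa>2" using a y2 by (intro convex_cone_scaleR[OF rational_fan_cone(1)[OF F c(3)]]) auto
    moreover have "?x \<notin> span \<beta>" using span_scale[of ?x \<beta> "- a"] y2(2) a(1) by auto
    moreover have "- ?n - ?x \<in> span \<beta>"
    proof -
      have "(1 / a) *\<^sub>R (y2 - a *\<^sub>R y1) - (?n - y1) \<in> span \<beta>"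
        by (rule span_diff[OF span_scale[OF a(2)] y1(3)])
      moreover have "(1 / a) *\<^sub>R (y2 - a *\<^sub>R y1) - (?n - y1) = - ?n - ?x"
        using a(1) by (simp add: scaleR_diff_right)
      ultimately show ?thesis by simp
    qed
    ultimately show "\<exists>x\<in>\<kappa>2 - span \<beta>. - ?n - x \<in> span \<beta>" by blast
    have "{x + of_int k *\<^sub>R - ?n | x (k::int). x \<in> sublat (lat F) \<beta>} =
          {x + of_int k *\<^sub>R ?n | x (k::int). x \<in> sublat (lat F) \<beta>}"
    proof -
      have *: "{x + of_int k *\<^sub>R - m | x (k::int). x \<in> S} \<subseteq> {x + of_int k *\<^sub>R m | x (k::int). x \<in> S}"
        for m :: 'a and S
      proof clarify
        fix x and k :: int assume "x \<in> S"
        moreover have "x + of_int k *\<^sub>R - m = x + of_int (- k) *\<^sub>R m" by simp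
        ultimately show "\<exists>x' l. x + of_int k *\<^sub>R - m = x' + of_int l *\<^sub>R m \<and> x' \<in> S" by blast
      qed
      show ?thesis using *[of "?n"] *[of "- ?n"] by (intro subset_antisym) (simp_all only: minus_minus)
    qed
    also have "\<dots> = sublat (lat F) \<kappa>2" using n sub_eq by (simp add: is_normal_vector_def)
    finally show "{x + of_int k *\<^sub>R - ?n | x (k::int). x \<in> sublat (lat F) \<beta>} = sublat (lat F) \<kappa>2" .
  qed
  then have "normal_vector (lat F) \<kappa>2 \<beta> - (- ?n) \<in> span \<beta>"
    by (rule normal_vector_cong) (rule rational_fan_pointed[OF F c(3,1) sub(2)])
  then show ?thesis by simp
qed

text \<open>When all adjacent cones span the same space, the wall has just two sides there, each
  with at most one cone. The two normal vectors cancel modulo the wall, so balancing equates the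
  weights.\<close>

lemma balanced_at_interior_wall:
  assumes F: "rational_fan F" and bal: "balanced_at F w \<beta>" and \<beta>: "\<beta> \<in> cones F" "Suc (dim \<beta>) = fan_dim F"
    and \<kappa>: "\<kappa>1 \<in> top_cones F" "\<kappa>2 \<in> top_cones F" "\<beta> \<subseteq> \<kappa>1" "\<beta> \<subseteq> \<kappa>2"
    and sp: "\<And>\<kappa>. \<kappa> \<in> top_cones F \<Longrightarrow> \<beta> \<subseteq> \<kappa> \<Longrightarrow> span \<kappa> = U"
  shows "w \<kappa>1 = w \<kappa>2"
proof (rule ccontr)
  assume "w \<kappa>1 \<noteq> w \<kappa>2"
  then have ne: "\<kappa>1 \<noteq> \<kappa>2" by blast
  let ?n = "\<lambda>\<kappa>. normal_vector (lat F) \<kappa> \<beta>"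
  have top: "\<kappa> \<in> cones F" "Suc (dim \<beta>) = dim \<kappa>" if "\<kappa> \<in> top_cones F" for \<kappa>
    using that \<beta>(2) by (auto simp: cones_of_dim_def)
  have yex: "\<exists>y\<in>\<kappa>. y \<notin> span \<beta>" if "\<kappa> \<in> top_cones F" for \<kappa>
    by (rule exists_not_in_span[OF F \<beta>(1) top(2)[OF that]])
  obtain y1 y2 where y: "y1 \<in> \<kappa>1" "y1 \<notin> span \<beta>" "y2 \<in> \<kappa>2" "y2 \<notin> span \<beta>" using yex \<kappa> by metis
  obtain a where a: "a < 0" "y2 - a *\<^sub>R y1 \<in> span \<beta>"
    by (rule opposite_side[OF F \<beta>(1) top(1)[OF \<kappa>(1)] top(1)[OF \<kappa>(2)] \<kappa>(3,4) top(2)[OF \<kappa>(1)] top(2)[OF \<kappa>(2)] ne _ y])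
      (use sp \<kappa> in auto)
  have set: "{\<kappa>. \<kappa> \<in> top_cones F \<and> \<beta> \<subseteq> \<kappa>} = {\<kappa>1, \<kappa>2}"
  proof -
    have "\<kappa> = \<kappa>1 \<or> \<kappa> = \<kappa>2" if \<kappa>3: "\<kappa> \<in> top_cones F" "\<beta> \<subseteq> \<kappa>" for \<kappa>
    proof (rule ccontr)
      assume no: "\<not> (\<kappa> = \<kappa>1 \<or> \<kappa> = \<kappa>2)"
      obtain y3 where y3: "y3 \<in> \<kappa>" "y3 \<notin> span \<beta>" using yex \<kappa>3 by blast
      obtain b where b: "b < 0" "y3 - b *\<^sub>R y1 \<in> span \<beta>"
        by (rule opposite_side[OF F \<beta>(1) top(1)[OF \<kappa>(1)] top(1)[OF \<kappa>3(1)] \<kappa>(3) \<kappa>3(2) top(2)[OF \<kappa>(1)] top(2)[OF \<kappa>3(1)] _ _ y(1,2) y3])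
          (use no sp \<kappa> \<kappa>3 in auto)
      \<comment> \<open>Two cones opposite to \<kappa>1 lie on the same side: rescaled by this
        positive factor, \<open>y3\<close> becomes congruent to \<open>y2\<close>.\<close>
      have ab: "0 < a / b" using a(1) b(1) by (simp add: zero_less_divide_iff)
      have "(a / b) *\<^sub>R y3 \<in> \<kappa>"
        using ab y3 by (intro convex_cone_scaleR[OF rational_fan_cone(1)[OF F top(1)[OF \<kappa>3(1)]]]) auto
      moreover have "(a / b) *\<^sub>R y3 \<notin> span \<beta>"
        using span_scale[of "(a / b) *\<^sub>R y3" \<beta> "b / a"] y3(2) a(1) b(1) by auto
      moreover have "(a / b) *\<^sub>R y3 - y2 \<in> span \<beta>"
      proof -
        have "(a / b) *\<^sub>R (y3 - b *\<^sub>R y1) - (y2 - a *\<^sub>R y1) \<in> span \<beta>"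
          by (rule span_diff[OF span_scale[OF b(2)] a(2)])
        then show ?thesis using b(1) by (simp add: scaleR_diff_right)
      qed
      ultimately have "\<kappa> = \<kappa>2"
        using same_side_eq[OF F \<beta>(1) top(1)[OF \<kappa>3(1)] top(1)[OF \<kappa>(2)] \<kappa>3(2) \<kappa>(4) top(2)[OF \<kappa>3(1)] top(2)[OF \<kappa>(2)]] y(3)
        by blast
      then show False using no by blast
    qed
    then show ?thesis using \<kappa> by blast
  qed
  have s: "w \<kappa>1 *\<^sub>R ?n \<kappa>1 + w \<kappa>2 *\<^sub>R ?n \<kappa>2 \<in> span \<beta>"
    using bal ne unfolding balanced_at_def set by simp
  have o: "?n \<kappa>2 + ?n \<kappa>1 \<in> span \<beta>"
    by (rule opposite_normal_vector[OF F \<beta>(1) top(1)[OF \<kappa>(1)] top(1)[OF \<kappa>(2)] \<kappa>(3,4) top(2)[OF \<kappa>(1)] top(2)[OF \<kappa>(2)] ne])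
      (use sp \<kappa> in auto)
  have "(w \<kappa>1 *\<^sub>R ?n \<kappa>1 + w \<kappa>2 *\<^sub>R ?n \<kappa>2) - w \<kappa>2 *\<^sub>R (?n \<kappa>2 + ?n \<kappa>1) \<in> span \<beta>"
    by (rule span_diff[OF s span_scale[OF o]])
  then have "(w \<kappa>1 - w \<kappa>2) *\<^sub>R ?n \<kappa>1 \<in> span \<beta>" by (simp add: algebra_simps)
  then have n1: "?n \<kappa>1 \<in> span \<beta>"
    using \<open>w \<kappa>1 \<noteq> w \<kappa>2\<close> span_scale[of "(w \<kappa>1 - w \<kappa>2) *\<^sub>R ?n \<kappa>1" \<beta> "1 / (w \<kappa>1 - w \<kappa>2)"] by simp
  obtain x where x: "x \<in> \<kappa>1" "x \<notin> span \<beta>" "?n \<kappa>1 - x \<in> span \<beta>"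
    using rational_fan_normal_vector[OF F top(1)[OF \<kappa>(1)] \<beta>(1) \<kappa>(3) top(2)[OF \<kappa>(1)]]
    unfolding is_normal_vector_def by blast
  then show False using span_diff[OF n1 x(3)] by simp
qed

text \<open>A functional that separates \<open>z\<close> from a cone stays negative after a small
  displacement, uniformly along the segment from \<open>p\<close> to \<open>q\<close>. This replaces
  a neighbourhood of \<open>z\<close>.\<close>

lemma fg_cones_avoid:
  assumes "finite \<D>" "\<And>\<kappa>. \<kappa> \<in> \<D> \<Longrightarrow> fg_cone \<kappa>" "\<And>\<kappa>. \<kappa> \<in> \<D> \<Longrightarrow> z \<notin> \<kappa>"
  shows "\<exists>\<epsilon>>0. \<forall>\<kappa>\<in>\<D>. \<forall>t\<in>{0..1}. z + \<epsilon> *\<^sub>R ((1 - t) *\<^sub>R p + t *\<^sub>R q) \<notin> \<kappa>"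
proof -
  have "\<forall>\<^sub>F \<epsilon> in at_right 0. \<forall>t\<in>{0..1}. z + \<epsilon> *\<^sub>R ((1 - t) *\<^sub>R p + t *\<^sub>R q) \<notin> \<kappa>" if \<kappa>: "\<kappa> \<in> \<D>" for \<kappa>
  proof -
    obtain h where h: "linear h" "\<forall>x\<in>\<kappa>. 0 \<le> h x" "h z < (0::real)"
      using farkas[OF assms(2,3)] \<kappa> by blast
    \<comment> \<open>The two absolute values bound \<open>h\<close> on the whole segment; the
      summand 1 keeps the divisor positive.\<close>
    let ?m = "\<bar>h p\<bar> + \<bar>h q\<bar> + 1"
    have "z + \<epsilon> *\<^sub>R ((1 - t) *\<^sub>R p + t *\<^sub>R q) \<notin> \<kappa>" if e: "0 < \<epsilon>" "\<epsilon> < - h z / ?m" and t: "t \<in> {0..1}" for \<epsilon> t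
    proof -
      have "(1 - t) * h p \<le> 1 * \<bar>h p\<bar>" "t * h q \<le> 1 * \<bar>h q\<bar>"
        using t mult_left_mono[OF abs_ge_self[of "h p"], of "1 - t"] mult_right_mono[of "1 - t" 1 "\<bar>h p\<bar>"]
          mult_left_mono[OF abs_ge_self[of "h q"], of t] mult_right_mono[of t 1 "\<bar>h q\<bar>"] by simp_all
      then have "(1 - t) * h p + t * h q \<le> ?m" by simp
      then have "\<epsilon> * ((1 - t) * h p + t * h q) \<le> \<epsilon> * ?m" using e by (intro mult_left_mono) auto
      also have "\<dots> < - h z" using e by (simp add: field_simps add_pos_nonneg)
      finally have "h (z + \<epsilon> *\<^sub>R ((1 - t) *\<^sub>R p + t *\<^sub>R q)) < 0"
        by (simp add: linear_add[OF h(1)] linear_scale[OF h(1)])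
      then show ?thesis using h(2) by force
    qed
    moreover have "0 < - h z / ?m" using h(3) by (intro divide_pos_pos) auto
    ultimately show ?thesis unfolding eventually_at_right_field by blast
  qed
  then have "\<forall>\<^sub>F \<epsilon> in at_right 0. \<forall>\<kappa>\<in>\<D>. \<forall>t\<in>{0..1}. z + \<epsilon> *\<^sub>R ((1 - t) *\<^sub>R p + t *\<^sub>R q) \<notin> \<kappa>"
    using assms(1) by (intro eventually_ball_finite) auto
  then obtain b :: real where "b > 0" "\<forall>\<epsilon>>0. \<epsilon> < b \<longrightarrow> (\<forall>\<kappa>\<in>\<D>. \<forall>t\<in>{0..1}. z + \<epsilon> *\<^sub>R ((1 - t) *\<^sub>R p + t *\<^sub>R q) \<notin> \<kappa>)"
    unfolding eventually_at_right_field by blast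
  then show ?thesis using field_lbound_gt_zero[of b b] by blast
qed

section \<open>Comparison of a fan with a subdivision of the same support\<close>

section \<open>Refinements\<close>

locale fan_refinement =
  fixes F :: "('a::real_vector, 'm) ofan_scheme" and F' :: "('a, 'n) ofan_scheme"
  assumes F: "rational_fan F" and F': "rational_fan F'"
    and lat_eq: "lat F' = lat F" and supp_eq: "supp F' = supp F"
    and refines: "\<And>\<kappa>. \<kappa> \<in> cones F' \<Longrightarrow> \<exists>\<eta>\<in>cones F. \<kappa> \<subseteq> \<eta>"
begin

lemma mem_supp: "\<sigma> \<in> cones F \<Longrightarrow> x \<in> \<sigma> \<Longrightarrow> x \<in> supp F'"
  using supp_eq by (auto simp: supp_def)

lemma mem_supp': "\<kappa> \<in> cones F' \<Longrightarrow> x \<in> \<kappa> \<Longrightarrow> x \<in> supp F"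
  using supp_eq by (auto simp: supp_def)

text \<open>\<kappa> lies in some cone \<zeta> of \<open>F\<close>, and \<alpha> cuts \<zeta> in a
  face. So \<open>\<kappa> \<inter> \<alpha>\<close> is a face of \<kappa> containing
  \<open>x\<close>, and by minimality of \<kappa> it is all of \<kappa>.\<close>

lemma carrier_mono:
  assumes "\<kappa> \<in> cones F'" "x \<in> \<kappa>" "\<And>\<eta>. \<eta> \<in> cones F' \<Longrightarrow> x \<in> \<eta> \<Longrightarrow> \<kappa> \<subseteq> \<eta>" "\<alpha> \<in> cones F" "x \<in> \<alpha>"
  shows "\<kappa> \<subseteq> \<alpha>"
proof -
  obtain \<zeta> where \<zeta>: "\<zeta> \<in> cones F" "\<kappa> \<subseteq> \<zeta>" using refines assms(1) by blast
  note C = rational_fan_cone(1)[OF F] and C' = rational_fan_cone(1)[OF F' assms(1)]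
  have T: "\<kappa> \<inter> \<alpha> face_of \<kappa>"
  proof (rule face_of_coneI[OF C'])
    show "convex_cone (\<kappa> \<inter> \<alpha>)"
      using C' C[OF assms(4)] unfolding convex_cone_iff by blast
    fix x y assume "x \<in> \<kappa>" "y \<in> \<kappa>" "x + y \<in> \<kappa> \<inter> \<alpha>"
    then show "x \<in> \<kappa> \<inter> \<alpha>"
      using face_of_add[OF C[OF \<zeta>(1)] rational_fanD(7)[OF F \<zeta>(1) assms(4)], of x y] \<zeta>(2) by blast
  qed simp
  have "\<kappa> \<inter> \<alpha> \<in> cones F'" by (rule rational_fanD(6)[OF F' assms(1) T]) (use assms in blast)
  then show ?thesis using assms(3)[of "\<kappa> \<inter> \<alpha>"] assms(2,5) by blast
qed

text \<open>Each point of a cone \<open>\<zeta>\<close> of \<open>F\<close> is a limit of the points \<open>x + y / n\<close> for a generic \<open>y\<close> of \<open>\<zeta>\<close>; infinitely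
  many of them lie in the relative interior of the same cone of \<open>F'\<close>.\<close>

lemma refining_cone:
  assumes \<zeta>: "\<zeta> \<in> cones F" "x \<in> \<zeta>"
  obtains \<kappa> where "\<kappa> \<in> cones F'" "x \<in> \<kappa>" "\<kappa> \<subseteq> \<zeta>" "span \<kappa> = span \<zeta>"
proof -
  note C\<zeta> = rational_fan_cone(1)[OF F \<zeta>(1)]
  have fin: "finite (span ` cones F')" using rational_fanD(2)[OF F'] by simp
  \<comment> \<open>Generic for the spans of \<open>F'\<close>: any cone of \<open>F'\<close> with
    \<open>y\<close> in its span spans at least \<zeta>.\<close>
  obtain y where y: "y \<in> \<zeta>" "\<forall>W\<in>span ` cones F'. y \<in> W \<longrightarrow> \<zeta> \<subseteq> W"
    using generic_point[OF C\<zeta> fin] by auto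
  define X where "X n = x + (1 / of_nat (Suc n)) *\<^sub>R y" for n :: nat
  have X\<zeta>: "X n \<in> \<zeta>" for n
    unfolding X_def using y \<zeta> by (intro convex_cone_add[OF C\<zeta>] convex_cone_scaleR[OF C\<zeta>]) auto
  have "\<exists>\<kappa>. \<kappa> \<in> cones F' \<and> X n \<in> \<kappa> \<and> (\<forall>\<eta>\<in>cones F'. X n \<in> \<eta> \<longrightarrow> \<kappa> \<subseteq> \<eta>)" for n
  proof -
    have "X n \<in> supp F'" using mem_supp[OF \<zeta>(1) X\<zeta>] .
    then show ?thesis using rational_fan_carrier[OF F'] by metis
  qed
  then obtain k where k: "\<And>n. k n \<in> cones F'" "\<And>n. X n \<in> k n" "\<And>n \<eta>. \<eta> \<in> cones F' \<Longrightarrow> X n \<in> \<eta> \<Longrightarrow> k n \<subseteq> \<eta>"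
    by metis
  have "finite (range k)" using k(1) rational_fanD(2)[OF F'] finite_subset by (metis image_subsetI)
  then obtain m where m: "infinite {n. k n = k m}"
    using pigeonhole_infinite[of UNIV k] by auto
  let ?\<kappa> = "k m"
  have "?\<kappa> \<subseteq> \<zeta>" by (rule carrier_mono[OF k(1) k(2) k(3) \<zeta>(1) X\<zeta>])
  moreover have x\<kappa>: "x \<in> ?\<kappa>"
  proof -
    have cl: "closed {t. x + t *\<^sub>R y \<in> ?\<kappa>}"
      by (rule fg_cone_closed_on_line[OF rational_fan_cone(3)[OF F' k(1)]])
    have "\<exists>t\<in>{t. x + t *\<^sub>R y \<in> ?\<kappa>}. dist t 0 < e" if e: "e > 0" for e :: real
    proof -
      obtain N where N: "1 / real (Suc N) < e" using e nat_approx_posE by blast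
      obtain n where n: "n > N" "k n = k m" using m unfolding infinite_nat_iff_unbounded by auto
      have "1 / real (Suc n) \<le> 1 / real (Suc N)" using n(1) by (intro divide_left_mono) auto
      then have "dist (1 / real (Suc n)) 0 < e" using N by (simp add: dist_real_def)
      moreover have "x + (1 / real (Suc n)) *\<^sub>R y \<in> ?\<kappa>" using k(2)[of n] n(2) unfolding X_def by simp
      ultimately show ?thesis by blast
    qed
    then have "0 \<in> closure {t. x + t *\<^sub>R y \<in> ?\<kappa>}" unfolding closure_approachable by blast
    then have "0 \<in> {t. x + t *\<^sub>R y \<in> ?\<kappa>}" using closure_closed[OF cl] by blast
    then show ?thesis by simp
  qed
  moreover have "span ?\<kappa> = span \<zeta>"
  proof -
    \<comment> \<open>\<open>y\<close> is a multiple of this difference, so genericity of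
      \<open>y\<close> applies to the span of the limit cone.\<close>
    have "X m - x \<in> span ?\<kappa>" using k(2)[of m] x\<kappa> by (intro span_diff span_base)
    then have "of_nat (Suc m) *\<^sub>R (X m - x) \<in> span ?\<kappa>" by (rule span_scale)
    then have "y \<in> span ?\<kappa>" unfolding X_def by (simp del: of_nat_Suc)
    then have "\<zeta> \<subseteq> span ?\<kappa>" using y(2) k(1) by blast
    then have "span \<zeta> \<subseteq> span ?\<kappa>" by (simp add: span_minimal)
    then show ?thesis using span_mono[OF \<open>?\<kappa> \<subseteq> \<zeta>\<close>] by blast
  qed
  ultimately show ?thesis using that k(1) by blast
qed

lemma fan_dim_eq: "fan_dim F' = fan_dim F"
proof (rule antisym)
  have "fan_dim F \<in> dim ` cones F" "fan_dim F' \<in> dim ` cones F'"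
    unfolding fan_dim_def using rational_fanD(2,3)[OF F] rational_fanD(2,3)[OF F'] by (auto intro!: Max_in)
  then obtain \<zeta> \<kappa> where \<zeta>: "\<zeta> \<in> cones F" "dim \<zeta> = fan_dim F" and \<kappa>: "\<kappa> \<in> cones F'" "dim \<kappa> = fan_dim F'" by force
  obtain \<kappa>' where \<kappa>': "\<kappa>' \<in> cones F'" "0 \<in> \<kappa>'" "\<kappa>' \<subseteq> \<zeta>" "span \<kappa>' = span \<zeta>"
    by (rule refining_cone[OF \<zeta>(1) rational_fan_cone(4)[OF F \<zeta>(1)]])
  show "fan_dim F \<le> fan_dim F'"
    using rational_fan_dim_le[OF F' \<kappa>'(1)] span_eq_dim[OF \<kappa>'(4)] \<zeta>(2) by simp
  obtain \<eta> where \<eta>: "\<eta> \<in> cones F" "\<kappa> \<subseteq> \<eta>" using refines[OF \<kappa>(1)] by blast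
  then have "dim \<kappa> \<le> dim \<eta>" by (intro rational_fan_dim_mono[OF F] subset_trans[OF _ span_superset])
  then show "fan_dim F' \<le> fan_dim F" using rational_fan_dim_le[OF F \<eta>(1)] \<kappa> by simp
qed

text \<open>Meant for top cones of \<open>F'\<close>. There the choice is unique, because two
  candidates would meet in full dimension.\<close>

definition parent :: "'a set \<Rightarrow> 'a set" where
  "parent \<kappa> = (SOME \<eta>. \<eta> \<in> top_cones F \<and> \<kappa> \<subseteq> \<eta>)"

lemma parent:
  assumes "\<kappa> \<in> top_cones F'"
  shows "parent \<kappa> \<in> top_cones F" "\<kappa> \<subseteq> parent \<kappa>"
    and parent_unique: "\<And>\<eta>. \<eta> \<in> cones F \<Longrightarrow> \<kappa> \<subseteq> \<eta> \<Longrightarrow> \<eta> = parent \<kappa>"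
    and span_parent: "span \<kappa> = span (parent \<kappa>)"
proof -
  have \<kappa>: "\<kappa> \<in> cones F'" "dim \<kappa> = fan_dim F" using assms fan_dim_eq by (auto simp: cones_of_dim_def)
  have dim\<eta>: "dim \<eta> = fan_dim F" if "\<eta> \<in> cones F" "\<kappa> \<subseteq> \<eta>" for \<eta>
    using rational_fan_dim_mono[OF F that(1) subset_trans[OF that(2) span_superset]]
      rational_fan_dim_le[OF F that(1)] \<kappa>(2) by simp
  have "\<exists>\<eta>. \<eta> \<in> top_cones F \<and> \<kappa> \<subseteq> \<eta>" using refines[OF \<kappa>(1)] dim\<eta> by (auto simp: cones_of_dim_def)
  then have "parent \<kappa> \<in> top_cones F \<and> \<kappa> \<subseteq> parent \<kappa>" unfolding parent_def by (rule someI_ex)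
  then show p: "parent \<kappa> \<in> top_cones F" "\<kappa> \<subseteq> parent \<kappa>" by blast+
  then have pc: "parent \<kappa> \<in> cones F" by (simp add: cones_of_dim_def)
  show "span \<kappa> = span (parent \<kappa>)"
    by (rule span_eq_of_dim[OF rational_fan_cone(2)[OF F pc]])
      (use p dim\<eta>[OF pc p(2)] \<kappa>(2) span_superset[of "parent \<kappa>"] in auto)
  fix \<eta> assume \<eta>: "\<eta> \<in> cones F" "\<kappa> \<subseteq> \<eta>"
  have i: "\<eta> \<inter> parent \<kappa> \<in> cones F" by (rule rational_fan_Int[OF F \<eta>(1) pc])
  have "dim (\<eta> \<inter> parent \<kappa>) = fan_dim F" by (rule dim\<eta>[OF i]) (use \<eta> p in blast)
  then have "\<eta> \<inter> parent \<kappa> = \<eta>" "\<eta> \<inter> parent \<kappa> = parent \<kappa>"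
    using rational_fan_eq_of_dim[OF F \<eta>(1) i] rational_fan_eq_of_dim[OF F pc i] dim\<eta>[OF \<eta>] dim\<eta>[OF pc p(2)] by auto
  then show "\<eta> = parent \<kappa>" by simp
qed

lemma refining_top_cone:
  assumes "\<zeta> \<in> top_cones F" "x \<in> \<zeta>"
  obtains \<kappa> where "\<kappa> \<in> top_cones F'" "x \<in> \<kappa>" "\<kappa> \<subseteq> \<zeta>" "parent \<kappa> = \<zeta>"
proof -
  have \<zeta>: "\<zeta> \<in> cones F" "dim \<zeta> = fan_dim F" using assms by (auto simp: cones_of_dim_def)
  obtain \<kappa> where \<kappa>: "\<kappa> \<in> cones F'" "x \<in> \<kappa>" "\<kappa> \<subseteq> \<zeta>" "span \<kappa> = span \<zeta>"
    by (rule refining_cone[OF \<zeta>(1) assms(2)])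
  have "\<kappa> \<in> top_cones F'" using \<kappa>(1) span_eq_dim[OF \<kappa>(4)] \<zeta>(2) fan_dim_eq by (simp add: cones_of_dim_def)
  then show ?thesis using that \<kappa> parent_unique[OF _ \<zeta>(1)] by metis
qed

text \<open>Pieces around \<beta> correspond to top cones around \<alpha>. Each such cone has a
  piece through an interior point of \<beta>. Two pieces with the same parent would lie on opposite
  sides of the wall, although \<alpha> is a face of the parent. Normal vectors may be shared because
  spans agree.\<close>

lemma balanced_at_refined_wall:
  assumes \<alpha>: "\<alpha> \<in> cones F" "Suc (dim \<alpha>) = fan_dim F" and \<beta>: "\<beta> \<in> cones F'" "\<beta> \<subseteq> \<alpha>" "dim \<beta> = dim \<alpha>"
    and w: "\<And>\<kappa>. \<kappa> \<in> top_cones F' \<Longrightarrow> \<beta> \<subseteq> \<kappa> \<Longrightarrow> w' \<kappa> = w (parent \<kappa>)"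
  shows "balanced_at F' w' \<beta> \<longleftrightarrow> balanced_at F w \<alpha>"
proof -
  have sp: "span \<beta> = span \<alpha>"
    by (rule span_eq_of_dim[OF rational_fan_cone(2)[OF F \<alpha>(1)]])
      (use \<beta> span_superset[of \<alpha>] in auto)
  have top: "\<kappa> \<in> cones F'" "Suc (dim \<beta>) = dim \<kappa>" if "\<kappa> \<in> top_cones F'" for \<kappa>
    using that \<alpha>(2) \<beta>(3) fan_dim_eq by (auto simp: cones_of_dim_def)
  have pc: "parent \<kappa> \<in> cones F" "Suc (dim \<alpha>) = dim (parent \<kappa>)" if "\<kappa> \<in> top_cones F'" for \<kappa>
    using parent(1)[OF that] \<alpha>(2) by (auto simp: cones_of_dim_def)
  let ?A = "{\<kappa>. \<kappa> \<in> top_cones F' \<and> \<beta> \<subseteq> \<kappa>}" and ?B = "{\<eta>. \<eta> \<in> top_cones F \<and> \<alpha> \<subseteq> \<eta>}"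
  have sub: "\<alpha> \<subseteq> parent \<kappa>" if \<kappa>: "\<kappa> \<in> ?A" for \<kappa>
  proof -
    have k: "\<kappa> \<in> top_cones F'" using \<kappa> by simp
    have i: "\<alpha> \<inter> parent \<kappa> \<in> cones F" by (rule rational_fan_Int[OF F \<alpha>(1) pc(1)[OF k]])
    have "\<beta> \<subseteq> \<alpha> \<inter> parent \<kappa>" using \<kappa> \<beta>(2) parent(2)[OF k] by auto
    then have "dim \<beta> \<le> dim (\<alpha> \<inter> parent \<kappa>)"
      using span_superset[of "\<alpha> \<inter> parent \<kappa>"] by (intro rational_fan_dim_mono[OF F i]) auto
    then have "\<alpha> \<inter> parent \<kappa> = \<alpha>" using \<beta>(3) by (intro rational_fan_eq_of_dim[OF F \<alpha>(1) i]) auto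
    then show ?thesis by blast
  qed
  have "parent ` ?A = ?B"
  proof
    show "parent ` ?A \<subseteq> ?B" using sub parent(1) by auto
    show "?B \<subseteq> parent ` ?A"
    proof
      fix \<eta> assume \<eta>: "\<eta> \<in> ?B"
      obtain z where z: "z \<in> \<beta>" "\<And>\<eta>. \<eta> \<in> cones F' \<Longrightarrow> z \<in> \<eta> \<Longrightarrow> \<beta> \<subseteq> \<eta>"
        using rational_fan_interior_point[OF F' \<beta>(1)] by blast
      have "\<eta> \<in> top_cones F" "z \<in> \<eta>" using \<eta> z \<beta>(2) by auto
      then obtain \<kappa> where \<kappa>: "\<kappa> \<in> top_cones F'" "z \<in> \<kappa>" "\<kappa> \<subseteq> \<eta>" "parent \<kappa> = \<eta>"
        using refining_top_cone by blast
      then show "\<eta> \<in> parent ` ?A" using z(2)[OF top(1)[OF \<kappa>(1)] \<kappa>(2)] by blast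
    qed
  qed
  moreover have inj: "inj_on parent ?A"
  proof (rule inj_onI, rule ccontr)
    fix \<kappa>1 \<kappa>2 assume \<kappa>: "\<kappa>1 \<in> ?A" "\<kappa>2 \<in> ?A" "parent \<kappa>1 = parent \<kappa>2" and ne: "\<kappa>1 \<noteq> \<kappa>2"
    then have k: "\<kappa>1 \<in> top_cones F'" "\<kappa>2 \<in> top_cones F'" "\<beta> \<subseteq> \<kappa>1" "\<beta> \<subseteq> \<kappa>2" by auto
    obtain y1 y2 where y: "y1 \<in> \<kappa>1" "y1 \<notin> span \<beta>" "y2 \<in> \<kappa>2" "y2 \<notin> span \<beta>"
      using exists_not_in_span[OF F' \<beta>(1) top(2)] k by metis
    obtain a where a: "a < 0" "y2 - a *\<^sub>R y1 \<in> span \<beta>"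
      by (rule opposite_side[OF F' \<beta>(1) top(1)[OF k(1)] top(1)[OF k(2)] k(3,4) top(2)[OF k(1)] top(2)[OF k(2)] ne _ y])
        (simp add: span_parent k \<kappa>(3))
    have "(- a) *\<^sub>R y1 \<in> \<kappa>1"
      using a y by (intro convex_cone_scaleR[OF rational_fan_cone(1)[OF F' top(1)[OF k(1)]]]) auto
    then have "y2 \<in> parent \<kappa>1" "(- a) *\<^sub>R y1 \<in> parent \<kappa>1"
      using y(3) parent(2)[OF k(1)] parent(2)[OF k(2)] \<kappa>(3) by blast+
    moreover have "y2 + (- a) *\<^sub>R y1 \<in> span \<alpha>" using a sp by simp
    ultimately have "y2 \<in> span \<alpha>"
      using rational_fan_pointed[OF F pc(1)[OF k(1)] \<alpha>(1) sub[OF \<kappa>(1)]] by blast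
    then show False using y sp by simp
  qed
  ultimately have "(\<Sum>\<eta>\<in>?B. w \<eta> *\<^sub>R normal_vector (lat F) \<eta> \<alpha>) =
      (\<Sum>\<kappa>\<in>?A. w (parent \<kappa>) *\<^sub>R normal_vector (lat F) (parent \<kappa>) \<alpha>)"
    using sum.reindex[OF inj, of "\<lambda>\<eta>. w \<eta> *\<^sub>R normal_vector (lat F) \<eta> \<alpha>"] by simp
  moreover have "(\<Sum>\<kappa>\<in>?A. w (parent \<kappa>) *\<^sub>R normal_vector (lat F) \<kappa> \<beta>) =
      (\<Sum>\<kappa>\<in>?A. w' \<kappa> *\<^sub>R normal_vector (lat F') \<kappa> \<beta>)"
    using w by (intro sum.cong) (auto simp: lat_eq)
  moreover have "(\<Sum>\<kappa>\<in>?A. w (parent \<kappa>) *\<^sub>R normal_vector (lat F) (parent \<kappa>) \<alpha>) \<in> span \<alpha> \<longleftrightarrow>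
      (\<Sum>\<kappa>\<in>?A. w (parent \<kappa>) *\<^sub>R normal_vector (lat F) \<kappa> \<beta>) \<in> span \<alpha>"
  proof (rule span_sum_cong)
    fix \<kappa> assume \<kappa>: "\<kappa> \<in> ?A"
    then have k: "\<kappa> \<in> top_cones F'" "\<beta> \<subseteq> \<kappa>" by auto
    have "is_normal_vector (lat F) \<kappa> \<beta> (normal_vector (lat F) \<kappa> \<beta>)"
      using rational_fan_normal_vector[OF F' top(1)[OF k(1)] \<beta>(1) k(2) top(2)[OF k(1)]] unfolding lat_eq .
    then have "is_normal_vector (lat F) (parent \<kappa>) \<alpha> (normal_vector (lat F) \<kappa> \<beta>)"
      using parent(2)[OF k(1)] unfolding is_normal_vector_def sublat_def span_parent[OF k(1)] sp by blast
    then show "normal_vector (lat F) (parent \<kappa>) \<alpha> - normal_vector (lat F) \<kappa> \<beta> \<in> span \<alpha>"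
      by (rule normal_vector_cong) (rule rational_fan_pointed[OF F pc(1)[OF k(1)] \<alpha>(1) sub[OF \<kappa>]])
  qed
  ultimately show ?thesis unfolding balanced_at_def sp by simp
qed

text \<open>Join the two cones, near \<open>z\<close>, by a segment that is generic enough to cross only walls in the
  interior of \<open>\<eta>\<close>; across such a wall a balanced weight does not change.\<close>

lemma weight_constant_on_parent:
  assumes \<eta>: "\<eta> \<in> top_cones F"
    and bal: "\<And>\<beta>. \<beta> \<in> cones F' \<Longrightarrow> Suc (dim \<beta>) = fan_dim F' \<Longrightarrow> z \<in> \<beta> \<Longrightarrow> balanced_at F' w \<beta>"
    and \<kappa>1: "\<kappa>1 \<in> top_cones F'" "z \<in> \<kappa>1" "\<kappa>1 \<subseteq> \<eta>" and \<kappa>2: "\<kappa>2 \<in> top_cones F'" "z \<in> \<kappa>2" "\<kappa>2 \<subseteq> \<eta>"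
  shows "w \<kappa>1 = w \<kappa>2"
proof (rule ccontr)
  assume ne: "w \<kappa>1 \<noteq> w \<kappa>2"
  let ?d = "fan_dim F"
  have \<eta>c: "\<eta> \<in> cones F" "dim \<eta> = ?d" using \<eta> by (auto simp: cones_of_dim_def)
  have top: "\<kappa> \<in> cones F'" "dim \<kappa> = ?d" if "\<kappa> \<in> top_cones F'" for \<kappa>
    using that fan_dim_eq by (auto simp: cones_of_dim_def)
  note C\<eta> = rational_fan_cone(1)[OF F \<eta>c(1)]
  let ?\<C> = "cones F \<union> cones F'"
  have fd: "fin_dim \<xi>" if "\<xi> \<in> ?\<C>" for \<xi> using that rational_fan_cone(2)[OF F] rational_fan_cone(2)[OF F'] by blast
  have fin: "finite ?\<C>" using rational_fanD(2)[OF F] rational_fanD(2)[OF F'] by simp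
  have "finite (span ` ?\<C>)" using fin by simp
  \<comment> \<open>\<open>q\<close> avoids the span of every cone, of either fan, that has less
    than top dimension.\<close>
  then obtain q where q: "q \<in> \<kappa>2" "\<forall>W\<in>span ` ?\<C>. q \<in> W \<longrightarrow> \<kappa>2 \<subseteq> W"
    using generic_point[OF rational_fan_cone(1)[OF F' top(1)[OF \<kappa>2(1)]], of "span ` ?\<C>"] by auto
  \<comment> \<open>\<open>p\<close> is chosen after \<open>q\<close> and also avoids the spans of
    \<open>q\<close> with small cones; this keeps the segment off cones of codimension two or
    more.\<close>
  have "finite (span ` ?\<C> \<union> (\<lambda>\<gamma>. span (insert q \<gamma>)) ` ?\<C>)" using fin by simp
  then obtain p where p: "p \<in> \<kappa>1" "\<forall>W\<in>span ` ?\<C> \<union> (\<lambda>\<gamma>. span (insert q \<gamma>)) ` ?\<C>. p \<in> W \<longrightarrow> \<kappa>1 \<subseteq> W"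
    using generic_point[OF rational_fan_cone(1)[OF F' top(1)[OF \<kappa>1(1)]], of "span ` ?\<C> \<union> (\<lambda>\<gamma>. span (insert q \<gamma>)) ` ?\<C>"]
    by auto
  have q_dim: "?d \<le> dim \<xi>" if "\<xi> \<in> ?\<C>" "q \<in> span \<xi>" for \<xi>
    using q(2) that dim_mono_fin[OF fd[OF that(1)], of \<kappa>2] top(2)[OF \<kappa>2(1)] by auto
  have p_dim: "?d \<le> dim \<xi>" if "\<xi> \<in> ?\<C>" "p \<in> span \<xi>" for \<xi>
    using p(2) that dim_mono_fin[OF fd[OF that(1)], of \<kappa>1] top(2)[OF \<kappa>1(1)] by auto
  have pq_dim: "?d \<le> dim (insert q \<xi>)" if "\<xi> \<in> ?\<C>" "p \<in> span (insert q \<xi>)" for \<xi>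
    using p(2) that dim_mono_fin[OF fin_dim_insert[OF fd[OF that(1)]], of \<kappa>1] top(2)[OF \<kappa>1(1)] by auto
  let ?m = "\<lambda>t. (1 - t) *\<^sub>R p + t *\<^sub>R q"
  \<comment> \<open>The segment is shrunk towards \<open>z\<close> until it meets only cones of
    \<open>F'\<close> through \<open>z\<close>, where balancing is available.\<close>
  have "\<exists>\<epsilon>>0. \<forall>\<kappa>\<in>{\<kappa>\<in>cones F'. z \<notin> \<kappa>}. \<forall>t\<in>{0..1}. z + \<epsilon> *\<^sub>R ?m t \<notin> \<kappa>"
    using rational_fanD(2)[OF F'] rational_fan_cone(3)[OF F'] by (intro fg_cones_avoid) auto
  then obtain \<epsilon> :: real where \<epsilon>: "\<epsilon> > 0" "\<And>\<kappa> t. \<kappa> \<in> cones F' \<Longrightarrow> z \<notin> \<kappa> \<Longrightarrow> t \<in> {0..1} \<Longrightarrow> z + \<epsilon> *\<^sub>R ?m t \<notin> \<kappa>"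
    by auto
  define X where "X t = z + \<epsilon> *\<^sub>R ?m t" for t
  have X_line: "X t = (z + \<epsilon> *\<^sub>R p) + t *\<^sub>R (\<epsilon> *\<^sub>R (q - p))" for t
    unfolding X_def by (simp add: algebra_simps)
  have pq\<eta>: "p \<in> \<eta>" "q \<in> \<eta>" "z \<in> \<eta>" using p q \<kappa>1 \<kappa>2 by auto
  have parts: "\<epsilon> *\<^sub>R (1 - t) *\<^sub>R p \<in> \<eta>" "\<epsilon> *\<^sub>R t *\<^sub>R q \<in> \<eta>" if "t \<in> {0..1}" for t
    using pq\<eta> \<epsilon>(1) that by (auto intro!: convex_cone_scaleR[OF C\<eta>])
  have X\<eta>: "X t \<in> \<eta>" if "t \<in> {0..1}" for t
  proof -
    have "z + (\<epsilon> *\<^sub>R (1 - t) *\<^sub>R p + \<epsilon> *\<^sub>R t *\<^sub>R q) \<in> \<eta>"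
      using parts[OF that] pq\<eta> by (intro convex_cone_add[OF C\<eta>])
    then show ?thesis unfolding X_def by (simp add: scaleR_add_right)
  qed
  \<comment> \<open>The segment stays in the interior of \<eta>: a proper face containing
    \<open>X t\<close> would contain a positive multiple of \<open>p\<close> or \<open>q\<close>,
    against their choice.\<close>
  have X_carrier: "\<eta> \<subseteq> \<zeta>" if \<zeta>: "\<zeta> \<in> cones F" "X t \<in> \<zeta>" and t: "t \<in> {0..1}" for \<zeta> t
  proof -
    have i: "\<eta> \<inter> \<zeta> \<in> cones F" by (rule rational_fan_Int[OF F \<eta>c(1) \<zeta>(1)])
    have f: "\<eta> \<inter> \<zeta> face_of \<eta>" by (rule rational_fanD(7)[OF F \<eta>c(1) \<zeta>(1)])
    have s: "\<epsilon> *\<^sub>R (1 - t) *\<^sub>R p + (\<epsilon> *\<^sub>R t *\<^sub>R q + z) \<in> \<eta> \<inter> \<zeta>" "\<epsilon> *\<^sub>R t *\<^sub>R q + (\<epsilon> *\<^sub>R (1 - t) *\<^sub>R p + z) \<in> \<eta> \<inter> \<zeta>"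
      using X\<eta>[OF t] \<zeta>(2) unfolding X_def by (simp_all add: algebra_simps)
    have "\<epsilon> *\<^sub>R (1 - t) *\<^sub>R p \<in> \<eta> \<inter> \<zeta>" "\<epsilon> *\<^sub>R t *\<^sub>R q \<in> \<eta> \<inter> \<zeta>"
      using face_of_add[OF C\<eta> f _ _ s(1)] face_of_add[OF C\<eta> f _ _ s(2)] parts[OF t] pq\<eta>(3)
        convex_cone_add[OF C\<eta>] by blast+
    then have m: "\<epsilon> *\<^sub>R (1 - t) *\<^sub>R p \<in> span (\<eta> \<inter> \<zeta>)" "\<epsilon> *\<^sub>R t *\<^sub>R q \<in> span (\<eta> \<inter> \<zeta>)" by (blast intro: span_base)+
    have "?d \<le> dim (\<eta> \<inter> \<zeta>)"
    proof (cases "t = 0")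
      case True
      then have "p \<in> span (\<eta> \<inter> \<zeta>)" using m(1) span_scale[of "\<epsilon> *\<^sub>R p" _ "1 / \<epsilon>"] \<epsilon>(1) by simp
      then show ?thesis using p_dim i by blast
    next
      case False
      then have "q \<in> span (\<eta> \<inter> \<zeta>)" using m(2) span_scale[of "\<epsilon> *\<^sub>R t *\<^sub>R q" _ "1 / (\<epsilon> * t)"] \<epsilon>(1) by simp
      then show ?thesis using q_dim i by blast
    qed
    then have "\<eta> \<inter> \<zeta> = \<eta>" using \<eta>c by (intro rational_fan_eq_of_dim[OF F \<eta>c(1) i]) auto
    then show ?thesis by blast
  qed
  \<comment> \<open>Pieces through \<open>z\<close> with the weight of \<kappa>1, as opposed to
    those with another weight. Each family occupies a closed set of parameters and together they
    cover the connected interval, so some parameter belongs to both.\<close>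
  define \<A> where "\<A> = {\<kappa>\<in>top_cones F'. z \<in> \<kappa> \<and> \<kappa> \<subseteq> \<eta> \<and> w \<kappa> = w \<kappa>1}"
  define \<B> where "\<B> = {\<kappa>\<in>top_cones F'. z \<in> \<kappa> \<and> \<kappa> \<subseteq> \<eta> \<and> w \<kappa> \<noteq> w \<kappa>1}"
  have closed: "closed (\<Union>\<kappa>\<in>\<D>. {t. X t \<in> \<kappa>})" if "\<D> \<subseteq> top_cones F'" for \<D>
  proof (rule closed_UN)
    have "\<D> \<subseteq> cones F'" using that top(1) by blast
    then show "finite \<D>" using rational_fanD(2)[OF F'] finite_subset by blast
    show "\<forall>\<kappa>\<in>\<D>. closed {t. X t \<in> \<kappa>}"
      unfolding X_line using that top(1) rational_fan_cone(3)[OF F'] by (blast intro: fg_cone_closed_on_line)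
  qed
  let ?A = "\<Union>\<kappa>\<in>\<A>. {t. X t \<in> \<kappa>}" and ?B = "\<Union>\<kappa>\<in>\<B>. {t. X t \<in> \<kappa>}"
  have "\<exists>t\<in>{0..1}. t \<in> ?A \<and> t \<in> ?B"
  proof (rule ccontr)
    assume no: "\<not> ?thesis"
    have cover: "{0..1} \<subseteq> ?A \<union> ?B"
    proof
      fix t :: real assume t: "t \<in> {0..1}"
      obtain \<kappa> where \<kappa>: "\<kappa> \<in> top_cones F'" "X t \<in> \<kappa>" "\<kappa> \<subseteq> \<eta>" using refining_top_cone[OF \<eta> X\<eta>[OF t]] by blast
      have "z \<in> \<kappa>" using \<epsilon>(2)[OF top(1)[OF \<kappa>(1)] _ t] \<kappa>(2) unfolding X_def by blast
      then show "t \<in> ?A \<union> ?B"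
        using \<kappa> unfolding \<A>_def \<B>_def by blast
    qed
    have "X 0 \<in> \<kappa>1" "X 1 \<in> \<kappa>2"
      unfolding X_def using p q \<kappa>1 \<kappa>2 \<epsilon>(1) top(1) rational_fan_cone(1)[OF F']
      by (auto intro!: convex_cone_add convex_cone_scaleR)
    then have ends: "0 \<in> ?A" "1 \<in> ?B"
      using \<kappa>1 \<kappa>2 ne unfolding \<A>_def \<B>_def by auto
    have cl: "closed ?A" "closed ?B"
      by (rule closed; auto simp: \<A>_def \<B>_def)+
    have "?A \<inter> ?B \<inter> {0..1} = {}" using no by blast
    from connected_closedD[OF connected_Icc this cover cl]
    show False
    proof
      assume "?A \<inter> {0..1} = {}"
      then show False using ends(1) by (metis IntI atLeastAtMost_iff empty_iff order_refl zero_le_one)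
    next
      assume "?B \<inter> {0..1} = {}"
      then show False using ends(2) by (metis IntI atLeastAtMost_iff empty_iff order_refl zero_le_one)
    qed
  qed
  then obtain t \<kappa>A \<kappa>B where t: "t \<in> {0..1}" and A: "\<kappa>A \<in> \<A>" "X t \<in> \<kappa>A" and B: "\<kappa>B \<in> \<B>" "X t \<in> \<kappa>B" by blast
  have kA: "\<kappa>A \<in> top_cones F'" "z \<in> \<kappa>A" "w \<kappa>A = w \<kappa>1" using A by (auto simp: \<A>_def)
  have kB: "\<kappa>B \<in> top_cones F'" "z \<in> \<kappa>B" "w \<kappa>B \<noteq> w \<kappa>1" using B by (auto simp: \<B>_def)
  let ?\<beta> = "\<kappa>A \<inter> \<kappa>B"
  have \<beta>: "?\<beta> \<in> cones F'" by (rule rational_fan_Int[OF F' top(1)[OF kA(1)] top(1)[OF kB(1)]])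
  \<comment> \<open>The cones carry different weights, hence are distinct and cannot share a
    top-dimensional cone.\<close>
  have "dim ?\<beta> < ?d"
  proof (rule ccontr)
    assume "\<not> dim ?\<beta> < ?d"
    then have "?\<beta> = \<kappa>A" "?\<beta> = \<kappa>B"
      using rational_fan_eq_of_dim[OF F' top(1)[OF kA(1)] \<beta>] rational_fan_eq_of_dim[OF F' top(1)[OF kB(1)] \<beta>] top(2) kA(1) kB(1) by auto
    then show False using kA(3) kB(3) by auto
  qed
  \<comment> \<open>The crossing direction lies in \<open>span ?\<beta>\<close>, so \<beta> spans
    \<open>q\<close>, or \<open>p\<close> together with \<open>q\<close>; genericity then leaves
    codimension at most one.\<close>
  moreover have "?d \<le> Suc (dim ?\<beta>)"
  proof -
    have "X t - z \<in> span ?\<beta>" using A B kA kB by (intro span_diff span_base) auto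
    then have "(1 / \<epsilon>) *\<^sub>R (X t - z) \<in> span ?\<beta>" by (rule span_scale)
    then have m: "?m t \<in> span ?\<beta>" using \<epsilon>(1) unfolding X_def by simp
    show ?thesis
    proof (cases "t = 1")
      case True
      then have "q \<in> span ?\<beta>" using m by simp
      then show ?thesis using q_dim \<beta> by fastforce
    next
      case False
      have "?m t - t *\<^sub>R q \<in> span (insert q ?\<beta>)"
        using m span_mono[of ?\<beta> "insert q ?\<beta>"] by (intro span_diff span_scale) (auto intro: span_base)
      then have "(1 - t) *\<^sub>R p \<in> span (insert q ?\<beta>)" by simp
      from span_scale[OF this, of "1 / (1 - t)"]
      have "p \<in> span (insert q ?\<beta>)" using False by simp
      then have 1: "?d \<le> dim (insert q ?\<beta>)" using pq_dim \<beta> by blast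
      have "dim (insert q ?\<beta>) \<le> Suc (dim ?\<beta>)"
      proof (cases "q \<in> span ?\<beta>")
        case True
        then have "dim (insert q ?\<beta>) = dim ?\<beta>" by (intro span_eq_dim span_redundant)
        then show ?thesis by simp
      next
        case False
        then show ?thesis using dim_insert_fin[OF rational_fan_cone(2)[OF F' \<beta>]] by simp
      qed
      then show ?thesis using 1 by simp
    qed
  qed
  ultimately have d\<beta>: "Suc (dim ?\<beta>) = fan_dim F'" using fan_dim_eq by simp
  \<comment> \<open>\<open>X t\<close> is interior to \<eta>, so every piece around the crossing has
    \<eta> as parent; this is the equal-span condition at the wall.\<close>
  have sp: "span \<kappa> = span \<eta>" if \<kappa>: "\<kappa> \<in> top_cones F'" "?\<beta> \<subseteq> \<kappa>" for \<kappa>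
  proof -
    have pc: "parent \<kappa> \<in> cones F" "dim (parent \<kappa>) = ?d" using parent(1)[OF \<kappa>(1)] by (auto simp: cones_of_dim_def)
    have "X t \<in> parent \<kappa>" using parent(2)[OF \<kappa>(1)] \<kappa>(2) A B by auto
    then have "\<eta> \<subseteq> parent \<kappa>" using X_carrier pc(1) t by blast
    then have "\<eta> = parent \<kappa>" using rational_fan_eq_of_dim[OF F pc(1) \<eta>c(1)] pc(2) \<eta>c(2) by simp
    then show ?thesis using span_parent[OF \<kappa>(1)] by simp
  qed
  have "balanced_at F' w ?\<beta>" by (rule bal[OF \<beta> d\<beta>]) (use kA kB in simp)
  then have "w \<kappa>A = w \<kappa>B"
    by (rule balanced_at_interior_wall[OF F' _ \<beta> d\<beta> kA(1) kB(1) _ _ sp]) auto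
  then show False using kA(3) kB(3) by simp
qed

text \<open>An interior point \<open>z\<close> of the given cone of \<open>F'\<close> matches it
  with its carrier \<sigma> in \<open>F\<close>. A weight balanced near \<open>z\<close> is constant
  on the pieces of each top cone, so it descends to \<open>F\<close>, where rigidity at \<sigma>
  applies.\<close>

lemma rigid_refines:
  assumes G: "rigid K F"
    and ori_refines: "\<And>\<kappa> \<eta>. \<kappa> \<in> top_cones F' \<Longrightarrow> \<eta> \<in> top_cones F \<Longrightarrow> \<kappa> \<subseteq> \<eta> \<Longrightarrow> ori F' \<kappa> = ori F \<eta>"
  shows "rigid K F'"
  unfolding rigid_def
proof (intro ballI allI impI)
  fix \<sigma>' w' assume \<sigma>': "\<sigma>' \<in> cones F'" and w': "local_weight K F' \<sigma>' w'"
  obtain z where z: "z \<in> \<sigma>'" "\<And>\<eta>. \<eta> \<in> cones F' \<Longrightarrow> z \<in> \<eta> \<Longrightarrow> \<sigma>' \<subseteq> \<eta>"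
    using rational_fan_interior_point[OF F' \<sigma>'] by blast
  have "z \<in> supp F" using mem_supp'[OF \<sigma>' z(1)] .
  then obtain \<sigma> where \<sigma>: "\<sigma> \<in> cones F" "z \<in> \<sigma>" "\<And>\<eta>. \<eta> \<in> cones F \<Longrightarrow> z \<in> \<eta> \<Longrightarrow> \<sigma> \<subseteq> \<eta>"
    using rational_fan_carrier[OF F] by blast
  \<comment> \<open>One piece through \<open>z\<close> in each top cone; by constancy the weight on
    it stands for all pieces through \<open>z\<close>.\<close>
  define k where "k \<eta> = (SOME \<kappa>. \<kappa> \<in> top_cones F' \<and> z \<in> \<kappa> \<and> \<kappa> \<subseteq> \<eta>)" for \<eta>
  have k: "k \<eta> \<in> top_cones F' \<and> z \<in> k \<eta> \<and> k \<eta> \<subseteq> \<eta>" if "\<eta> \<in> top_cones F" "z \<in> \<eta>" for \<eta>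
    unfolding k_def by (rule someI_ex) (use refining_top_cone[OF that] in blast)
  define w where "w \<eta> = w' (k \<eta>)" for \<eta>
  have top: "\<kappa> \<in> cones F'" if "\<kappa> \<in> top_cones F'" for \<kappa> using that by (simp add: cones_of_dim_def)
  have bal: "balanced_at F' w' \<beta>" if "\<beta> \<in> cones F'" "Suc (dim \<beta>) = fan_dim F'" "z \<in> \<beta>" for \<beta>
    using w' z(2)[OF that(1,3)] that unfolding local_weight_def by blast
  have const: "w' \<kappa> = w (parent \<kappa>)" if \<kappa>: "\<kappa> \<in> top_cones F'" "z \<in> \<kappa>" for \<kappa>
  proof -
    have zp: "z \<in> parent \<kappa>" using parent(2)[OF \<kappa>(1)] \<kappa>(2) by blast
    note kk = k[OF parent(1)[OF \<kappa>(1)] zp]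
    show ?thesis unfolding w_def
      by (rule weight_constant_on_parent[OF parent(1)[OF \<kappa>(1)] bal \<kappa> parent(2)[OF \<kappa>(1)]])
        (use kk in auto)
  qed
  have "local_weight K F \<sigma> w"
    unfolding local_weight_def
  proof (intro conjI ballI impI)
    fix \<eta> assume \<eta>: "\<eta> \<in> top_cones F" "\<sigma> \<subseteq> \<eta>"
    then have "k \<eta> \<in> top_cones F'" "\<sigma>' \<subseteq> k \<eta>" using k[OF \<eta>(1)] \<sigma>(2) z(2) top by blast+
    then show "w \<eta> \<in> K" unfolding w_def using w' by (simp add: local_weight_def)
  next
    fix \<alpha> assume \<alpha>: "\<alpha> \<in> cones F" "Suc (dim \<alpha>) = fan_dim F \<and> \<sigma> \<subseteq> \<alpha>"
    then have "z \<in> \<alpha>" using \<sigma>(2) by blast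
    from refining_cone[OF \<alpha>(1) this]
    obtain \<beta> where \<beta>: "\<beta> \<in> cones F'" "z \<in> \<beta>" "\<beta> \<subseteq> \<alpha>" "span \<beta> = span \<alpha>" .
    have d: "dim \<beta> = dim \<alpha>" by (rule span_eq_dim[OF \<beta>(4)])
    have "balanced_at F' w' \<beta>" using bal \<beta> d \<alpha>(2) fan_dim_eq by simp
    then show "balanced_at F w \<alpha>"
      using balanced_at_refined_wall[OF \<alpha>(1) _ \<beta>(1,3) d, of w' w] const \<alpha>(2) \<beta>(2) by blast
  qed
  from rigidD[OF G \<sigma>(1) this] obtain c where
    c: "c \<in> K" "\<And>\<eta>. \<eta> \<in> top_cones F \<Longrightarrow> \<sigma> \<subseteq> \<eta> \<Longrightarrow> w \<eta> = c * ori F \<eta>" by blast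
  have "w' \<kappa> = c * ori F' \<kappa>" if \<kappa>: "\<kappa> \<in> top_cones F'" "\<sigma>' \<subseteq> \<kappa>" for \<kappa>
  proof -
    note p = parent[OF \<kappa>(1)]
    have "z \<in> \<kappa>" using z(1) \<kappa>(2) by blast
    moreover have "\<sigma> \<subseteq> parent \<kappa>" using \<sigma>(3)[of "parent \<kappa>"] p(1,2) calculation by (auto simp: cones_of_dim_def)
    ultimately show ?thesis using const[OF \<kappa>(1)] c(2)[OF p(1)] ori_refines[OF \<kappa>(1) p(1,2)] by simp
  qed
  then show "\<exists>c\<in>K. \<forall>\<eta>\<in>top_cones F'. \<sigma>' \<subseteq> \<eta> \<longrightarrow> w' \<eta> = c * ori F' \<eta>" using c(1) by blast
qed

text \<open>The weight is pulled back along \<open>parent\<close>. Balancing on \<open>F'\<close>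
  then has to be checked at the old walls and at those created by the subdivision, and rigidity of
  \<open>F'\<close> is read back on one piece of each top cone.\<close>

lemma rigid_coarsens:
  assumes G: "rigid K F'"
    and ori_refines: "\<And>\<kappa> \<eta>. \<kappa> \<in> top_cones F' \<Longrightarrow> \<eta> \<in> top_cones F \<Longrightarrow> \<kappa> \<subseteq> \<eta> \<Longrightarrow> ori F' \<kappa> = ori F \<eta>"
    and bal': "\<And>\<tau>. \<tau> \<in> cones F' \<Longrightarrow> Suc (dim \<tau>) = fan_dim F' \<Longrightarrow> balanced_at F' (ori F') \<tau>"
    and ori0: "\<And>\<eta>. \<eta> \<in> top_cones F \<Longrightarrow> ori F \<eta> \<noteq> 0"
  shows "rigid K F"
  unfolding rigid_def
proof (intro ballI allI impI)
  fix \<sigma> w assume \<sigma>: "\<sigma> \<in> cones F" and w: "local_weight K F \<sigma> w"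
  obtain z where z: "z \<in> \<sigma>" "\<And>\<eta>. \<eta> \<in> cones F \<Longrightarrow> z \<in> \<eta> \<Longrightarrow> \<sigma> \<subseteq> \<eta>"
    using rational_fan_interior_point[OF F \<sigma>] by blast
  have "z \<in> supp F'" using mem_supp[OF \<sigma> z(1)] .
  then obtain \<sigma>' where \<sigma>': "\<sigma>' \<in> cones F'" "z \<in> \<sigma>'" "\<And>\<eta>. \<eta> \<in> cones F' \<Longrightarrow> z \<in> \<eta> \<Longrightarrow> \<sigma>' \<subseteq> \<eta>"
    using rational_fan_carrier[OF F'] by blast
  let ?w' = "\<lambda>\<kappa>. w (parent \<kappa>)"
  have "local_weight K F' \<sigma>' ?w'"
    unfolding local_weight_def
  proof (intro conjI ballI impI)
    fix \<kappa> assume \<kappa>: "\<kappa> \<in> top_cones F'" "\<sigma>' \<subseteq> \<kappa>"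
    have "z \<in> parent \<kappa>" using parent(2)[OF \<kappa>(1)] \<kappa>(2) \<sigma>'(2) by blast
    then have "\<sigma> \<subseteq> parent \<kappa>" using z(2) parent(1)[OF \<kappa>(1)] by (simp add: cones_of_dim_def)
    then show "?w' \<kappa> \<in> K" using w parent(1)[OF \<kappa>(1)] by (simp add: local_weight_def)
  next
    fix \<beta> assume \<beta>: "\<beta> \<in> cones F'" and \<beta>2: "Suc (dim \<beta>) = fan_dim F' \<and> \<sigma>' \<subseteq> \<beta>"
    obtain x where x: "x \<in> \<beta>" "\<And>\<eta>. \<eta> \<in> cones F' \<Longrightarrow> x \<in> \<eta> \<Longrightarrow> \<beta> \<subseteq> \<eta>"
      using rational_fan_interior_point[OF F' \<beta>] by blast
    have "x \<in> supp F" using mem_supp'[OF \<beta> x(1)] .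
    then obtain \<alpha> where \<alpha>: "\<alpha> \<in> cones F" "x \<in> \<alpha>" "\<And>\<eta>. \<eta> \<in> cones F \<Longrightarrow> x \<in> \<eta> \<Longrightarrow> \<alpha> \<subseteq> \<eta>"
      using rational_fan_carrier[OF F] by blast
    have \<beta>\<alpha>: "\<beta> \<subseteq> \<alpha>" by (rule carrier_mono[OF \<beta> x \<alpha>(1,2)])
    have le: "dim \<beta> \<le> dim \<alpha>" "dim \<alpha> \<le> fan_dim F"
      using rational_fan_dim_mono[OF F \<alpha>(1), of \<beta>] \<beta>\<alpha> span_superset[of \<alpha>] rational_fan_dim_le[OF F \<alpha>(1)] by auto
    \<comment> \<open>\<alpha> is the carrier in \<open>F\<close> of an interior point of \<beta>:
      either it is a wall of the same dimension, or \<beta> runs through the inside of a top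
      cone.\<close>
    show "balanced_at F' ?w' \<beta>"
    proof (cases "dim \<beta> = dim \<alpha>")
      case True
      have "\<sigma> \<subseteq> \<alpha>" using z(2)[OF \<alpha>(1)] \<beta>\<alpha> \<beta>2 \<sigma>'(2) by blast
      moreover have d: "Suc (dim \<alpha>) = fan_dim F" using True \<beta>2 fan_dim_eq by simp
      ultimately have "balanced_at F w \<alpha>" using w \<alpha>(1) by (simp add: local_weight_def)
      then show ?thesis using balanced_at_refined_wall[OF \<alpha>(1) d \<beta> \<beta>\<alpha> True, of ?w' w] by simp
    next
      case False
      then have d: "dim \<alpha> = fan_dim F" using le \<beta>2 fan_dim_eq by simp
      then have \<alpha>t: "\<alpha> \<in> top_cones F" using \<alpha>(1) by (simp add: cones_of_dim_def)
      have p: "parent \<kappa> = \<alpha>" if \<kappa>: "\<kappa> \<in> top_cones F'" "\<beta> \<subseteq> \<kappa>" for \<kappa>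
      proof -
        have pc: "parent \<kappa> \<in> cones F" "dim (parent \<kappa>) = fan_dim F"
          using parent(1)[OF \<kappa>(1)] by (auto simp: cones_of_dim_def)
        have "\<alpha> \<subseteq> parent \<kappa>" using \<alpha>(3)[OF pc(1)] parent(2)[OF \<kappa>(1)] \<kappa>(2) x(1) by blast
        then show ?thesis using rational_fan_eq_of_dim[OF F pc(1) \<alpha>(1)] pc(2) d by simp
      qed
      \<comment> \<open>All pieces around this wall have parent \<alpha>, so the weight is locally a
        multiple of the balanced orientation. Only balancing is at stake, hence the factor may leave
        \<open>K\<close>.\<close>
      have "balanced_at F' (\<lambda>\<kappa>. (w \<alpha> / ori F \<alpha>) * ori F' \<kappa>) \<beta>"
        using bal'[OF \<beta>] \<beta>2 by (intro balanced_at_scale) blast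
      moreover have "?w' \<kappa> = (w \<alpha> / ori F \<alpha>) * ori F' \<kappa>" if \<kappa>: "\<kappa> \<in> top_cones F'" "\<beta> \<subseteq> \<kappa>" for \<kappa>
        using p[OF \<kappa>] ori_refines[OF \<kappa>(1) parent(1,2)[OF \<kappa>(1)]] ori0[OF \<alpha>t] by simp
      ultimately show ?thesis
        using balanced_at_cong[of F' \<beta> ?w' "\<lambda>\<kappa>. (w \<alpha> / ori F \<alpha>) * ori F' \<kappa>"] by blast
    qed
  qed
  from rigidD[OF G \<sigma>'(1) this] obtain c where
    c: "c \<in> K" "\<And>\<kappa>. \<kappa> \<in> top_cones F' \<Longrightarrow> \<sigma>' \<subseteq> \<kappa> \<Longrightarrow> ?w' \<kappa> = c * ori F' \<kappa>" by blast
  have "w \<eta> = c * ori F \<eta>" if \<eta>: "\<eta> \<in> top_cones F" "\<sigma> \<subseteq> \<eta>" for \<eta>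
  proof -
    have "z \<in> \<eta>" using z(1) \<eta>(2) by blast
    then obtain \<kappa> where \<kappa>: "\<kappa> \<in> top_cones F'" "z \<in> \<kappa>" "\<kappa> \<subseteq> \<eta>" "parent \<kappa> = \<eta>"
      using refining_top_cone[OF \<eta>(1)] by blast
    have "\<sigma>' \<subseteq> \<kappa>" using \<sigma>'(3)[OF _ \<kappa>(2)] \<kappa>(1) by (simp add: cones_of_dim_def)
    then show ?thesis using c(2)[OF \<kappa>(1)] \<kappa>(4) ori_refines[OF \<kappa>(1) \<eta>(1) \<kappa>(3)] by simp
  qed
  then show "\<exists>c\<in>K. \<forall>\<eta>\<in>top_cones F. \<sigma> \<subseteq> \<eta> \<longrightarrow> w \<eta> = c * ori F \<eta>" using c(1) by blast
qed

end

section \<open>Balancing on the two kinds of walls of a product\<close>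

section \<open>Products\<close>

text \<open>A maximal cone among those around \<sigma> is a facet, and purity fixes its
  dimension.\<close>

lemma tropical_fan_pure:
  assumes "tropical_fan F" "\<sigma> \<in> cones F"
  obtains \<eta> where "\<eta> \<in> top_cones F" "\<sigma> \<subseteq> \<eta>"
proof -
  have "finite {\<eta>\<in>cones F. \<sigma> \<subseteq> \<eta>}" "{\<eta>\<in>cones F. \<sigma> \<subseteq> \<eta>} \<noteq> {}"
    using rational_fanD(2)[OF tropical_fan_rational[OF assms(1)]] assms(2) by auto
  then obtain \<eta> where \<eta>: "\<eta> \<in> cones F" "\<sigma> \<subseteq> \<eta>" "\<And>\<zeta>. \<zeta> \<in> cones F \<Longrightarrow> \<sigma> \<subseteq> \<zeta> \<Longrightarrow> \<eta> \<subseteq> \<zeta> \<Longrightarrow> \<eta> = \<zeta>"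
    using finite_has_maximal[of "{\<eta>\<in>cones F. \<sigma> \<subseteq> \<eta>}"] by auto
  have "\<eta> \<in> facets F" unfolding facets_def using \<eta> by blast
  then have "dim \<eta> = fan_dim F" using assms(1) unfolding tropical_fan_def by blast
  then show ?thesis using that \<eta> by (simp add: cones_of_dim_def)
qed

lemma tropical_fan_top:
  assumes "tropical_fan F"
  shows "\<exists>\<eta>. \<eta> \<in> top_cones F"
proof -
  obtain \<sigma> where "\<sigma> \<in> cones F" using rational_fanD(3)[OF tropical_fan_rational[OF assms]] by blast
  from tropical_fan_pure[OF assms this] show ?thesis by blast
qed

lemma fan_dim_eqI:
  assumes "finite (cones F)" "\<And>\<sigma>. \<sigma> \<in> cones F \<Longrightarrow> dim \<sigma> \<le> d" "\<sigma> \<in> cones F" "dim \<sigma> = d"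
  shows "fan_dim F = d"
  unfolding fan_dim_def by (rule Max_eqI) (use assms in auto)

lemma sublat_Times:
  "0 \<in> \<sigma> \<Longrightarrow> 0 \<in> \<eta> \<Longrightarrow> sublat (L \<times> M) (\<sigma> \<times> \<eta>) = sublat L \<sigma> \<times> sublat M \<eta>"
  unfolding sublat_def span_Times by blast

lemma is_normal_vector_Times:
  assumes n: "is_normal_vector N \<sigma> \<tau> n" and zero: "0 \<in> \<sigma>" "0 \<in> \<tau>" "0 \<in> \<eta>" and M: "additive_subgroup M"
  shows "is_normal_vector (N \<times> M) (\<sigma> \<times> \<eta>) (\<tau> \<times> \<eta>) (n, 0)"
    and "is_normal_vector (M \<times> N) (\<eta> \<times> \<sigma>) (\<eta> \<times> \<tau>) (0, n)"
proof -
  show *: "is_normal_vector (N \<times> M) (\<sigma> \<times> \<eta>) (\<tau> \<times> \<eta>) (n, 0)"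
    unfolding is_normal_vector_def sublat_Times[OF zero(1,3)] sublat_Times[OF zero(2,3)] span_Times[OF zero(2,3)]
  proof (intro conjI)
    have "0 \<in> sublat M \<eta>" by (intro additive_subgroup_0 additive_subgroup_sublat M)
    then show "(n, 0) \<in> sublat N \<sigma> \<times> sublat M \<eta>" using n by (simp add: is_normal_vector_def)
    obtain x where "x \<in> \<sigma>" "x \<notin> span \<tau>" "n - x \<in> span \<tau>" using n unfolding is_normal_vector_def by blast
    then show "\<exists>x\<in>\<sigma> \<times> \<eta> - span \<tau> \<times> span \<eta>. (n, 0) - x \<in> span \<tau> \<times> span \<eta>"
      using zero(3) span_0[of \<eta>] by (intro bexI[of _ "(x, 0)"]) auto
    have s: "sublat N \<sigma> = {x + of_int k *\<^sub>R n | x (k::int). x \<in> sublat N \<tau>}"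
      using n by (simp add: is_normal_vector_def)
    show "{x + of_int k *\<^sub>R (n, 0) | x (k::int). x \<in> sublat N \<tau> \<times> sublat M \<eta>} = sublat N \<sigma> \<times> sublat M \<eta>"
      unfolding s by force
  qed
  have lin: "linear (prod.swap :: 'a \<times> 'b \<Rightarrow> 'b \<times> 'a)" by (rule linearI) auto
  have "is_normal_vector (M \<times> N) (prod.swap ` (\<sigma> \<times> \<eta>)) (prod.swap ` (\<tau> \<times> \<eta>)) (prod.swap (n, 0))"
    by (rule normal_vector_image[OF lin *])
      (auto simp: product_swap sublat_Times span_Times zero)
  then show "is_normal_vector (M \<times> N) (\<eta> \<times> \<sigma>) (\<eta> \<times> \<tau>) (0, n)" by (simp add: product_swap)
qed

locale fan_product =
  fixes F :: "('a::real_vector, 'm) ofan_scheme" and G :: "('b::real_vector, 'n) ofan_scheme"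
  assumes F: "tropical_fan F" and G: "tropical_fan G"
begin

abbreviation P :: "('a \<times> 'b) ofan" where "P \<equiv> prod_fan F G"

lemmas rF = tropical_fan_rational[OF F]
lemmas rG = tropical_fan_rational[OF G]

lemma cones_P: "\<zeta> \<in> cones P \<longleftrightarrow> (\<exists>\<sigma>\<in>cones F. \<exists>\<eta>\<in>cones G. \<zeta> = \<sigma> \<times> \<eta>)"
  by (auto simp: prod_fan_def)

lemma lat_P: "lat P = lat F \<times> lat G"
  by (simp add: prod_fan_def)

lemma zeroF: "\<sigma> \<in> cones F \<Longrightarrow> 0 \<in> \<sigma>" and zeroG: "\<eta> \<in> cones G \<Longrightarrow> 0 \<in> \<eta>"
  using rational_fan_cone(4)[OF rF] rational_fan_cone(4)[OF rG] by blast+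

lemma Times_subset: "\<sigma> \<in> cones F \<Longrightarrow> \<eta> \<in> cones G \<Longrightarrow> \<sigma> \<times> \<eta> \<subseteq> \<sigma>' \<times> \<eta>' \<longleftrightarrow> \<sigma> \<subseteq> \<sigma>' \<and> \<eta> \<subseteq> \<eta>'"
  using zeroF zeroG by (auto simp: times_subset_iff)

lemma Times_eq: "\<sigma> \<in> cones F \<Longrightarrow> \<eta> \<in> cones G \<Longrightarrow> \<sigma> \<times> \<eta> = \<sigma>' \<times> \<eta>' \<longleftrightarrow> \<sigma> = \<sigma>' \<and> \<eta> = \<eta>'"
  using zeroF zeroG by (auto simp: times_eq_iff)

lemma dim_P: "\<sigma> \<in> cones F \<Longrightarrow> \<eta> \<in> cones G \<Longrightarrow> dim (\<sigma> \<times> \<eta>) = dim \<sigma> + dim \<eta>"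
  by (intro dim_Times_fin rational_fan_cone(2)[OF rF] rational_fan_cone(2)[OF rG] zeroF zeroG)

lemma span_P: "\<sigma> \<in> cones F \<Longrightarrow> \<eta> \<in> cones G \<Longrightarrow> span (\<sigma> \<times> \<eta>) = span \<sigma> \<times> span \<eta>"
  by (intro span_Times zeroF zeroG)

lemma spanned_P: "lattice_spanned P"
  unfolding lattice_spanned_def lat_P
proof (intro conjI ballI)
  have sF: "lattice_spanned F" and sG: "lattice_spanned G"
    using rational_fan_lattice_spanned rF rG by blast+
  show "additive_subgroup (lat F \<times> lat G)"
    using sF sG unfolding lattice_spanned_def by (blast intro: additive_subgroup_Times)
  fix \<zeta> assume "\<zeta> \<in> cones P"
  then obtain \<sigma> \<eta> where c: "\<sigma> \<in> cones F" "\<eta> \<in> cones G" "\<zeta> = \<sigma> \<times> \<eta>" using cones_P by blast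
  show "fin_dim \<zeta>" unfolding c(3)
    by (intro fin_dim_Times rational_fan_cone(2)[OF rF c(1)] rational_fan_cone(2)[OF rG c(2)])
  have "0 \<in> lat F \<inter> \<sigma>" "0 \<in> lat G \<inter> \<eta>"
    using zeroF[OF c(1)] zeroG[OF c(2)] sF sG additive_subgroup_0 unfolding lattice_spanned_def by blast+
  then have "span ((lat F \<times> lat G) \<inter> \<zeta>) = span (lat F \<inter> \<sigma>) \<times> span (lat G \<inter> \<eta>)"
    unfolding c(3) Times_Int_Times by (rule span_Times)
  moreover have "\<sigma> \<subseteq> span (lat F \<inter> \<sigma>)" "\<eta> \<subseteq> span (lat G \<inter> \<eta>)"
    using sF sG c unfolding lattice_spanned_def by blast+
  ultimately show "\<zeta> \<subseteq> span ((lat F \<times> lat G) \<inter> \<zeta>)" unfolding c(3) by blast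
qed

lemma fan_dim_P: "fan_dim P = fan_dim F + fan_dim G"
proof -
  obtain \<sigma> \<eta> where t: "\<sigma> \<in> top_cones F" "\<eta> \<in> top_cones G"
    using tropical_fan_top[OF F] tropical_fan_top[OF G] by blast
  then have c: "\<sigma> \<in> cones F" "\<eta> \<in> cones G" "dim \<sigma> = fan_dim F" "dim \<eta> = fan_dim G" by (auto simp: cones_of_dim_def)
  show ?thesis
  proof (rule fan_dim_eqI)
    have "cones P = (\<lambda>(\<sigma>, \<eta>). \<sigma> \<times> \<eta>) ` (cones F \<times> cones G)" by (force simp: prod_fan_def)
    then show "finite (cones P)" using rational_fanD(2)[OF rF] rational_fanD(2)[OF rG] by simp
    show "\<sigma> \<times> \<eta> \<in> cones P" using c cones_P by blast
    show "dim (\<sigma> \<times> \<eta>) = fan_dim F + fan_dim G" using dim_P c by simp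
    fix \<zeta> assume "\<zeta> \<in> cones P"
    then obtain \<sigma> \<eta> where c: "\<sigma> \<in> cones F" "\<eta> \<in> cones G" "\<zeta> = \<sigma> \<times> \<eta>" using cones_P by blast
    then show "dim \<zeta> \<le> fan_dim F + fan_dim G"
      using dim_P[OF c(1,2)] rational_fan_dim_le[OF rF c(1)] rational_fan_dim_le[OF rG c(2)] by simp
  qed
qed

lemma top_P: "\<zeta> \<in> top_cones P \<longleftrightarrow> (\<exists>\<sigma>\<in>top_cones F. \<exists>\<eta>\<in>top_cones G. \<zeta> = \<sigma> \<times> \<eta>)"
proof
  assume "\<zeta> \<in> top_cones P"
  then obtain \<sigma> \<eta> where c: "\<sigma> \<in> cones F" "\<eta> \<in> cones G" "\<zeta> = \<sigma> \<times> \<eta>" "dim \<zeta> = fan_dim P"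
    using cones_P by (auto simp: cones_of_dim_def)
  then have "dim \<sigma> + dim \<eta> = fan_dim F + fan_dim G" using dim_P fan_dim_P by simp
  then have "dim \<sigma> = fan_dim F" "dim \<eta> = fan_dim G"
    using rational_fan_dim_le[OF rF c(1)] rational_fan_dim_le[OF rG c(2)] by linarith+
  then show "\<exists>\<sigma>\<in>top_cones F. \<exists>\<eta>\<in>top_cones G. \<zeta> = \<sigma> \<times> \<eta>" using c by (auto simp: cones_of_dim_def)
next
  assume "\<exists>\<sigma>\<in>top_cones F. \<exists>\<eta>\<in>top_cones G. \<zeta> = \<sigma> \<times> \<eta>"
  then show "\<zeta> \<in> top_cones P" using dim_P fan_dim_P cones_P by (auto simp: cones_of_dim_def)
qed

lemma ori_P: "\<sigma> \<in> cones F \<Longrightarrow> \<eta> \<in> cones G \<Longrightarrow> ori P (\<sigma> \<times> \<eta>) = ori F \<sigma> * ori G \<eta>"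
  using zeroF zeroG by (auto simp: prod_fan_def fst_image_times snd_image_times)

text \<open>\<eta> is top-dimensional, so the top cones over the wall keep \<eta> as second factor,
  and their normal vectors can be taken with second component 0. The first projection gives the
  condition on \<open>F\<close>.\<close>

lemma balanced_at_P_left:
  assumes \<tau>: "\<tau> \<in> cones F" "Suc (dim \<tau>) = fan_dim F" and \<eta>: "\<eta> \<in> top_cones G"
    and bal: "balanced_at P w (\<tau> \<times> \<eta>)"
  shows "balanced_at F (\<lambda>\<sigma>. w (\<sigma> \<times> \<eta>)) \<tau>"
proof -
  have \<eta>c: "\<eta> \<in> cones G" "dim \<eta> = fan_dim G" using \<eta> by (auto simp: cones_of_dim_def)
  let ?C = "{\<sigma>. \<sigma> \<in> top_cones F \<and> \<tau> \<subseteq> \<sigma>}"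
  have C: "\<sigma> \<in> cones F" "\<tau> \<subseteq> \<sigma>" "Suc (dim \<tau>) = dim \<sigma>" if "\<sigma> \<in> ?C" for \<sigma>
    using that \<tau> by (auto simp: cones_of_dim_def)
  have set: "{\<zeta>. \<zeta> \<in> top_cones P \<and> \<tau> \<times> \<eta> \<subseteq> \<zeta>} = (\<lambda>\<sigma>. \<sigma> \<times> \<eta>) ` ?C"
  proof
    show "{\<zeta>. \<zeta> \<in> top_cones P \<and> \<tau> \<times> \<eta> \<subseteq> \<zeta>} \<subseteq> (\<lambda>\<sigma>. \<sigma> \<times> \<eta>) ` ?C"
    proof clarify
      fix \<zeta> assume "\<zeta> \<in> top_cones P" and sub: "\<tau> \<times> \<eta> \<subseteq> \<zeta>"
      then obtain \<sigma> \<eta>' where c: "\<sigma> \<in> top_cones F" "\<eta>' \<in> top_cones G" "\<zeta> = \<sigma> \<times> \<eta>'" using top_P by blast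
      have s: "\<tau> \<subseteq> \<sigma>" "\<eta> \<subseteq> \<eta>'" using sub Times_subset[OF \<tau>(1) \<eta>c(1)] c(3) by blast+
      have "\<eta> = \<eta>'" using c(2) \<eta>c s(2) by (intro rational_fan_eq_of_dim[OF rG]) (auto simp: cones_of_dim_def)
      then show "\<zeta> \<in> (\<lambda>\<sigma>. \<sigma> \<times> \<eta>) ` ?C" using c s by blast
    qed
    show "(\<lambda>\<sigma>. \<sigma> \<times> \<eta>) ` ?C \<subseteq> {\<zeta>. \<zeta> \<in> top_cones P \<and> \<tau> \<times> \<eta> \<subseteq> \<zeta>}" using top_P \<eta> by blast
  qed
  have inj: "inj_on (\<lambda>\<sigma>. \<sigma> \<times> \<eta>) ?C" using Times_eq \<eta>c C by (intro inj_onI) blast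
  have "(\<Sum>\<sigma>\<in>?C. w (\<sigma> \<times> \<eta>) *\<^sub>R normal_vector (lat P) (\<sigma> \<times> \<eta>) (\<tau> \<times> \<eta>)) \<in> span (\<tau> \<times> \<eta>)"
    using bal unfolding balanced_at_def set sum.reindex[OF inj] by (simp add: o_def)
  moreover have "(\<Sum>\<sigma>\<in>?C. w (\<sigma> \<times> \<eta>) *\<^sub>R normal_vector (lat P) (\<sigma> \<times> \<eta>) (\<tau> \<times> \<eta>)) \<in> span (\<tau> \<times> \<eta>) \<longleftrightarrow>
      (\<Sum>\<sigma>\<in>?C. w (\<sigma> \<times> \<eta>) *\<^sub>R (normal_vector (lat F) \<sigma> \<tau>, 0)) \<in> span (\<tau> \<times> \<eta>)"
  proof (rule span_sum_cong, rule normal_vector_cong)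
    fix \<sigma> assume \<sigma>: "\<sigma> \<in> ?C"
    let ?n = "normal_vector (lat F) \<sigma> \<tau>"
    have n: "is_normal_vector (lat F) \<sigma> \<tau> ?n"
      by (rule rational_fan_normal_vector[OF rF C(1)[OF \<sigma>] \<tau>(1) C(2,3)[OF \<sigma>]])
    show "is_normal_vector (lat P) (\<sigma> \<times> \<eta>) (\<tau> \<times> \<eta>) (?n, 0)"
      unfolding lat_P using zeroF[OF C(1)[OF \<sigma>]] zeroF[OF \<tau>(1)] zeroG[OF \<eta>c(1)]
      by (intro is_normal_vector_Times(1)[OF n] lattice_subgroup rational_fanD(1)[OF rG])
    fix x y assume "x \<in> \<sigma> \<times> \<eta>" "y \<in> \<sigma> \<times> \<eta>" "x + y \<in> span (\<tau> \<times> \<eta>)"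
    then show "x \<in> span (\<tau> \<times> \<eta>)"
      unfolding span_P[OF \<tau>(1) \<eta>c(1)]
      using rational_fan_pointed[OF rF C(1)[OF \<sigma>] \<tau>(1) C(2)[OF \<sigma>], of "fst x" "fst y"]
      by (auto intro: span_base)
  qed
  ultimately have "(\<Sum>\<sigma>\<in>?C. w (\<sigma> \<times> \<eta>) *\<^sub>R (normal_vector (lat F) \<sigma> \<tau>, 0::'b)) \<in> span \<tau> \<times> span \<eta>"
    unfolding span_P[OF \<tau>(1) \<eta>c(1)] by simp
  then have "fst (\<Sum>\<sigma>\<in>?C. w (\<sigma> \<times> \<eta>) *\<^sub>R (normal_vector (lat F) \<sigma> \<tau>, 0::'b)) \<in> span \<tau>"
    unfolding mem_Times_iff by (rule conjunct1)
  then show ?thesis unfolding balanced_at_def by (simp add: fst_sum)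
qed

lemma balanced_at_P_right:
  assumes \<tau>: "\<tau> \<in> cones G" "Suc (dim \<tau>) = fan_dim G" and \<eta>: "\<eta> \<in> top_cones F"
    and bal: "balanced_at P w (\<eta> \<times> \<tau>)"
  shows "balanced_at G (\<lambda>\<sigma>. w (\<eta> \<times> \<sigma>)) \<tau>"
proof -
  have \<eta>c: "\<eta> \<in> cones F" "dim \<eta> = fan_dim F" using \<eta> by (auto simp: cones_of_dim_def)
  let ?C = "{\<sigma>. \<sigma> \<in> top_cones G \<and> \<tau> \<subseteq> \<sigma>}"
  have C: "\<sigma> \<in> cones G" "\<tau> \<subseteq> \<sigma>" "Suc (dim \<tau>) = dim \<sigma>" if "\<sigma> \<in> ?C" for \<sigma>
    using that \<tau> by (auto simp: cones_of_dim_def)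
  have set: "{\<zeta>. \<zeta> \<in> top_cones P \<and> \<eta> \<times> \<tau> \<subseteq> \<zeta>} = (\<lambda>\<sigma>. \<eta> \<times> \<sigma>) ` ?C"
  proof
    show "{\<zeta>. \<zeta> \<in> top_cones P \<and> \<eta> \<times> \<tau> \<subseteq> \<zeta>} \<subseteq> (\<lambda>\<sigma>. \<eta> \<times> \<sigma>) ` ?C"
    proof clarify
      fix \<zeta> assume "\<zeta> \<in> top_cones P" and sub: "\<eta> \<times> \<tau> \<subseteq> \<zeta>"
      then obtain \<eta>' \<sigma> where c: "\<eta>' \<in> top_cones F" "\<sigma> \<in> top_cones G" "\<zeta> = \<eta>' \<times> \<sigma>" using top_P by blast
      have s: "\<tau> \<subseteq> \<sigma>" "\<eta> \<subseteq> \<eta>'" using sub Times_subset[OF \<eta>c(1) \<tau>(1)] c(3) by blast+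
      have "\<eta> = \<eta>'" using c(1) \<eta>c s(2) by (intro rational_fan_eq_of_dim[OF rF]) (auto simp: cones_of_dim_def)
      then show "\<zeta> \<in> (\<lambda>\<sigma>. \<eta> \<times> \<sigma>) ` ?C" using c s by blast
    qed
    show "(\<lambda>\<sigma>. \<eta> \<times> \<sigma>) ` ?C \<subseteq> {\<zeta>. \<zeta> \<in> top_cones P \<and> \<eta> \<times> \<tau> \<subseteq> \<zeta>}" using top_P \<eta> by blast
  qed
  have inj: "inj_on (\<lambda>\<sigma>. \<eta> \<times> \<sigma>) ?C" using Times_eq \<eta>c C by (intro inj_onI) blast
  have "(\<Sum>\<sigma>\<in>?C. w (\<eta> \<times> \<sigma>) *\<^sub>R normal_vector (lat P) (\<eta> \<times> \<sigma>) (\<eta> \<times> \<tau>)) \<in> span (\<eta> \<times> \<tau>)"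
    using bal unfolding balanced_at_def set sum.reindex[OF inj] by (simp add: o_def)
  moreover have "(\<Sum>\<sigma>\<in>?C. w (\<eta> \<times> \<sigma>) *\<^sub>R normal_vector (lat P) (\<eta> \<times> \<sigma>) (\<eta> \<times> \<tau>)) \<in> span (\<eta> \<times> \<tau>) \<longleftrightarrow>
      (\<Sum>\<sigma>\<in>?C. w (\<eta> \<times> \<sigma>) *\<^sub>R (0, normal_vector (lat G) \<sigma> \<tau>)) \<in> span (\<eta> \<times> \<tau>)"
  proof (rule span_sum_cong, rule normal_vector_cong)
    fix \<sigma> assume \<sigma>: "\<sigma> \<in> ?C"
    let ?n = "normal_vector (lat G) \<sigma> \<tau>"
    have n: "is_normal_vector (lat G) \<sigma> \<tau> ?n"
      by (rule rational_fan_normal_vector[OF rG C(1)[OF \<sigma>] \<tau>(1) C(2,3)[OF \<sigma>]])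
    show "is_normal_vector (lat P) (\<eta> \<times> \<sigma>) (\<eta> \<times> \<tau>) (0, ?n)"
      unfolding lat_P using zeroG[OF C(1)[OF \<sigma>]] zeroG[OF \<tau>(1)] zeroF[OF \<eta>c(1)]
      by (intro is_normal_vector_Times(2)[OF n] lattice_subgroup rational_fanD(1)[OF rF])
    fix x y assume "x \<in> \<eta> \<times> \<sigma>" "y \<in> \<eta> \<times> \<sigma>" "x + y \<in> span (\<eta> \<times> \<tau>)"
    then show "x \<in> span (\<eta> \<times> \<tau>)"
      unfolding span_P[OF \<eta>c(1) \<tau>(1)]
      using rational_fan_pointed[OF rG C(1)[OF \<sigma>] \<tau>(1) C(2)[OF \<sigma>], of "snd x" "snd y"]
      by (auto intro: span_base)
  qed
  ultimately have "(\<Sum>\<sigma>\<in>?C. w (\<eta> \<times> \<sigma>) *\<^sub>R (0::'a, normal_vector (lat G) \<sigma> \<tau>)) \<in> span \<eta> \<times> span \<tau>"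
    unfolding span_P[OF \<eta>c(1) \<tau>(1)] by simp
  then have "snd (\<Sum>\<sigma>\<in>?C. w (\<eta> \<times> \<sigma>) *\<^sub>R (0::'a, normal_vector (lat G) \<sigma> \<tau>)) \<in> span \<tau>"
    unfolding mem_Times_iff by (rule conjunct2)
  then show ?thesis unfolding balanced_at_def by (simp add: snd_sum)
qed

lemma rigid_P:
  assumes "rigid K F" "rigid K G"
  shows "rigid K P"
  unfolding rigid_def
proof (intro ballI allI impI)
  fix \<zeta> w assume "\<zeta> \<in> cones P" and w: "local_weight K P \<zeta> w"
  then obtain \<sigma>0 \<eta>0 where c0: "\<sigma>0 \<in> cones F" "\<eta>0 \<in> cones G" "\<zeta> = \<sigma>0 \<times> \<eta>0" using cones_P by blast
  have "\<exists>c\<in>K. \<forall>\<sigma>\<in>top_cones F. \<sigma>0 \<subseteq> \<sigma> \<longrightarrow> w (\<sigma> \<times> \<eta>) = c * ori F \<sigma>" if \<eta>: "\<eta> \<in> top_cones G" "\<eta>0 \<subseteq> \<eta>" for \<eta>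
  proof -
    have \<eta>c: "\<eta> \<in> cones G" "dim \<eta> = fan_dim G" using \<eta> by (auto simp: cones_of_dim_def)
    have "local_weight K F \<sigma>0 (\<lambda>\<sigma>. w (\<sigma> \<times> \<eta>))"
      unfolding local_weight_def
    proof (intro conjI ballI impI)
      fix \<sigma> assume \<sigma>: "\<sigma> \<in> top_cones F" "\<sigma>0 \<subseteq> \<sigma>"
      then have "\<sigma> \<times> \<eta> \<in> top_cones P" "\<zeta> \<subseteq> \<sigma> \<times> \<eta>" using top_P \<eta> c0 by auto
      then show "w (\<sigma> \<times> \<eta>) \<in> K" using w by (simp add: local_weight_def)
    next
      fix \<tau> assume \<tau>: "\<tau> \<in> cones F" "Suc (dim \<tau>) = fan_dim F \<and> \<sigma>0 \<subseteq> \<tau>"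
      then have "\<tau> \<times> \<eta> \<in> cones P" "\<zeta> \<subseteq> \<tau> \<times> \<eta>" "Suc (dim (\<tau> \<times> \<eta>)) = fan_dim P"
        using cones_P \<eta> \<eta>c c0 dim_P[OF \<tau>(1) \<eta>c(1)] fan_dim_P by auto
      then have "balanced_at P w (\<tau> \<times> \<eta>)" using w by (simp add: local_weight_def)
      then show "balanced_at F (\<lambda>\<sigma>. w (\<sigma> \<times> \<eta>)) \<tau>" using balanced_at_P_left \<tau> \<eta> by blast
    qed
    from rigidD[OF assms(1) c0(1) this] show ?thesis by metis
  qed
  then obtain c where c: "\<And>\<eta>. \<eta> \<in> top_cones G \<Longrightarrow> \<eta>0 \<subseteq> \<eta> \<Longrightarrow> c \<eta> \<in> K"
    "\<And>\<eta> \<sigma>. \<eta> \<in> top_cones G \<Longrightarrow> \<eta>0 \<subseteq> \<eta> \<Longrightarrow> \<sigma> \<in> top_cones F \<Longrightarrow> \<sigma>0 \<subseteq> \<sigma> \<Longrightarrow> w (\<sigma> \<times> \<eta>) = c \<eta> * ori F \<sigma>"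
    by metis
  obtain \<sigma> where \<sigma>: "\<sigma> \<in> top_cones F" "\<sigma>0 \<subseteq> \<sigma>" using tropical_fan_pure[OF F c0(1)] by blast
  have \<sigma>c: "\<sigma> \<in> cones F" "dim \<sigma> = fan_dim F" using \<sigma> by (auto simp: cones_of_dim_def)
  have "local_weight K G \<eta>0 c"
    unfolding local_weight_def
  proof (intro conjI ballI impI)
    show "c \<eta> \<in> K" if "\<eta> \<in> top_cones G" "\<eta>0 \<subseteq> \<eta>" for \<eta> using c(1) that .
    fix \<tau> assume \<tau>: "\<tau> \<in> cones G" "Suc (dim \<tau>) = fan_dim G \<and> \<eta>0 \<subseteq> \<tau>"
    then have "\<sigma> \<times> \<tau> \<in> cones P" "\<zeta> \<subseteq> \<sigma> \<times> \<tau>" "Suc (dim (\<sigma> \<times> \<tau>)) = fan_dim P"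
      using cones_P \<sigma> \<sigma>c c0 dim_P[OF \<sigma>c(1) \<tau>(1)] fan_dim_P by auto
    then have "balanced_at P w (\<sigma> \<times> \<tau>)" using w by (simp add: local_weight_def)
    then have "balanced_at G (\<lambda>\<eta>. w (\<sigma> \<times> \<eta>)) \<tau>" using balanced_at_P_right \<tau> \<sigma> by blast
    \<comment> \<open>The multiplicities are recovered from one fixed \<sigma> by division by its
      nonzero orientation. Their membership in \<open>K\<close> is already known, so the division
      only serves balancing.\<close>
    then have "balanced_at G (\<lambda>\<eta>. (1 / ori F \<sigma>) * w (\<sigma> \<times> \<eta>)) \<tau>" by (rule balanced_at_scale)
    moreover have "c \<eta> = (1 / ori F \<sigma>) * w (\<sigma> \<times> \<eta>)" if \<eta>: "\<eta> \<in> top_cones G" "\<tau> \<subseteq> \<eta>" for \<eta>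
      using c(2)[OF \<eta>(1) _ \<sigma>] \<eta>(2) \<tau>(2) tropical_fan_ori(2)[OF F \<sigma>(1)] by auto
    ultimately show "balanced_at G c \<tau>"
      using balanced_at_cong[of G \<tau> c "\<lambda>\<eta>. (1 / ori F \<sigma>) * w (\<sigma> \<times> \<eta>)"] by blast
  qed
  from rigidD[OF assms(2) c0(2) this] obtain k where
    k: "k \<in> K" "\<And>\<eta>. \<eta> \<in> top_cones G \<Longrightarrow> \<eta>0 \<subseteq> \<eta> \<Longrightarrow> c \<eta> = k * ori G \<eta>" by blast
  have "w \<xi> = k * ori P \<xi>" if \<xi>: "\<xi> \<in> top_cones P" "\<zeta> \<subseteq> \<xi>" for \<xi>
  proof -
    obtain \<sigma> \<eta> where t: "\<sigma> \<in> top_cones F" "\<eta> \<in> top_cones G" "\<xi> = \<sigma> \<times> \<eta>" using \<xi>(1) top_P by blast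
    then have "\<sigma>0 \<subseteq> \<sigma>" "\<eta>0 \<subseteq> \<eta>" using \<xi>(2) Times_subset[OF c0(1,2)] c0(3) by blast+
    then show ?thesis
      using c(2) k(2) t ori_P[of \<sigma> \<eta>] by (simp add: cones_of_dim_def)
  qed
  then show "\<exists>c\<in>K. \<forall>\<eta>\<in>top_cones P. \<zeta> \<subseteq> \<eta> \<longrightarrow> w \<eta> = c * ori P \<eta>" using k(1) by blast
qed

end

section \<open>Linear algebra of graph cones and vertical cones, and their balancing
  conditions\<close>

section \<open>Tropical modifications\<close>

locale meromorphic_fan =
  fixes F :: "('a::real_normed_vector, 'm) ofan_scheme" and f :: "'a \<Rightarrow> real"
  assumes F: "tropical_fan F" and f: "meromorphic F f"
begin

lemmas rF = tropical_fan_rational[OF F]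

abbreviation T :: "('a \<times> real) ofan" where "T \<equiv> tropical_modification F f"

abbreviation \<Delta> :: "'a set set" where "\<Delta> \<equiv> cones (div_fan F f)"

text \<open>The graph of \<open>f\<close> over \<sigma>, continued linearly to the whole space when
  \<sigma> is a cone of \<open>F\<close>, so that spans and normal vectors can be moved by one
  linear map.\<close>

abbreviation lift :: "'a set \<Rightarrow> 'a \<Rightarrow> 'a \<times> real" where "lift \<sigma> \<equiv> (\<lambda>x. (x, cone_form f \<sigma> x))"

lemma zero: "\<sigma> \<in> cones F \<Longrightarrow> 0 \<in> \<sigma>"
  by (rule rational_fan_cone(4)[OF rF])

lemma cone_form:
  assumes "\<sigma> \<in> cones F"
  shows "linear (cone_form f \<sigma>)" "\<And>x. x \<in> \<sigma> \<Longrightarrow> cone_form f \<sigma> x = f x"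
proof -
  have "\<exists>l. linear l \<and> (\<forall>x\<in>\<sigma>. l x = f x)" using f assms unfolding meromorphic_def by blast
  then have "linear (cone_form f \<sigma>) \<and> (\<forall>x\<in>\<sigma>. cone_form f \<sigma> x = f x)"
    unfolding cone_form_def by (rule someI_ex)
  then show "linear (cone_form f \<sigma>)" "\<And>x. x \<in> \<sigma> \<Longrightarrow> cone_form f \<sigma> x = f x" by blast+
qed

lemma cone_form_unique:
  assumes "\<sigma> \<in> cones F" "linear l" "\<And>x. x \<in> \<sigma> \<Longrightarrow> l x = f x" "x \<in> span \<sigma>"
  shows "cone_form f \<sigma> x = l x"
  by (rule linear_eq_on_span[OF cone_form(1)[OF assms(1)] assms(2) _ assms(4)])
    (use cone_form(2)[OF assms(1)] assms(3) in simp)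

text \<open>The form selected by \<open>cone_form\<close> need not be the integral one that
  \<open>meromorphic\<close> provides, but the two agree on \<open>span \<sigma>\<close>.\<close>

lemma cone_form_Ints:
  assumes "\<sigma> \<in> cones F" "x \<in> sublat (lat F) \<sigma>"
  shows "cone_form f \<sigma> x \<in> \<int>"
proof -
  obtain l where l: "linear l" "l ` sublat (lat F) \<sigma> \<subseteq> \<int>" "\<forall>x\<in>\<sigma>. l x = f x"
    using f assms(1) unfolding meromorphic_def by blast
  then have "cone_form f \<sigma> x = l x" using assms by (intro cone_form_unique) (auto simp: sublat_def)
  then show ?thesis using l(2) assms(2) by auto
qed

lemma f_0: "f 0 = 0"
proof -
  obtain \<sigma> where "\<sigma> \<in> cones F" using rational_fanD(3)[OF rF] by blast
  then show ?thesis using cone_form(2)[of \<sigma> 0] linear_0[OF cone_form(1)] zero by metis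
qed

lemma linear_lift: "\<sigma> \<in> cones F \<Longrightarrow> linear (lift \<sigma>)"
  using cone_form(1) by (auto intro!: linearI simp: linear_add linear_scale)

lemma graph_cone_eq: "\<sigma> \<in> cones F \<Longrightarrow> graph_cone f \<sigma> = lift \<sigma> ` \<sigma>"
  using cone_form(2) by (auto simp: graph_cone_def)

text \<open>The form of the larger cone also describes the graph over a face, so a cone and its wall
  are lifted together.\<close>

lemma graph_cone_face_eq:
  assumes "\<sigma> \<in> cones F" "\<tau> \<subseteq> \<sigma>"
  shows "graph_cone f \<tau> = lift \<sigma> ` \<tau>"
proof -
  have "graph_cone f \<tau> = (\<lambda>x. (x, f x)) ` \<tau>" by (auto simp: graph_cone_def)
  also have "\<dots> = lift \<sigma> ` \<tau>" using cone_form(2)[OF assms(1)] assms(2) by (intro image_cong) auto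
  finally show ?thesis .
qed

lemma span_graph_cone: "\<sigma> \<in> cones F \<Longrightarrow> span (graph_cone f \<sigma>) = lift \<sigma> ` span \<sigma>"
  by (simp add: graph_cone_eq linear_span_image[OF linear_lift])

lemma fst_graph_cone: "fst ` graph_cone f \<sigma> = \<sigma>"
  by (force simp: graph_cone_def)

lemma fst_up_cone: "fst ` up_cone f \<sigma> = \<sigma>"
  by (force simp: up_cone_def)

lemma inj_on_graph: "inj_on (graph_cone f) A"
  by (rule inj_on_inverseI[where g = "image fst"]) (rule fst_graph_cone)

lemma inj_on_up: "inj_on (up_cone f) A"
  by (rule inj_on_inverseI[where g = "image fst"]) (rule fst_up_cone)

lemma graph_subset: "graph_cone f \<tau> \<subseteq> graph_cone f \<sigma> \<longleftrightarrow> \<tau> \<subseteq> \<sigma>"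
  by (auto simp: graph_cone_def)

lemma graph_subset_up: "graph_cone f \<tau> \<subseteq> up_cone f \<delta> \<longleftrightarrow> \<tau> \<subseteq> \<delta>"
proof
  assume "graph_cone f \<tau> \<subseteq> up_cone f \<delta>"
  then have "fst ` graph_cone f \<tau> \<subseteq> fst ` up_cone f \<delta>" by (rule image_mono)
  then show "\<tau> \<subseteq> \<delta>" unfolding fst_graph_cone fst_up_cone .
next
  assume "\<tau> \<subseteq> \<delta>"
  then show "graph_cone f \<tau> \<subseteq> up_cone f \<delta>"
    unfolding graph_cone_def up_cone_def by (auto intro!: exI[of _ "0::real"])
qed

lemma up_subset: "up_cone f \<tau> \<subseteq> up_cone f \<delta> \<longleftrightarrow> \<tau> \<subseteq> \<delta>"
proof
  assume "up_cone f \<tau> \<subseteq> up_cone f \<delta>"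
  then have "fst ` up_cone f \<tau> \<subseteq> fst ` up_cone f \<delta>" by (rule image_mono)
  then show "\<tau> \<subseteq> \<delta>" unfolding fst_up_cone .
qed (auto simp: up_cone_def)

text \<open>Over 0 a graph has a single point, while the vertical cone contains a ray.\<close>

lemma up_not_subset_graph: "\<delta> \<in> cones F \<Longrightarrow> \<not> up_cone f \<delta> \<subseteq> graph_cone f \<sigma>"
proof
  assume "\<delta> \<in> cones F" "up_cone f \<delta> \<subseteq> graph_cone f \<sigma>"
  moreover have "(0, f 0 + 1) \<in> up_cone f \<delta>"
    unfolding up_cone_def using zero[OF \<open>\<delta> \<in> cones F\<close>] by (intro CollectI exI[of _ 0] exI[of _ 1]) simp
  ultimately have "(0, f 0 + 1) \<in> graph_cone f \<sigma>" by blast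
  then show False by (simp add: graph_cone_def)
qed

text \<open>The vertical ray frees the last coordinate, so the slope of \<open>f\<close> disappears
  from the span. Modulo a vertical wall, last components of normal vectors can be ignored.\<close>

lemma span_up_cone:
  assumes "\<delta> \<in> cones F"
  shows "span (up_cone f \<delta>) = span \<delta> \<times> UNIV"
proof
  show "span (up_cone f \<delta>) \<subseteq> span \<delta> \<times> UNIV"
    by (intro span_minimal subspace_Times) (auto simp: up_cone_def span_base)
  show "span \<delta> \<times> UNIV \<subseteq> span (up_cone f \<delta>)"
  proof clarify
    fix x and r :: real assume x: "x \<in> span \<delta>"
    have "(x, cone_form f \<delta> x) \<in> span (graph_cone f \<delta>)" using x span_graph_cone[OF assms] by blast
    then have 1: "(x, cone_form f \<delta> x) \<in> span (up_cone f \<delta>)"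
      using span_mono[of "graph_cone f \<delta>" "up_cone f \<delta>"] graph_subset_up by blast
    have "(0, 1) \<in> up_cone f \<delta>"
      unfolding up_cone_def using zero[OF assms] f_0 by (intro CollectI exI[of _ 0] exI[of _ 1]) simp
    then have "(r - cone_form f \<delta> x) *\<^sub>R (0, 1) \<in> span (up_cone f \<delta>)" by (intro span_scale span_base)
    from span_add[OF 1 this] show "(x, r) \<in> span (up_cone f \<delta>)" by simp
  qed
qed

lemma dim_graph_cone: "\<sigma> \<in> cones F \<Longrightarrow> dim (graph_cone f \<sigma>) = dim \<sigma>"
  unfolding graph_cone_eq
  by (rule dim_image_inj_on[OF rational_fan_cone(2)[OF rF] linear_lift]) (auto intro: inj_onI)

lemma dim_up_cone:
  assumes "\<delta> \<in> cones F"
  shows "dim (up_cone f \<delta>) = Suc (dim \<delta>)"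
proof -
  have fin: "fin_dim (UNIV :: real set)"
    unfolding fin_dim_def by (intro exI[of _ Basis] conjI finite_Basis) (simp only: span_Basis order_refl)
  have "dim (up_cone f \<delta>) = dim (\<delta> \<times> (UNIV :: real set))"
    by (rule span_eq_dim) (simp add: span_up_cone[OF assms] span_Times zero[OF assms])
  also have "\<dots> = dim \<delta> + dim (UNIV :: real set)"
    by (rule dim_Times_fin[OF rational_fan_cone(2)[OF rF assms] fin zero[OF assms]]) simp
  finally show ?thesis by simp
qed

text \<open>In a fan a cone contained in another is a face of it, so the divisor can be handled by
  inclusions alone.\<close>

lemma \<Delta>_cones: "\<delta> \<in> \<Delta> \<longleftrightarrow> \<delta> \<in> cones F \<and> (\<exists>\<tau>\<in>div_support F f. \<delta> \<subseteq> \<tau>)"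
proof
  assume "\<delta> \<in> \<Delta>"
  then obtain \<tau> where \<tau>: "\<delta> \<noteq> {}" "\<tau> \<in> div_support F f" "\<delta> face_of \<tau>" by (auto simp: div_fan_def)
  then have "\<tau> \<in> cones F" by (simp add: div_support_def)
  then show "\<delta> \<in> cones F \<and> (\<exists>\<tau>\<in>div_support F f. \<delta> \<subseteq> \<tau>)"
    using rational_fanD(6)[OF rF] \<tau> face_of_imp_subset by blast
next
  assume "\<delta> \<in> cones F \<and> (\<exists>\<tau>\<in>div_support F f. \<delta> \<subseteq> \<tau>)"
  then obtain \<tau> where \<tau>: "\<delta> \<in> cones F" "\<tau> \<in> div_support F f" "\<delta> \<subseteq> \<tau>" by blast
  then have "\<tau> \<in> cones F" by (simp add: div_support_def)
  then have "\<delta> face_of \<tau>" using rational_fan_subset_face[OF rF] \<tau> by blast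
  then show "\<delta> \<in> \<Delta>" using zero[OF \<tau>(1)] \<tau>(2) by (auto simp: div_fan_def)
qed

lemma div_support_\<Delta>: "\<delta> \<in> div_support F f \<longleftrightarrow> \<delta> \<in> \<Delta> \<and> Suc (dim \<delta>) = fan_dim F"
proof
  assume "\<delta> \<in> div_support F f"
  then show "\<delta> \<in> \<Delta> \<and> Suc (dim \<delta>) = fan_dim F" unfolding \<Delta>_cones by (auto simp: div_support_def)
next
  assume \<delta>: "\<delta> \<in> \<Delta> \<and> Suc (dim \<delta>) = fan_dim F"
  then obtain \<tau> where \<tau>: "\<delta> \<in> cones F" "\<tau> \<in> div_support F f" "\<delta> \<subseteq> \<tau>" unfolding \<Delta>_cones by blast
  then have "\<tau> \<in> cones F" "Suc (dim \<tau>) = fan_dim F" by (auto simp: div_support_def)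
  then have "\<delta> = \<tau>" using \<delta> \<tau> by (intro rational_fan_eq_of_dim[OF rF]) auto
  then show "\<delta> \<in> div_support F f" using \<tau> by simp
qed

lemma dim_\<Delta>: "\<delta> \<in> \<Delta> \<Longrightarrow> Suc (dim \<delta>) \<le> fan_dim F"
proof -
  assume "\<delta> \<in> \<Delta>"
  then obtain \<tau> where \<tau>: "\<delta> \<in> cones F" "\<tau> \<in> div_support F f" "\<delta> \<subseteq> \<tau>" unfolding \<Delta>_cones by blast
  then have "\<tau> \<in> cones F" "Suc (dim \<tau>) = fan_dim F" by (auto simp: div_support_def)
  then show ?thesis using rational_fan_dim_mono[OF rF, of \<tau> \<delta>] subset_trans[OF \<tau>(3) span_superset] by simp
qed

lemma lat_T: "lat T = lat F \<times> \<int>"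
  by (simp add: tropical_modification_def)

lemma cones_T: "\<zeta> \<in> cones T \<longleftrightarrow> (\<exists>\<sigma>\<in>cones F. \<zeta> = graph_cone f \<sigma>) \<or> (\<exists>\<delta>\<in>\<Delta>. \<zeta> = up_cone f \<delta>)"
  by (auto simp: tropical_modification_def)

lemma fan_dim_T: "fan_dim T = fan_dim F"
proof -
  obtain \<sigma> where "\<sigma> \<in> top_cones F" using tropical_fan_top[OF F] by blast
  then have \<sigma>: "\<sigma> \<in> cones F" "dim \<sigma> = fan_dim F" by (auto simp: cones_of_dim_def)
  show ?thesis
  proof (rule fan_dim_eqI)
    have "finite \<Delta>" using finite_subset[OF _ rational_fanD(2)[OF rF], of \<Delta>] \<Delta>_cones by blast
    then show "finite (cones T)" using rational_fanD(2)[OF rF] by (simp add: tropical_modification_def)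
    show "graph_cone f \<sigma> \<in> cones T" using \<sigma> cones_T by blast
    show "dim (graph_cone f \<sigma>) = fan_dim F" using dim_graph_cone \<sigma> by simp
    fix \<zeta> assume "\<zeta> \<in> cones T"
    then consider \<sigma> where "\<sigma> \<in> cones F" "\<zeta> = graph_cone f \<sigma>" | \<delta> where "\<delta> \<in> \<Delta>" "\<zeta> = up_cone f \<delta>"
      using cones_T[of \<zeta>] by blast
    then show "dim \<zeta> \<le> fan_dim F"
    proof cases
      case 1
      then show ?thesis using dim_graph_cone rational_fan_dim_le[OF rF] by simp
    next
      case 2
      then have "\<delta> \<in> cones F" using \<Delta>_cones by blast
      then show ?thesis using dim_up_cone 2 dim_\<Delta> by simp
    qed
  qed
qed

lemma top_T: "top_cones T = graph_cone f ` top_cones F \<union> up_cone f ` div_support F f"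
proof
  show "top_cones T \<subseteq> graph_cone f ` top_cones F \<union> up_cone f ` div_support F f"
  proof
    fix \<zeta> assume "\<zeta> \<in> top_cones T"
    then have \<zeta>: "\<zeta> \<in> cones T" "dim \<zeta> = fan_dim F" using fan_dim_T by (auto simp: cones_of_dim_def)
    then consider \<sigma> where "\<sigma> \<in> cones F" "\<zeta> = graph_cone f \<sigma>" | \<delta> where "\<delta> \<in> \<Delta>" "\<zeta> = up_cone f \<delta>"
      using cones_T[of \<zeta>] by blast
    then show "\<zeta> \<in> graph_cone f ` top_cones F \<union> up_cone f ` div_support F f"
    proof cases
      case 1
      then show ?thesis using dim_graph_cone \<zeta> by (auto simp: cones_of_dim_def)
    next
      case 2
      then have "\<delta> \<in> cones F" using \<Delta>_cones by blast
      then have "\<delta> \<in> div_support F f" using div_support_\<Delta> dim_up_cone \<zeta>(2) 2 by simp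
      then show ?thesis using 2 by blast
    qed
  qed
  show "graph_cone f ` top_cones F \<union> up_cone f ` div_support F f \<subseteq> top_cones T"
  proof
    fix \<zeta> assume "\<zeta> \<in> graph_cone f ` top_cones F \<union> up_cone f ` div_support F f"
    then consider \<sigma> where "\<sigma> \<in> top_cones F" "\<zeta> = graph_cone f \<sigma>" | \<tau> where "\<tau> \<in> div_support F f" "\<zeta> = up_cone f \<tau>"
      by blast
    then have "\<zeta> \<in> cones T \<and> dim \<zeta> = fan_dim F"
    proof cases
      case 1
      then show ?thesis using dim_graph_cone cones_T[of \<zeta>] by (auto simp: cones_of_dim_def)
    next
      case 2
      have \<tau>: "\<tau> \<in> \<Delta>" "Suc (dim \<tau>) = fan_dim F" using 2(1) div_support_\<Delta>[of \<tau>] by blast+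
      moreover have "\<tau> \<in> cones F" using \<tau>(1) \<Delta>_cones[of \<tau>] by blast
      ultimately show ?thesis using 2(2) dim_up_cone[of \<tau>] cones_T[of \<zeta>] by auto
    qed
    then show "\<zeta> \<in> top_cones T" using fan_dim_T by (simp add: cones_of_dim_def)
  qed
qed

lemma ori_T_graph: "\<sigma> \<in> cones F \<Longrightarrow> ori T (graph_cone f \<sigma>) = ori F \<sigma>"
  by (simp add: tropical_modification_def fst_graph_cone)

lemma ori_T_up: "\<delta> \<in> cones F \<Longrightarrow> ori T (up_cone f \<delta>) = ord_along F f \<delta>"
  using up_not_subset_graph[of \<delta>] by (auto simp: tropical_modification_def fst_up_cone)

lemma subgroup: "additive_subgroup (lat F)"
  by (rule lattice_subgroup[OF rational_fanD(1)[OF rF]])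

lemma spanned_div: "lattice_spanned (div_fan F f)"
proof -
  have "lat (div_fan F f) = lat F" by (simp add: div_fan_def)
  moreover have "fin_dim \<delta> \<and> \<delta> \<subseteq> span (lat F \<inter> \<delta>)" if "\<delta> \<in> \<Delta>" for \<delta>
  proof -
    have "\<delta> \<in> cones F" using that \<Delta>_cones by blast
    then show ?thesis using rational_fan_lattice_spanned[OF rF] unfolding lattice_spanned_def by blast
  qed
  ultimately show ?thesis using subgroup unfolding lattice_spanned_def by simp
qed

text \<open>Integrality of \<open>f\<close> lifts lattice points to lattice points of the graph; a
  vertical cone contains the lattice vector \<open>(0, 1)\<close> in addition.\<close>

lemma spanned_T: "lattice_spanned T"
  unfolding lattice_spanned_def
proof (intro conjI ballI)
  show "additive_subgroup (lat T)"
    unfolding lat_T by (intro additive_subgroup_Times subgroup additive_subgroup_Ints)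
  have g: "graph_cone f \<sigma> \<subseteq> span (lat T \<inter> graph_cone f \<sigma>)" if \<sigma>: "\<sigma> \<in> cones F" for \<sigma>
  proof -
    have "lift \<sigma> ` (lat F \<inter> \<sigma>) \<subseteq> lat T \<inter> graph_cone f \<sigma>"
      unfolding lat_T graph_cone_eq[OF \<sigma>] using cone_form_Ints[OF \<sigma>] by (auto simp: sublat_def span_base)
    then have "span (lift \<sigma> ` (lat F \<inter> \<sigma>)) \<subseteq> span (lat T \<inter> graph_cone f \<sigma>)" by (rule span_mono)
    moreover have "lift \<sigma> ` \<sigma> \<subseteq> span (lift \<sigma> ` (lat F \<inter> \<sigma>))"
      unfolding linear_span_image[OF linear_lift[OF \<sigma>]]
      using rational_fan_lattice_spanned[OF rF] \<sigma> unfolding lattice_spanned_def by (intro image_mono) blast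
    ultimately show ?thesis using graph_cone_eq[OF \<sigma>] by blast
  qed
  fix \<zeta> assume "\<zeta> \<in> cones T"
  then consider \<sigma> where "\<sigma> \<in> cones F" "\<zeta> = graph_cone f \<sigma>" | \<delta> where "\<delta> \<in> cones F" "\<zeta> = up_cone f \<delta>"
    using cones_T[of \<zeta>] \<Delta>_cones by blast
  then have "fin_dim \<zeta> \<and> \<zeta> \<subseteq> span (lat T \<inter> \<zeta>)"
  proof cases
    case 1
    then show ?thesis
      using g fin_dim_image[OF rational_fan_cone(2)[OF rF] linear_lift] graph_cone_eq by auto
  next
    case 2
    have fin: "fin_dim (UNIV :: real set)"
      unfolding fin_dim_def by (intro exI[of _ Basis] conjI finite_Basis) (simp only: span_Basis order_refl)
    have "fin_dim (\<delta> \<times> (UNIV :: real set))"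
      by (rule fin_dim_Times[OF rational_fan_cone(2)[OF rF 2(1)] fin])
    moreover have "up_cone f \<delta> \<subseteq> span (\<delta> \<times> (UNIV :: real set))"
      by (auto simp: up_cone_def intro: span_base)
    ultimately have fd: "fin_dim \<zeta>" using fin_dim_mono 2(2) by blast
    have sub: "graph_cone f \<delta> \<subseteq> up_cone f \<delta>" using graph_subset_up by blast
    have "(0, 1) \<in> lat T \<inter> \<zeta>"
      unfolding lat_T 2(2) up_cone_def using zero[OF 2(1)] f_0 additive_subgroup_0[OF subgroup]
      by (auto intro!: exI[of _ 0] exI[of _ 1])
    then have 1: "(0, t) \<in> span (lat T \<inter> \<zeta>)" for t :: real
      using span_scale[OF span_base, of "(0, 1)" "lat T \<inter> \<zeta>" t] by simp
    have "span (lat T \<inter> graph_cone f \<delta>) \<subseteq> span (lat T \<inter> \<zeta>)"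
      using sub 2(2) by (intro span_mono) auto
    then have 2: "(x, f x) \<in> span (lat T \<inter> \<zeta>)" if "x \<in> \<delta>" for x
      using g[OF 2(1)] that unfolding graph_cone_def by blast
    have "(x, f x + t) \<in> span (lat T \<inter> \<zeta>)" if "x \<in> \<delta>" for x t
      using span_add[OF 2[OF that] 1[of t]] by simp
    then have "\<zeta> \<subseteq> span (lat T \<inter> \<zeta>)" unfolding \<open>\<zeta> = up_cone f \<delta>\<close> by (subst (1) up_cone_def) auto
    then show ?thesis using fd by blast
  qed
  then show "fin_dim \<zeta>" "\<zeta> \<subseteq> span (lat T \<inter> \<zeta>)" by blast+
qed

lemma sublat_lift:
  assumes "\<sigma> \<in> cones F" "\<tau> \<in> cones F" "\<tau> \<subseteq> \<sigma>"
  shows "sublat (lat T) (lift \<sigma> ` \<tau>) = lift \<sigma> ` sublat (lat F) \<tau>"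
proof
  have s: "sublat (lat F) \<tau> \<subseteq> sublat (lat F) \<sigma>" using span_mono[OF assms(3)] by (auto simp: sublat_def)
  show "sublat (lat T) (lift \<sigma> ` \<tau>) \<subseteq> lift \<sigma> ` sublat (lat F) \<tau>"
    unfolding sublat_def lat_T linear_span_image[OF linear_lift[OF assms(1)]] by auto
  show "lift \<sigma> ` sublat (lat F) \<tau> \<subseteq> sublat (lat T) (lift \<sigma> ` \<tau>)"
    using s cone_form_Ints[OF assms(1)]
    unfolding sublat_def lat_T linear_span_image[OF linear_lift[OF assms(1)]] by auto
qed

lemma sublat_up:
  "\<delta> \<in> cones F \<Longrightarrow> sublat (lat T) (up_cone f \<delta>) = sublat (lat F) \<delta> \<times> \<int>"
  unfolding sublat_def lat_T span_up_cone by auto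

lemma normal_vector_graph:
  assumes "\<sigma> \<in> cones F" "\<tau> \<in> cones F" "\<tau> \<subseteq> \<sigma>" "Suc (dim \<tau>) = dim \<sigma>"
  shows "normal_vector (lat T) (graph_cone f \<sigma>) (graph_cone f \<tau>) - lift \<sigma> (normal_vector (lat F) \<sigma> \<tau>)
    \<in> span (graph_cone f \<tau>)"
  unfolding graph_cone_eq[OF assms(1)] graph_cone_face_eq[OF assms(1,3)]
proof (rule normal_vector_cong)
  note n = rational_fan_normal_vector[OF rF assms]
  show "is_normal_vector (lat T) (lift \<sigma> ` \<sigma>) (lift \<sigma> ` \<tau>) (lift \<sigma> (normal_vector (lat F) \<sigma> \<tau>))"
    by (rule normal_vector_image[OF linear_lift[OF assms(1)] n sublat_lift[OF assms(1,1) order_refl] sublat_lift[OF assms(1-3)]])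
      (auto simp: linear_span_image[OF linear_lift[OF assms(1)]])
  fix x y assume xy: "x \<in> lift \<sigma> ` \<sigma>" "y \<in> lift \<sigma> ` \<sigma>" "x + y \<in> span (lift \<sigma> ` \<tau>)"
  then obtain a b where ab: "a \<in> \<sigma>" "b \<in> \<sigma>" "x = lift \<sigma> a" "y = lift \<sigma> b" by blast
  have "a + b \<in> span \<tau>" using xy(3) ab(3,4) by (auto simp: linear_span_image[OF linear_lift[OF assms(1)]])
  then have "a \<in> span \<tau>" using rational_fan_pointed[OF rF assms(1-3)] ab by blast
  then show "x \<in> span (lift \<sigma> ` \<tau>)" using ab(3) by (simp add: linear_span_image[OF linear_lift[OF assms(1)]])
qed

text \<open>By integrality of \<open>f\<close> a lattice point over \<tau> is a lifted lattice point
  plus an integer multiple of \<open>(0, 1)\<close>. Pointedness holds since \<open>f\<close> is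
  linear on \<tau>: nonnegative excesses over the graph cannot cancel.\<close>

lemma normal_vector_up_graph:
  assumes "\<tau> \<in> cones F"
  shows "normal_vector (lat T) (up_cone f \<tau>) (graph_cone f \<tau>) - (0, 1) \<in> span (graph_cone f \<tau>)"
proof (rule normal_vector_cong)
  have sl: "sublat (lat T) (graph_cone f \<tau>) = lift \<tau> ` sublat (lat F) \<tau>"
    unfolding graph_cone_eq[OF assms] by (rule sublat_lift[OF assms assms order_refl])
  have z: "0 \<in> sublat (lat F) \<tau>" by (intro additive_subgroup_0 additive_subgroup_sublat subgroup)
  have l0: "cone_form f \<tau> 0 = 0" by (rule linear_0[OF cone_form(1)[OF assms]])
  show "is_normal_vector (lat T) (up_cone f \<tau>) (graph_cone f \<tau>) (0, 1)"
    unfolding is_normal_vector_def sl sublat_up[OF assms] span_graph_cone[OF assms]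
  proof (intro conjI)
    show "(0, 1) \<in> sublat (lat F) \<tau> \<times> (\<int> :: real set)" using z by simp
    have "(0, 1) \<in> up_cone f \<tau>"
      unfolding up_cone_def using zero[OF assms] f_0 by (intro CollectI exI[of _ 0] exI[of _ 1]) simp
    moreover have "(0, 1) \<notin> lift \<tau> ` span \<tau>" using l0 by auto
    moreover have "(0, 1) - (0, 1) \<in> lift \<tau> ` span \<tau>" using l0 span_0[of \<tau>] by (auto simp: zero_prod_def image_iff)
    ultimately show "\<exists>x\<in>up_cone f \<tau> - lift \<tau> ` span \<tau>. (0, 1) - x \<in> lift \<tau> ` span \<tau>" by blast
    show "{x + of_int k *\<^sub>R (0, 1) | x (k::int). x \<in> lift \<tau> ` sublat (lat F) \<tau>} = sublat (lat F) \<tau> \<times> \<int>" (is "?A = ?B")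
    proof
      show "?A \<subseteq> ?B" using cone_form_Ints[OF assms] by auto
      show "?B \<subseteq> ?A"
      proof clarify
        fix x and r :: real assume x: "x \<in> sublat (lat F) \<tau>" "r \<in> \<int>"
        then have "r - cone_form f \<tau> x \<in> \<int>" using cone_form_Ints[OF assms] by auto
        then obtain k :: int where "r - cone_form f \<tau> x = of_int k" by (auto elim: Ints_cases)
        then have "(x, r) = lift \<tau> x + of_int k *\<^sub>R (0, 1)" by simp
        then show "\<exists>y k. (x, r) = y + of_int k *\<^sub>R (0, 1) \<and> y \<in> lift \<tau> ` sublat (lat F) \<tau>" using x(1) by blast
      qed
    qed
  qed
  fix x y assume xy: "x \<in> up_cone f \<tau>" "y \<in> up_cone f \<tau>" "x + y \<in> span (graph_cone f \<tau>)"
  then obtain a b s t where ab: "x = (a, f a + s)" "y = (b, f b + t)" "a \<in> \<tau>" "b \<in> \<tau>" "0 \<le> s" "0 \<le> t"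
    by (auto simp: up_cone_def)
  have "f a + s + (f b + t) = cone_form f \<tau> (a + b)"
    using xy(3) ab(1,2) unfolding span_graph_cone[OF assms] by auto
  also have "\<dots> = f a + f b" using cone_form[OF assms] ab(3,4) by (simp add: linear_add)
  finally have "s = 0" using ab by simp
  then have "x \<in> graph_cone f \<tau>" using ab by (simp add: graph_cone_def)
  then show "x \<in> span (graph_cone f \<tau>)" by (rule span_base)
qed

lemma normal_vector_up:
  assumes "\<tau> \<in> cones F" "\<alpha> \<in> cones F" "\<alpha> \<subseteq> \<tau>" "Suc (dim \<alpha>) = dim \<tau>"
  shows "normal_vector (lat T) (up_cone f \<tau>) (up_cone f \<alpha>) - (normal_vector (lat F) \<tau> \<alpha>, 0) \<in> span (up_cone f \<alpha>)"
proof (rule normal_vector_cong)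
  let ?n = "normal_vector (lat F) \<tau> \<alpha>"
  note n = rational_fan_normal_vector[OF rF assms]
  show "is_normal_vector (lat T) (up_cone f \<tau>) (up_cone f \<alpha>) (?n, 0)"
    unfolding is_normal_vector_def sublat_up[OF assms(1)] sublat_up[OF assms(2)] span_up_cone[OF assms(2)]
  proof (intro conjI)
    show "(?n, 0) \<in> sublat (lat F) \<tau> \<times> (\<int> :: real set)" using n by (simp add: is_normal_vector_def)
    obtain x where x: "x \<in> \<tau>" "x \<notin> span \<alpha>" "?n - x \<in> span \<alpha>" using n unfolding is_normal_vector_def by blast
    have "(x, f x) \<in> up_cone f \<tau>" using x(1) unfolding up_cone_def by (auto intro!: exI[of _ "0::real"])
    then show "\<exists>x\<in>up_cone f \<tau> - span \<alpha> \<times> UNIV. (?n, 0) - x \<in> span \<alpha> \<times> UNIV"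
      using x by (intro bexI[of _ "(x, f x)"]) auto
    have s: "sublat (lat F) \<tau> = {x + of_int k *\<^sub>R ?n | x (k::int). x \<in> sublat (lat F) \<alpha>}"
      using n by (simp add: is_normal_vector_def)
    show "{x + of_int k *\<^sub>R (?n, 0) | x (k::int). x \<in> sublat (lat F) \<alpha> \<times> (\<int> :: real set)} = sublat (lat F) \<tau> \<times> \<int>"
      unfolding s by force
  qed
  fix x y assume "x \<in> up_cone f \<tau>" "y \<in> up_cone f \<tau>" "x + y \<in> span (up_cone f \<alpha>)"
  then show "x \<in> span (up_cone f \<alpha>)"
    unfolding span_up_cone[OF assms(2)]
    using rational_fan_pointed[OF rF assms(1-3), of "fst x" "fst y"] by (auto simp: up_cone_def)
qed

text \<open>The first coordinate of the balancing condition at \<open>graph_cone f \<tau>\<close> is the balancing condition of \<open>F\<close>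
  at \<open>\<tau>\<close>; the second one determines the weight of the vertical cone over \<open>\<tau>\<close>.\<close>

lemma balanced_at_T_graph:
  assumes \<tau>: "\<tau> \<in> cones F" "Suc (dim \<tau>) = fan_dim F" and bal: "balanced_at T w (graph_cone f \<tau>)"
  shows "balanced_at F (\<lambda>\<sigma>. w (graph_cone f \<sigma>)) \<tau>"
    and "\<tau> \<in> div_support F f \<Longrightarrow> (\<And>\<sigma>. \<sigma> \<in> top_cones F \<Longrightarrow> \<tau> \<subseteq> \<sigma> \<Longrightarrow> w (graph_cone f \<sigma>) = c * ori F \<sigma>) \<Longrightarrow>
      w (up_cone f \<tau>) = c * ord_along F f \<tau>"
proof -
  \<comment> \<open>\<open>?U\<close> is \<open>{\<tau>}\<close> or empty, so walls with and without
    a vertical cone over them are treated together.\<close>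
  let ?C = "{\<sigma> \<in> top_cones F. \<tau> \<subseteq> \<sigma>}" and ?U = "{\<delta> \<in> div_support F f. \<delta> = \<tau>}"
  have C: "\<sigma> \<in> cones F" "\<tau> \<subseteq> \<sigma>" "Suc (dim \<tau>) = dim \<sigma>" if "\<sigma> \<in> ?C" for \<sigma>
    using that \<tau> by (auto simp: cones_of_dim_def)
  have fin: "finite ?C" "finite ?U"
    using rational_fanD(2)[OF rF] by (auto simp: cones_of_dim_def)
  have "\<tau> \<subseteq> \<delta> \<longleftrightarrow> \<delta> = \<tau>" if "\<delta> \<in> div_support F f" for \<delta>
    using rational_fan_eq_of_dim[OF rF _ \<tau>(1), of \<delta>] \<tau>(2) that by (auto simp: div_support_def)
  then have set: "{\<zeta>. \<zeta> \<in> top_cones T \<and> graph_cone f \<tau> \<subseteq> \<zeta>} = graph_cone f ` ?C \<union> up_cone f ` ?U"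
    unfolding top_T
    by (auto simp: graph_subset graph_subset_up
        intro: graph_subset[THEN iffD2, THEN subsetD] graph_subset_up[THEN iffD2, THEN subsetD])
  have disj: "graph_cone f ` ?C \<inter> up_cone f ` ?U = {}" using up_not_subset_graph[OF \<tau>(1)] by blast
  have inj: "inj_on (graph_cone f) ?C" "inj_on (up_cone f) ?U" by (rule inj_on_graph inj_on_up)+
  let ?N = "\<lambda>\<zeta>. normal_vector (lat T) \<zeta> (graph_cone f \<tau>)"
  let ?n = "\<lambda>\<sigma>. normal_vector (lat F) \<sigma> \<tau>"
  have s: "(\<Sum>\<sigma>\<in>?C. w (graph_cone f \<sigma>) *\<^sub>R ?N (graph_cone f \<sigma>)) + (\<Sum>\<delta>\<in>?U. w (up_cone f \<delta>) *\<^sub>R ?N (up_cone f \<delta>))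
      \<in> span (graph_cone f \<tau>)"
    using bal unfolding balanced_at_def set
      sum.union_disjoint[OF finite_imageI[OF fin(1)] finite_imageI[OF fin(2)] disj]
      sum.reindex[OF inj(1)] sum.reindex[OF inj(2)] o_def .
  let ?g = "\<Sum>\<sigma>\<in>?C. w (graph_cone f \<sigma>) *\<^sub>R lift \<sigma> (?n \<sigma>)" and ?u = "\<Sum>\<delta>\<in>?U. w (up_cone f \<delta>) *\<^sub>R (0::'a, 1::real)"
  have d1: "(\<Sum>\<sigma>\<in>?C. w (graph_cone f \<sigma>) *\<^sub>R ?N (graph_cone f \<sigma>)) - ?g \<in> span (graph_cone f \<tau>)"
    unfolding sum_subtractf[symmetric] scaleR_diff_right[symmetric]
    by (intro span_sum span_scale normal_vector_graph \<tau>(1)) (use C in blast)+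
  have d2: "(\<Sum>\<delta>\<in>?U. w (up_cone f \<delta>) *\<^sub>R ?N (up_cone f \<delta>)) - ?u \<in> span (graph_cone f \<tau>)"
    unfolding sum_subtractf[symmetric] scaleR_diff_right[symmetric]
    using normal_vector_up_graph[OF \<tau>(1)] by (intro span_sum span_scale) auto
  have "?g + ?u \<in> span (graph_cone f \<tau>)"
    using span_diff[OF span_diff[OF s d1] d2] by (simp add: algebra_simps)
  then obtain y where y: "y \<in> span \<tau>" "?g + ?u = (y, cone_form f \<tau> y)"
    unfolding span_graph_cone[OF \<tau>(1)] by blast
  have y1: "y = (\<Sum>\<sigma>\<in>?C. w (graph_cone f \<sigma>) *\<^sub>R ?n \<sigma>)"
    using arg_cong[OF y(2), of fst] by (simp add: fst_sum)
  have y2: "cone_form f \<tau> y = (\<Sum>\<sigma>\<in>?C. w (graph_cone f \<sigma>) * cone_form f \<sigma> (?n \<sigma>)) + (\<Sum>\<delta>\<in>?U. w (up_cone f \<delta>))"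
    using arg_cong[OF y(2), of snd] by (simp add: snd_sum)
  show "balanced_at F (\<lambda>\<sigma>. w (graph_cone f \<sigma>)) \<tau>" using y(1) y1 by (simp add: balanced_at_def)
  assume u: "\<tau> \<in> div_support F f" and c: "\<And>\<sigma>. \<sigma> \<in> top_cones F \<Longrightarrow> \<tau> \<subseteq> \<sigma> \<Longrightarrow> w (graph_cone f \<sigma>) = c * ori F \<sigma>"
  have U: "?U = {\<tau>}" using u by blast
  have e1: "(\<Sum>\<sigma>\<in>?C. w (graph_cone f \<sigma>) *\<^sub>R ?n \<sigma>) = c *\<^sub>R (\<Sum>\<sigma>\<in>?C. ori F \<sigma> *\<^sub>R ?n \<sigma>)"
    unfolding scaleR_sum_right by (intro sum.cong) (use c in auto)
  have e2: "(\<Sum>\<sigma>\<in>?C. w (graph_cone f \<sigma>) * cone_form f \<sigma> (?n \<sigma>)) = c * (\<Sum>\<sigma>\<in>?C. ori F \<sigma> * cone_form f \<sigma> (?n \<sigma>))"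
    unfolding sum_distrib_left by (intro sum.cong) (use c in auto)
  \<comment> \<open>The last coordinate; solved for the vertical weight it gives the two terms of
    \<open>ord_along\<close>, with their signs.\<close>
  have "c * cone_form f \<tau> (\<Sum>\<sigma>\<in>?C. ori F \<sigma> *\<^sub>R ?n \<sigma>) =
      c * (\<Sum>\<sigma>\<in>?C. ori F \<sigma> * cone_form f \<sigma> (?n \<sigma>)) + w (up_cone f \<tau>)"
    using y2 unfolding y1 e1 e2 U linear_scale[OF cone_form(1)[OF \<tau>(1)]] by simp
  then show "w (up_cone f \<tau>) = c * ord_along F f \<tau>"
    unfolding ord_along_def Let_def by (simp add: algebra_simps)
qed

text \<open>The divisor has codimension one, written with \<open>Suc\<close> to avoid subtraction.
  It must be nonempty, as otherwise \<open>fan_dim\<close> would be a maximum over no cones.\<close>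

lemma div_fan_dim:
  assumes "div_support F f \<noteq> {}"
  shows "Suc (fan_dim (div_fan F f)) = fan_dim F"
    and "top_cones (div_fan F f) = div_support F f"
proof -
  obtain \<delta> where \<delta>: "\<delta> \<in> div_support F f" using assms by blast
  then have "Suc (dim \<delta>) = fan_dim F" using div_support_\<Delta> by blast
  have "fan_dim (div_fan F f) = dim \<delta>"
  proof (rule fan_dim_eqI)
    show "finite \<Delta>" using finite_subset[OF _ rational_fanD(2)[OF rF], of \<Delta>] \<Delta>_cones by blast
    show "\<delta> \<in> \<Delta>" using \<delta> div_support_\<Delta> by blast
    show "dim \<sigma> \<le> dim \<delta>" if "\<sigma> \<in> \<Delta>" for \<sigma> using dim_\<Delta>[OF that] \<open>Suc (dim \<delta>) = fan_dim F\<close> by simp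
  qed simp
  then show *: "Suc (fan_dim (div_fan F f)) = fan_dim F" using \<open>Suc (dim \<delta>) = fan_dim F\<close> by simp
  show "top_cones (div_fan F f) = div_support F f"
    unfolding cones_of_dim_def set_eq_iff mem_Collect_eq div_support_\<Delta> *[symmetric] by simp
qed

text \<open>No graph cone contains a vertical one, so only the vertical cones over top cones of the
  divisor meet at such a wall. The first projection discards the free vertical direction.\<close>

lemma balanced_at_T_up:
  assumes ne: "div_support F f \<noteq> {}" and \<alpha>: "\<alpha> \<in> \<Delta>" "Suc (dim \<alpha>) = fan_dim (div_fan F f)"
    and bal: "balanced_at T w (up_cone f \<alpha>)"
  shows "balanced_at (div_fan F f) (\<lambda>\<tau>. w (up_cone f \<tau>)) \<alpha>"
proof -
  have \<alpha>c: "\<alpha> \<in> cones F" using \<alpha>(1) \<Delta>_cones by blast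
  let ?U = "{\<tau> \<in> div_support F f. \<alpha> \<subseteq> \<tau>}"
  have U: "\<tau> \<in> cones F" "\<alpha> \<subseteq> \<tau>" "Suc (dim \<alpha>) = dim \<tau>" if "\<tau> \<in> ?U" for \<tau>
    using that \<alpha>(2) div_fan_dim(1)[OF ne] by (auto simp: div_support_def)
  have set: "{\<zeta>. \<zeta> \<in> top_cones T \<and> up_cone f \<alpha> \<subseteq> \<zeta>} = up_cone f ` ?U"
    unfolding top_T
    by (auto simp: up_subset up_not_subset_graph[OF \<alpha>c] intro: up_subset[THEN iffD2, THEN subsetD])
  have inj: "inj_on (up_cone f) ?U" by (rule inj_on_up)
  let ?N = "\<lambda>\<zeta>. normal_vector (lat T) \<zeta> (up_cone f \<alpha>)"
  let ?n = "\<lambda>\<sigma>. normal_vector (lat F) \<sigma> \<alpha>"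
  have s: "(\<Sum>\<tau>\<in>?U. w (up_cone f \<tau>) *\<^sub>R ?N (up_cone f \<tau>)) \<in> span (up_cone f \<alpha>)"
    using bal unfolding balanced_at_def set sum.reindex[OF inj] by (simp add: o_def)
  have "(\<Sum>\<tau>\<in>?U. w (up_cone f \<tau>) *\<^sub>R ?N (up_cone f \<tau>)) \<in> span (up_cone f \<alpha>) \<longleftrightarrow>
      (\<Sum>\<tau>\<in>?U. w (up_cone f \<tau>) *\<^sub>R (?n \<tau>, 0::real)) \<in> span (up_cone f \<alpha>)"
    by (rule span_sum_cong, rule normal_vector_up) (use U \<alpha>c in blast)+
  then have "(\<Sum>\<tau>\<in>?U. w (up_cone f \<tau>) *\<^sub>R (?n \<tau>, 0::real)) \<in> span \<alpha> \<times> UNIV"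
    using s unfolding span_up_cone[OF \<alpha>c] by simp
  then have "fst (\<Sum>\<tau>\<in>?U. w (up_cone f \<tau>) *\<^sub>R (?n \<tau>, 0::real)) \<in> span \<alpha>"
    unfolding mem_Times_iff by (rule conjunct1)
  moreover have "lat (div_fan F f) = lat F" by (simp add: div_fan_def)
  ultimately show ?thesis unfolding balanced_at_def div_fan_dim(2)[OF ne] by (simp add: fst_sum)
qed

text \<open>A trivial divisor contributes no vertical cones and has no meaningful fan data, hence
  the conditional form of \<open>D\<close>.\<close>

lemma rigid_T:
  assumes R: "rigid K F" and D: "div_support F f \<noteq> {} \<Longrightarrow> rigid K (div_fan F f)"
  shows "rigid K T"
  unfolding rigid_def
proof (intro ballI allI impI)
  fix \<zeta> w assume "\<zeta> \<in> cones T" and w: "local_weight K T \<zeta> w"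
  have val: "w \<xi> \<in> K" if "\<xi> \<in> top_cones T" "\<zeta> \<subseteq> \<xi>" for \<xi> using w that by (simp add: local_weight_def)
  have bal: "balanced_at T w \<xi>" if "\<xi> \<in> cones T" "Suc (dim \<xi>) = fan_dim F" "\<zeta> \<subseteq> \<xi>" for \<xi>
    using w that fan_dim_T by (simp add: local_weight_def)
  from \<open>\<zeta> \<in> cones T\<close> consider \<sigma> where "\<sigma> \<in> cones F" "\<zeta> = graph_cone f \<sigma>" | \<delta> where "\<delta> \<in> \<Delta>" "\<zeta> = up_cone f \<delta>"
    using cones_T[of \<zeta>] by blast
  then show "\<exists>c\<in>K. \<forall>\<eta>\<in>top_cones T. \<zeta> \<subseteq> \<eta> \<longrightarrow> w \<eta> = c * ori T \<eta>"
  proof cases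
    case (1 \<sigma>0)
    have bg: "balanced_at T w (graph_cone f \<tau>)" if "\<tau> \<in> cones F" "Suc (dim \<tau>) = fan_dim F" "\<sigma>0 \<subseteq> \<tau>" for \<tau>
      using that cones_T dim_graph_cone graph_subset 1(2) by (intro bal) auto
    have "local_weight K F \<sigma>0 (\<lambda>\<sigma>. w (graph_cone f \<sigma>))"
      unfolding local_weight_def
    proof (intro conjI ballI impI)
      fix \<sigma> assume "\<sigma> \<in> top_cones F" "\<sigma>0 \<subseteq> \<sigma>"
      then show "w (graph_cone f \<sigma>) \<in> K" using top_T graph_subset 1(2) by (intro val) auto
    next
      fix \<tau> assume "\<tau> \<in> cones F" "Suc (dim \<tau>) = fan_dim F \<and> \<sigma>0 \<subseteq> \<tau>"
      then show "balanced_at F (\<lambda>\<sigma>. w (graph_cone f \<sigma>)) \<tau>" using balanced_at_T_graph(1) bg by blast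
    qed
    from rigidD[OF R 1(1) this] obtain c where
      c: "c \<in> K" "\<And>\<sigma>. \<sigma> \<in> top_cones F \<Longrightarrow> \<sigma>0 \<subseteq> \<sigma> \<Longrightarrow> w (graph_cone f \<sigma>) = c * ori F \<sigma>" by blast
    have "w \<xi> = c * ori T \<xi>" if \<xi>: "\<xi> \<in> top_cones T" "\<zeta> \<subseteq> \<xi>" for \<xi>
    proof -
      consider \<sigma> where "\<sigma> \<in> top_cones F" "\<xi> = graph_cone f \<sigma>" | \<tau> where "\<tau> \<in> div_support F f" "\<xi> = up_cone f \<tau>"
        using \<xi>(1) top_T by blast
      then show ?thesis
      proof cases
        case 11: 1
        then have "\<sigma>0 \<subseteq> \<sigma>" using \<xi>(2) 1(2) graph_subset by blast
        then show ?thesis using c(2) 11 ori_T_graph by (simp add: cones_of_dim_def)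
      next
        case 22: 2
        have \<tau>: "\<tau> \<in> cones F" "Suc (dim \<tau>) = fan_dim F" using 22(1) by (auto simp: div_support_def)
        have s: "\<sigma>0 \<subseteq> \<tau>" using \<xi>(2) 1(2) 22(2) graph_subset_up by blast
        have "w (up_cone f \<tau>) = c * ord_along F f \<tau>"
          by (rule balanced_at_T_graph(2)[OF \<tau> bg[OF \<tau> s] 22(1)]) (use c(2) s in blast)
        then show ?thesis using 22(2) ori_T_up[OF \<tau>(1)] by simp
      qed
    qed
    then show ?thesis using c(1) by blast
  next
    case (2 \<delta>0)
    have ne: "div_support F f \<noteq> {}" using 2(1) \<Delta>_cones by blast
    have \<delta>c: "\<delta>0 \<in> cones F" using 2(1) \<Delta>_cones by blast
    have "local_weight K (div_fan F f) \<delta>0 (\<lambda>\<tau>. w (up_cone f \<tau>))"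
      unfolding local_weight_def div_fan_dim(2)[OF ne]
    proof (intro conjI ballI impI)
      fix \<tau> assume "\<tau> \<in> div_support F f" "\<delta>0 \<subseteq> \<tau>"
      then show "w (up_cone f \<tau>) \<in> K" using top_T up_subset 2(2) by (intro val) auto
    next
      fix \<alpha> assume \<alpha>: "\<alpha> \<in> \<Delta>" "Suc (dim \<alpha>) = fan_dim (div_fan F f) \<and> \<delta>0 \<subseteq> \<alpha>"
      then have "\<alpha> \<in> cones F" using \<Delta>_cones by blast
      then have "balanced_at T w (up_cone f \<alpha>)"
        using \<alpha> dim_up_cone div_fan_dim(1)[OF ne] cones_T up_subset 2(2) by (intro bal) auto
      then show "balanced_at (div_fan F f) (\<lambda>\<tau>. w (up_cone f \<tau>)) \<alpha>"
        using balanced_at_T_up[OF ne \<alpha>(1)] \<alpha>(2) by blast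
    qed
    from rigidD[OF D[OF ne] 2(1) this] obtain c where
      c: "c \<in> K" "\<And>\<tau>. \<tau> \<in> div_support F f \<Longrightarrow> \<delta>0 \<subseteq> \<tau> \<Longrightarrow> w (up_cone f \<tau>) = c * ori (div_fan F f) \<tau>"
      unfolding div_fan_dim(2)[OF ne] by blast
    have "w \<xi> = c * ori T \<xi>" if \<xi>: "\<xi> \<in> top_cones T" "\<zeta> \<subseteq> \<xi>" for \<xi>
    proof -
      have "\<xi> \<notin> graph_cone f ` top_cones F" using up_not_subset_graph[OF \<delta>c] \<xi>(2) 2(2) by blast
      then obtain \<tau> where \<tau>: "\<tau> \<in> div_support F f" "\<xi> = up_cone f \<tau>" using \<xi>(1) top_T by blast
      then have "\<delta>0 \<subseteq> \<tau>" "\<tau> \<in> cones F" using \<xi>(2) 2(2) up_subset by (auto simp: div_support_def)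
      then show ?thesis using c(2)[OF \<tau>(1)] \<tau>(2) ori_T_up by (simp add: div_fan_def)
    qed
    then show ?thesis using c(1) by blast
  qed
qed

end

section \<open>The stellar subdivision as a refinement of the original fan\<close>

section \<open>Blow-ups\<close>

lemma convex_cone_ray: "convex_cone {t *\<^sub>R v | t. 0 \<le> (t::real)}"
  unfolding convex_cone_iff
proof (intro conjI ballI allI impI)
  show "0 \<in> {t *\<^sub>R v | t. 0 \<le> t}" by (auto intro!: exI[of _ "0::real"])
next
  fix x y assume "x \<in> {t *\<^sub>R v | t. 0 \<le> t}" "y \<in> {t *\<^sub>R v | t. 0 \<le> t}"
  then obtain s t where "x = s *\<^sub>R v" "y = t *\<^sub>R v" "0 \<le> s" "0 \<le> t" by blast
  then show "x + y \<in> {t *\<^sub>R v | t. 0 \<le> t}" by (auto simp: scaleR_add_left[symmetric] intro!: exI[of _ "s + t"])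
next
  fix x and c :: real assume "x \<in> {t *\<^sub>R v | t. 0 \<le> t}" "0 \<le> c"
  then obtain s where "x = s *\<^sub>R v" "0 \<le> s" by blast
  then show "c *\<^sub>R x \<in> {t *\<^sub>R v | t. 0 \<le> t}" using \<open>0 \<le> c\<close> by (auto intro!: exI[of _ "c * s"])
qed

lemma convex_cone_hull_ray: "convex_cone hull {v} = {t *\<^sub>R v | t. 0 \<le> (t::real)}"
proof (rule hull_unique)
  show "{v} \<subseteq> {t *\<^sub>R v | t. 0 \<le> (t::real)}" by (auto intro!: exI[of _ "1::real"])
  fix C assume "{v} \<subseteq> C" "convex_cone C"
  then show "{t *\<^sub>R v | t. 0 \<le> (t::real)} \<subseteq> C" by (auto intro: convex_cone_scaleR)
qed (rule convex_cone_ray)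

lemma ray_in_interiorE:
  assumes "ray_in_interior F \<sigma> \<rho>"
  obtains v where "v \<in> lat F" "v \<noteq> 0" "v \<in> \<sigma>" "\<rho> = {t *\<^sub>R v | t. 0 \<le> t}"
proof -
  obtain v where v: "v \<in> lat F" "v \<noteq> 0" "\<rho> = {t *\<^sub>R v | t. 0 \<le> t}"
    using assms unfolding ray_in_interior_def rational_ray_def by blast
  have "v \<in> \<rho> - {0}" unfolding v(3) using v(2) by (auto intro!: exI[of _ "1::real"])
  then have "v \<in> rel_interior \<sigma>" using assms unfolding ray_in_interior_def by blast
  then have "v \<in> \<sigma>" using rel_interior_subset[of \<sigma>] by blast
  then show ?thesis using that v by blast
qed

locale fan_blow_up =
  fixes F :: "('a::real_normed_vector, 'm) ofan_scheme" and \<sigma> \<rho> :: "'a set" and v :: 'a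
  assumes F: "tropical_fan F" and \<sigma>: "\<sigma> \<in> cones F"
    and v: "v \<in> lat F" "v \<noteq> 0" and v_mem: "v \<in> \<sigma>" and \<rho>: "\<rho> = {t *\<^sub>R v | t. 0 \<le> t}"
begin

lemmas rF = tropical_fan_rational[OF F]

abbreviation B :: "'a ofan" where "B \<equiv> blow_up F \<sigma> \<rho>"

lemma cones_B: "\<kappa> \<in> cones B \<longleftrightarrow> (\<kappa> \<in> cones F \<and> \<not> \<sigma> \<subseteq> \<kappa>) \<or>
    (\<exists>\<tau> \<eta>. \<kappa> = {x + y | x y. x \<in> \<tau> \<and> y \<in> \<rho>} \<and> \<tau> \<noteq> {} \<and> \<not> \<sigma> \<subseteq> \<tau> \<and> \<eta> \<in> cones F \<and> \<sigma> \<subseteq> \<eta> \<and> \<tau> face_of \<eta>)"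
  unfolding blow_up_def by auto

lemma lat_B: "lat B = lat F"
  by (simp add: blow_up_def)

lemma B_refines: "\<kappa> \<in> cones B \<Longrightarrow> \<exists>\<eta>\<in>cones F. \<kappa> \<subseteq> \<eta>"
proof -
  assume "\<kappa> \<in> cones B"
  then consider "\<kappa> \<in> cones F" | \<tau> \<eta> where "\<kappa> = {x + y | x y. x \<in> \<tau> \<and> y \<in> \<rho>}" "\<eta> \<in> cones F" "\<sigma> \<subseteq> \<eta>" "\<tau> face_of \<eta>"
    using cones_B[of \<kappa>] by blast
  then show ?thesis
  proof cases
    case 2
    note C = rational_fan_cone(1)[OF rF 2(2)]
    have "\<rho> \<subseteq> \<eta>" unfolding \<rho> using v_mem 2(3) by (auto intro!: convex_cone_scaleR[OF C])
    moreover have "\<tau> \<subseteq> \<eta>" using 2(4) face_of_imp_subset by blast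
    ultimately have "\<kappa> \<subseteq> \<eta>" unfolding 2(1) by (auto intro!: convex_cone_add[OF C])
    then show ?thesis using 2(2) by blast
  qed blast
qed

lemma B_rational: 
  assumes "\<kappa> \<in> cones B"
  shows "rational_polyhedral_cone (lat B) \<kappa>"
proof -
  consider "\<kappa> \<in> cones F"
    | \<tau> \<eta> where "\<kappa> = {x + y | x y. x \<in> \<tau> \<and> y \<in> \<rho>}" "\<tau> \<noteq> {}" "\<eta> \<in> cones F" "\<tau> face_of \<eta>"
    using cones_B[of \<kappa>] assms by blast
  then show ?thesis
  proof cases
    case 1
    then show ?thesis using rational_fanD(4)[OF rF] lat_B by simp
  next
    case 2
    have "\<tau> \<in> cones F" by (rule rational_fanD(6)[OF rF 2(3,4,2)])
    then obtain G where G: "finite G" "G \<subseteq> lat F" "\<tau> = convex_cone hull G"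
      using rational_fanD(4)[OF rF] unfolding rational_polyhedral_cone_def by blast
    have "convex_cone hull (G \<union> {v}) = (\<Union>x\<in>\<tau>. \<Union>y\<in>\<rho>. {x + y})"
      unfolding convex_cone_hull_Un G(3) convex_cone_hull_ray \<rho> ..
    also have "\<dots> = \<kappa>" unfolding 2(1) by blast
    finally show ?thesis
      unfolding rational_polyhedral_cone_def lat_B using G v(1) by (intro exI[of _ "G \<union> {v}"]) auto
  qed
qed

lemma B_strongly_convex:
  assumes "\<kappa> \<in> cones B"
  shows "strongly_convex \<kappa>"
proof -
  obtain \<eta> where \<eta>: "\<eta> \<in> cones F" "\<kappa> \<subseteq> \<eta>" using B_refines[OF assms] by blast
  have "0 \<in> \<kappa>"
    using B_rational[OF assms] rational_polyhedral_cone_fg fg_cone_convex_cone convex_cone_contains_0 by blast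
  then have "0 \<in> \<kappa> \<inter> uminus ` \<kappa>" by (auto intro: image_eqI[of _ _ 0])
  moreover have "\<kappa> \<inter> uminus ` \<kappa> \<subseteq> \<eta> \<inter> uminus ` \<eta>" using \<eta>(2) by blast
  ultimately show ?thesis using rational_fanD(5)[OF rF \<eta>(1)] unfolding strongly_convex_def by blast
qed

lemma B_spanned: "lattice_spanned B"
  unfolding lattice_spanned_def
proof (intro conjI ballI)
  show "additive_subgroup (lat B)" unfolding lat_B by (rule lattice_subgroup[OF rational_fanD(1)[OF rF]])
  fix \<kappa> assume "\<kappa> \<in> cones B"
  note r = B_rational[OF this]
  show "fin_dim \<kappa>" by (rule rational_polyhedral_cone_fin_dim[OF r])
  show "\<kappa> \<subseteq> span (lat B \<inter> \<kappa>)" by (rule rational_polyhedral_cone_spanned[OF r])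
qed

text \<open>Move \<open>x\<close> in the direction \<open>- v\<close> until it leaves the cone.\<close>

lemma B_covers:
  assumes \<eta>: "\<eta> \<in> cones F" "\<sigma> \<subseteq> \<eta>" and x: "x \<in> \<eta>"
  shows "\<exists>\<kappa>\<in>cones B. x \<in> \<kappa>"
proof -
  note C = rational_fan_cone(1)[OF rF \<eta>(1)] and fg = rational_fan_cone(3)[OF rF \<eta>(1)]
  have v\<eta>: "v \<in> \<eta>" using v_mem \<eta>(2) by blast
  \<comment> \<open>The admissible step lengths. They form a closed set by Farkas' lemma, bounded
    because strong convexity separates \<open>- v\<close> from the cone.\<close>
  define S where "S = {t. 0 \<le> t \<and> x + t *\<^sub>R (- v) \<in> \<eta>}"
  have "closed {t. x + t *\<^sub>R (- v) \<in> \<eta>}" by (rule fg_cone_closed_on_line[OF fg])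
  moreover have "S = {0..} \<inter> {t. x + t *\<^sub>R (- v) \<in> \<eta>}" unfolding S_def by auto
  ultimately have clS: "closed S" by auto
  have S0: "0 \<in> S" using x by (simp add: S_def)
  have "- v \<notin> \<eta>"
  proof
    assume "- v \<in> \<eta>"
    then have "v \<in> \<eta> \<inter> uminus ` \<eta>" using v\<eta> by (auto intro: image_eqI[of _ _ "- v"])
    then show False using rational_fanD(5)[OF rF \<eta>(1)] v(2) unfolding strongly_convex_def by blast
  qed
  then obtain h where h: "linear h" "\<forall>x\<in>\<eta>. 0 \<le> h x" "h (- v) < (0::real)" using farkas[OF fg] by blast
  have bdd: "bdd_above S"
  proof (rule bdd_aboveI)
    fix t assume "t \<in> S"
    then have "0 \<le> h (x + t *\<^sub>R (- v))" using h(2) unfolding S_def by blast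
    then have "0 \<le> h x + t * h (- v)" unfolding linear_add[OF h(1)] linear_scale[OF h(1)] by simp
    then show "t \<le> h x / - h (- v)" using h(3) by (simp add: field_simps)
  qed
  define t where "t = Sup S"
  have tS: "t \<in> S" unfolding t_def using clS S0 bdd by (intro closed_contains_Sup) auto
  have tmax: "s \<le> t" if "s \<in> S" for s unfolding t_def using bdd that by (rule cSup_upper[rotated])
  let ?y = "x + t *\<^sub>R (- v)"
  have y: "?y \<in> \<eta>" "0 \<le> t" using tS by (auto simp: S_def)
  have "?y \<in> supp F" using y(1) \<eta>(1) by (auto simp: supp_def)
  then obtain \<tau> where \<tau>: "\<tau> \<in> cones F" "?y \<in> \<tau>" "\<And>\<zeta>. \<zeta> \<in> cones F \<Longrightarrow> ?y \<in> \<zeta> \<Longrightarrow> \<tau> \<subseteq> \<zeta>"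
    using rational_fan_carrier[OF rF] by blast
  have \<tau>\<eta>: "\<tau> \<subseteq> \<eta>" by (rule \<tau>(3)[OF \<eta>(1) y(1)])
  \<comment> \<open>Otherwise the carrier \<tau> of the exit point would absorb \<open>- v\<close>
    and allow a further step. So \<tau> does not contain \<sigma>, and \<tau> with the ray added is
    a cone of the blow-up containing \<open>x\<close>.\<close>
  have "v \<notin> \<tau>"
  proof
    assume "v \<in> \<tau>"
    then have "- v \<in> span \<tau>" by (intro span_neg span_base)
    then obtain s where s: "s > 0" "s *\<^sub>R ?y + - v \<in> \<tau>"
      using rational_fan_span_absorb[OF rF \<tau>] by blast
    have "(1 / s) *\<^sub>R (s *\<^sub>R ?y + - v) \<in> \<eta>"
      using s \<tau>\<eta> by (intro convex_cone_scaleR[OF C]) auto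
    moreover have "(1 / s) *\<^sub>R (s *\<^sub>R ?y + - v) = x + (t + 1 / s) *\<^sub>R (- v)"
      using s(1) by (simp add: scaleR_add_right scaleR_add_left scaleR_diff_right)
    ultimately have "t + 1 / s \<in> S" using s(1) y(2) by (simp add: S_def)
    then show False using tmax[of "t + 1 / s"] s(1) by simp
  qed
  then have "\<not> \<sigma> \<subseteq> \<tau>" using v_mem by blast
  moreover have "\<tau> face_of \<eta>" by (rule rational_fan_subset_face[OF rF \<eta>(1) \<tau>(1) \<tau>\<eta>])
  moreover have "\<tau> \<noteq> {}" using \<tau>(2) by blast
  ultimately have cB: "{x + y | x y. x \<in> \<tau> \<and> y \<in> \<rho>} \<in> cones B"
    unfolding cones_B using \<eta> by (intro disjI2 exI[of _ \<tau>] exI[of _ \<eta>] conjI refl)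
  have "x \<in> {x + y | x y. x \<in> \<tau> \<and> y \<in> \<rho>}"
  proof -
    have "x = ?y + t *\<^sub>R v" by simp
    moreover have "t *\<^sub>R v \<in> \<rho>" unfolding \<rho> using y(2) by blast
    ultimately show ?thesis using \<tau>(2) by blast
  qed
  then show ?thesis by (rule bexI[OF _ cB])
qed

lemma supp_B: "supp B = supp F"
proof
  show "supp B \<subseteq> supp F" unfolding supp_def using B_refines by blast
  show "supp F \<subseteq> supp B"
  proof
    fix x assume "x \<in> supp F"
    then obtain \<eta> where \<eta>: "\<eta> \<in> cones F" "x \<in> \<eta>" by (auto simp: supp_def)
    have "\<exists>\<kappa>\<in>cones B. x \<in> \<kappa>"
    proof (cases "\<sigma> \<subseteq> \<eta>")
      case True
      then show ?thesis using B_covers \<eta> by blast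
    next
      case False
      then have "\<eta> \<in> cones B" unfolding cones_B using \<eta>(1) by simp
      then show ?thesis using \<eta>(2) by blast
    qed
    then show "x \<in> supp B" by (auto simp: supp_def)
  qed
qed

text \<open>The isomorphic fan \<open>G\<close> does double duty: it supplies the incidence axioms
  that make the blow-up a rational fan, and the balancing of its orientation needed for passing to
  the coarser fan.\<close>

lemma rigid_B:
  fixes G :: "('b::real_vector, 'n) ofan_scheme"
  assumes iso: "fan_iso B G" and G: "tropical_fan G"
  shows "rigid K B \<longleftrightarrow> rigid K F"
proof -
  obtain \<phi> where "fan_isomorphism B G \<phi>"
    using fan_isomorphismI[OF iso B_spanned tropical_fan_rational[OF G]] by blast
  then interpret iso: fan_isomorphism B G \<phi> .
  have "is_lattice (lat B)" unfolding lat_B by (rule rational_fanD(1)[OF rF])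
  then have rB: "rational_fan B" using iso.rational_fan_pullback B_rational B_strongly_convex by blast
  interpret ref: fan_refinement F B
    by unfold_locales (use rF rB lat_B supp_B B_refines in auto)
  \<comment> \<open>The orientation is defined through the facet containing a cone; for a top cone
    of the subdivision that facet is unique.\<close>
  have ori: "ori B \<kappa> = ori F \<eta>" if \<kappa>: "\<kappa> \<in> top_cones B" "\<eta> \<in> top_cones F" "\<kappa> \<subseteq> \<eta>" for \<kappa> \<eta>
  proof -
    have \<eta>: "\<eta> \<in> cones F" "dim \<eta> = fan_dim F" using \<kappa>(2) by (auto simp: cones_of_dim_def)
    have "\<eta> = \<zeta>" if "\<zeta> \<in> cones F" "\<eta> \<subseteq> \<zeta>" for \<zeta>
      using rational_fan_eq_of_dim[OF rF that(1) \<eta>(1) that(2)] rational_fan_dim_le[OF rF that(1)] \<eta>(2) by simp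
    then have "\<eta> \<in> facets F" using \<eta>(1) unfolding facets_def by blast
    moreover have "\<zeta> = \<eta>" if "\<zeta> \<in> facets F" "\<kappa> \<subseteq> \<zeta>" for \<zeta>
    proof -
      have "\<zeta> \<in> cones F" using that(1) by (simp add: facets_def)
      then show ?thesis
        using ref.parent_unique[OF \<kappa>(1) _ that(2)] ref.parent_unique[OF \<kappa>(1) \<eta>(1) \<kappa>(3)] by simp
    qed
    ultimately have "(THE \<eta>. \<eta> \<in> facets F \<and> \<kappa> \<subseteq> \<eta>) = \<eta>"
      using \<kappa>(3) by (intro the_equality conjI) blast+
    then show ?thesis by (simp add: blow_up_def)
  qed
  show ?thesis
  proof
    assume R: "rigid K B"
    show "rigid K F"
    proof (rule ref.rigid_coarsens[OF R])
      show "ori B \<kappa> = ori F \<eta>" if "\<kappa> \<in> top_cones B" "\<eta> \<in> top_cones F" "\<kappa> \<subseteq> \<eta>" for \<kappa> \<eta>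
        using ori[OF that] .
      show "balanced_at B (ori B) \<tau>" if "\<tau> \<in> cones B" "Suc (dim \<tau>) = fan_dim B" for \<tau>
        using iso.balanced_at_ori[OF G that] .
      show "ori F \<eta> \<noteq> 0" if "\<eta> \<in> top_cones F" for \<eta>
        using tropical_fan_ori(2)[OF F that] .
    qed
  next
    assume R: "rigid K F"
    show "rigid K B"
    proof (rule ref.rigid_refines[OF R])
      show "ori B \<kappa> = ori F \<eta>" if "\<kappa> \<in> top_cones B" "\<eta> \<in> top_cones F" "\<kappa> \<subseteq> \<eta>" for \<kappa> \<eta>
        using ori[OF that] .
    qed
  qed
qed

end

section \<open>Assembly of the stability clauses for both kinds of coefficients\<close>

section \<open>Stability\<close>

lemma fan_class_unitary: "fan_class unitary_tropical_fans"
  unfolding fan_class_def unitary_tropical_fans_def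
proof (intro conjI ballI allI impI)
  fix F G :: "universe ofan"
  assume "F \<in> {F. tropical_fan F \<and> unitary F}" and G: "tropical_fan G \<and> fan_iso F G"
  then have F: "tropical_fan F" "unitary F" by auto
  obtain \<phi> where "fan_isomorphism F G \<phi>"
    using fan_isomorphismI[of F G] rational_fan_lattice_spanned F(1) G tropical_fan_rational by blast
  then interpret fan_isomorphism F G \<phi> .
  have "unitary G" using F(2) unfolding unitary_def top_cones_eq using ori_iso by auto
  then show "G \<in> {F. tropical_fan F \<and> unitary F}" using G by blast
qed auto

lemma T_stable_locally_irreducible_over:
  assumes C: "fan_class C" and K: "\<int> \<subseteq> K" "\<And>a b. a \<in> K \<Longrightarrow> b \<in> K \<Longrightarrow> a * b \<in> K"
  shows "T_stable_in C {F \<in> C. locally_irreducible_over K F}"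
proof -
  have tr: "tropical_fan F" if "F \<in> C" for F using C that unfolding fan_class_def by blast
  have irr: "locally_irreducible_over K F \<longleftrightarrow> rigid K F" if "F \<in> C" for F
    by (rule locally_irreducible_over_iff_rigid[OF tr[OF that] K])
  then have S: "{F \<in> C. locally_irreducible_over K F} = {F \<in> C. rigid K F}" by blast
  have iso: "rigid K F \<longleftrightarrow> rigid K G" if "fan_iso F G" "lattice_spanned F" "G \<in> C"
    for F :: "('b::real_vector, 'm) ofan_scheme" and G
    by (rule rigid_fan_iso[OF that(1,2) tropical_fan_rational[OF tr[OF that(3)]]])
  \<comment> \<open>Rigidity of the construction itself passes to its copy in \<open>C\<close>, so
    each clause reduces to a statement about \<open>rigid\<close>.\<close>
  have in_class: "in_class F {F \<in> C. rigid K F}" if "in_class F C" "lattice_spanned F" "rigid K F"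
    for F :: "('b::real_vector, 'm) ofan_scheme"
    using that iso unfolding in_class_def by blast
  show ?thesis
    unfolding S T_stable_in_def
  proof (intro conjI ballI allI impI)
    show "fan_class C" by (rule C)
    show "fan_class {F \<in> C. rigid K F}"
      unfolding fan_class_def
    proof (intro conjI ballI allI impI)
      fix F G :: "universe ofan" assume F: "F \<in> {F \<in> C. rigid K F}" and G: "tropical_fan G \<and> fan_iso F G"
      then have "G \<in> C" using C unfolding fan_class_def by blast
      moreover have "lattice_spanned F"
        using F tr tropical_fan_rational rational_fan_lattice_spanned by blast
      ultimately show "G \<in> {F \<in> C. rigid K F}" using iso[of F G] F G by blast
    qed (use tr in blast)
    show "{F \<in> C. rigid K F} \<subseteq> C" by blast
  next
    fix F F' assume mem: "F \<in> {F \<in> C. rigid K F}" "F' \<in> {F \<in> C. rigid K F}" and P: "in_class (prod_fan F F') C"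
    interpret fan_product F F' by unfold_locales (use mem tr in auto)
    show "in_class (prod_fan F F') {F \<in> C. rigid K F}"
      by (rule in_class[OF P spanned_P rigid_P]) (use mem in auto)
  next
    fix F f
    assume mem: "F \<in> {F \<in> C. rigid K F}"
      and hyp: "meromorphic F f \<and> (div_trivial F f \<or> in_class (div_fan F f) {F \<in> C. rigid K F}) \<and>
        in_class (tropical_modification F f) C"
    interpret meromorphic_fan F f by unfold_locales (use mem hyp tr in auto)
    have "rigid K (div_fan F f)" if "div_support F f \<noteq> {}"
    proof -
      have "in_class (div_fan F f) {F \<in> C. rigid K F}" using hyp that unfolding div_trivial_def by blast
      then obtain G where "G \<in> C" "rigid K G" "fan_iso (div_fan F f) G" unfolding in_class_def by blast
      then show ?thesis using iso spanned_div by blast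
    qed
    then have "rigid K (tropical_modification F f)" using rigid_T mem by blast
    then show "in_class (tropical_modification F f) {F \<in> C. rigid K F}"
      using in_class[OF _ spanned_T] hyp by blast
  next
    fix F \<sigma> \<rho>
    assume mem: "F \<in> C" and cone: "\<sigma> \<in> cones F"
      and a: "ray_in_interior F \<sigma> \<rho> \<and> in_class (star_fan F \<sigma>) {F \<in> C. rigid K F} \<and>
        in_class (blow_up F \<sigma> \<rho>) C"
    from a have "ray_in_interior F \<sigma> \<rho>" by blast
    then obtain v where "v \<in> lat F" "v \<noteq> 0" "v \<in> \<sigma>" "\<rho> = {t *\<^sub>R v | t. 0 \<le> t}"
      by (rule ray_in_interiorE)
    then interpret fan_blow_up F \<sigma> \<rho> v using mem cone tr by unfold_locales
    obtain G where G: "G \<in> C" "fan_iso (blow_up F \<sigma> \<rho>) G" using a unfolding in_class_def by blast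
    have *: "rigid K (blow_up F \<sigma> \<rho>) \<longleftrightarrow> rigid K F" by (rule rigid_B[OF G(2) tr[OF G(1)]])
    show "F \<in> {F \<in> C. rigid K F} \<longleftrightarrow> in_class (blow_up F \<sigma> \<rho>) {F \<in> C. rigid K F}"
    proof
      assume "F \<in> {F \<in> C. rigid K F}"
      then show "in_class (blow_up F \<sigma> \<rho>) {F \<in> C. rigid K F}"
        using in_class B_spanned a * by blast
    next
      assume "in_class (blow_up F \<sigma> \<rho>) {F \<in> C. rigid K F}"
      then obtain H where "H \<in> C" "rigid K H" "fan_iso (blow_up F \<sigma> \<rho>) H" unfolding in_class_def by blast
      then have "rigid K (blow_up F \<sigma> \<rho>)" using iso B_spanned by blast
      then show "F \<in> {F \<in> C. rigid K F}" using mem * by blast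
    qed
  qed
qed

theorem theorem1p4:
  shows "T_stable_property Q_locally_irreducible all_tropical_fans \<and>
         T_stable_property locally_irreducible unitary_tropical_fans"
proof
  have "fan_class all_tropical_fans" by (simp add: fan_class_def all_tropical_fans_def)
  then show "T_stable_property Q_locally_irreducible all_tropical_fans"
    unfolding T_stable_property_def Q_locally_irreducible_def
    by (intro T_stable_locally_irreducible_over) (auto intro: Ints_subset_Rats[THEN subsetD])
  show "T_stable_property locally_irreducible unitary_tropical_fans"
    unfolding T_stable_property_def locally_irreducible_def
    by (intro T_stable_locally_irreducible_over fan_class_unitary) auto
qed

end
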